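(* Assume in addition $\mathbb E X_0^3<\infty$ and $\mathbb E\varepsilon_1^3<\infty$. Then $\sqrt n(\tilde\alpha_n-\alpha)\to\mathcal N(0,\sigma_{\alpha,\varepsilon}^2)$ in distribution as $n\to\infty$. Moreover, conditionally on the values $(Y_{s-1},Y_{s+1})$, $$\sqrt n\Big(\tilde\theta_n-\Big(Y_s-\frac{\alpha}{1+\alpha^2}(Y_{s-1}+Y_{s+1})-\frac{1-\alpha}{1+\alpha^2}\mu_\varepsilon\Big)\Big)\to\mathcal N(0,c_{\alpha,\varepsilon}^2)$$ in distribution as $n\to\infty$, where $$c_{\alpha,\varepsilon}^2=\frac{\sigma_{\alpha,\varepsilon}^2}{(1+\alpha^2)^4}\Big((\alpha^2-1)(Y_{s-1}+Y_{s+1})+(1+2\alpha-\alpha^2)\mu_\varepsilon\Big)^2 .$$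
   Context: INAR(1) process: Let $\alpha\in(0,1)$. Let $(\varepsilon_k)_{k\in\mathbb N}$ be i.i.d. non-negative integer-valued random variables with $\mathbb E\varepsilon_1^2<\infty$ and $\mathbb P(\varepsilon_1\ne 0)>0$; write $\mu_\varepsilon=\mathbb E\varepsilon_1$ (assumed known) and $\sigma_\varepsilon^2=\operatorname{Var}\varepsilon_1$. For each $k\in\mathbb N$ let $(\xi_{k,j})_{j\in\mathbb N}$ be i.i.d. Bernoulli random variables with mean $\alpha$, these sequences being mutually independent and independent of $(\varepsilon_k)$. Let $X_0$ be a non-negative integer-valued random variable with $\mathbb E X_0^2<\infty$, independent of all $\xi_{k,j}$ and $\varepsilon_k$, and set $X_k=\sum_{j=1}^{X_{k-1}}\xi_{k,j}+\varepsilon_k$ for $k\in\mathbb N$. This Markov chain has a unique stationary distribution; $\tilde X$ denotes a random variable with that distribution, and $$\sigma_{\alpha,\varepsilon}^2=\frac{\alpha(1-\alpha)\mathbb E\tilde X^3+\sigma_\varepsilon^2\mathbb E\tilde X^2}{(\mathbb E\tilde X^2)^2}.$$ Additive outlier: fix a known time $s\in\mathbb N$ and size $\theta\in\mathbb N$, and let $Y_k=X_k+\delta_{k,s}\theta$, $k\in\mathbb Z_+$. Write $\mathbf Y_n=(Y_0,\dots,Y_n)$. For $n\ge s+1$ and $\alpha',\theta'\in\mathbb R$, $$Q_n(\mathbf y_n;\alpha',\theta')=\sum_{\substack{k=1\\k\notin\{s,s+1\}}}^n(y_k-\alpha'y_{k-1}-\mu_\varepsilon)^2+(y_s-\alpha'y_{s-1}-\mu_\varepsilon-\theta')^2+(y_{s+1}-\alpha'y_s-\mu_\varepsilon+\alpha'\theta')^2,$$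 and $(\tilde\alpha_n,\tilde\theta_n)$ is the unique global minimizer of $(\alpha',\theta')\mapsto Q_n(\mathbf Y_n;\alpha',\theta')$ when such a unique minimizer exists, and $(0,0)$ otherwise. Conditional convergence: for random variables $\zeta_n$ and a random vector $\eta$ with values in $\mathbb Z_+^d$, "conditionally on the values $\eta$, $\zeta_n\to\mathcal N(0,v(\eta))$ in distribution" means: for every $m\in\mathbb Z_+^d$ with $\mathbb P(\eta=m)>0$, the conditional distribution of $\zeta_n$ given $\{\eta=m\}$ converges weakly to $\mathcal N(0,v(m))$ (and analogously for random vectors and covariance matrices). *)

theory Defs
  imports "HOL-Probability.Probability"
begin

datatype inar_idx = IX0 | IEps nat | IXi nat nat

definition inar_family ::
  "('a \<Rightarrow> nat) \<Rightarrow> (nat \<Rightarrow> 'a \<Rightarrow> nat) \<Rightarrow> (nat \<Rightarrow> nat \<Rightarrow> 'a \<Rightarrow> nat) \<Rightarrow> inar_idx \<Rightarrow> 'a \<Rightarrow> nat" where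
  "inar_family X0 eps xi i = (case i of IX0 \<Rightarrow> X0 | IEps k \<Rightarrow> eps k | IXi k j \<Rightarrow> xi k j)"

definition inar_indices :: "inar_idx set" where
  "inar_indices = {IX0} \<union> {IEps k | k. k \<ge> 1} \<union> {IXi k j | k j. k \<ge> 1 \<and> j \<ge> 1}"

fun inar_X ::
  "('a \<Rightarrow> nat) \<Rightarrow> (nat \<Rightarrow> 'a \<Rightarrow> nat) \<Rightarrow> (nat \<Rightarrow> nat \<Rightarrow> 'a \<Rightarrow> nat) \<Rightarrow> nat \<Rightarrow> 'a \<Rightarrow> nat" where
  "inar_X X0 eps xi 0 \<omega> = X0 \<omega>"
| "inar_X X0 eps xi (Suc k) \<omega> =
     (\<Sum>j = 1..inar_X X0 eps xi k \<omega>. xi (Suc k) j \<omega>) + eps (Suc k) \<omega>"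

definition inar_kernel :: "real \<Rightarrow> nat pmf \<Rightarrow> nat \<Rightarrow> nat pmf" where
  "inar_kernel \<alpha> p x = map_pmf (\<lambda>(b, e). b + e) (pair_pmf (binomial_pmf x \<alpha>) p)"

definition inar_stationary :: "real \<Rightarrow> nat pmf \<Rightarrow> nat pmf" where
  "inar_stationary \<alpha> p = (THE \<pi>. bind_pmf \<pi> (inar_kernel \<alpha> p) = \<pi>)"

definition inar_sigma2 :: "real \<Rightarrow> nat pmf \<Rightarrow> real" where
  "inar_sigma2 \<alpha> p =
     (let \<pi> = inar_stationary \<alpha> p;
          m2 = measure_pmf.expectation \<pi> (\<lambda>x. real x ^ 2);
          m3 = measure_pmf.expectation \<pi> (\<lambda>x. real x ^ 3);
          s2 = measure_pmf.variance p real
      in (\<alpha> * (1 - \<alpha>) * m3 + s2 * m2) / m2 ^ 2)"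

definition inar_Q :: "nat \<Rightarrow> nat \<Rightarrow> real \<Rightarrow> (nat \<Rightarrow> real) \<Rightarrow> real \<Rightarrow> real \<Rightarrow> real" where
  "inar_Q n s \<mu> y a t =
     (\<Sum>k\<in>{1..n} - {s, s + 1}. (y k - a * y (k - 1) - \<mu>)\<^sup>2)
     + (y s - a * y (s - 1) - \<mu> - t)\<^sup>2
     + (y (s + 1) - a * y s - \<mu> + a * t)\<^sup>2"

definition inar_est :: "nat \<Rightarrow> nat \<Rightarrow> real \<Rightarrow> (nat \<Rightarrow> real) \<Rightarrow> real \<times> real" where
  "inar_est n s \<mu> y =
     (if \<exists>!p. \<forall>q. inar_Q n s \<mu> y (fst p) (snd p) \<le> inar_Q n s \<mu> y (fst q) (snd q)
      then THE p. \<forall>q. inar_Q n s \<mu> y (fst p) (snd p) \<le> inar_Q n s \<mu> y (fst q) (snd q)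
      else (0, 0))"

definition normal_var :: "real \<Rightarrow> real measure" where
  "normal_var v = (if v = 0 then return borel 0 else density lborel (normal_density 0 (sqrt v)))"

end

theory Submission
  imports Defs
begin

text \<open>Minimising over the outlier size in closed form leaves a function of \<open>a\<close> alone which is, up to a
  bounded perturbation, the least squares criterion. Hence \<open>\<surd>n (a\<^sub>n - \<alpha>)\<close> agrees up to \<open>o\<^sub>P(1)\<close> with a
  martingale sum over \<open>\<surd>n\<close> divided by the average of the \<open>X\<^sub>j\<^sup>2\<close>, and the outlier estimator is \<open>Y\<^sub>s\<close>
  plus a smooth function of \<open>a\<^sub>n\<close> and the neighbouring observations.

  Both the central limit theorem for the martingale and the law of large numbers for the squares come
  from one statement about characteristic functions of additive functionals. Its proof uses the Poisson
  equation of the chain, which is solvable by polynomials because the kernel is triangular on binomial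
  coefficients, and the uniform integrability of the \<open>X\<^sub>j\<^sup>3\<close>, which follows from stochastic domination
  by \<open>X\<^sub>0\<close> plus an independent stationary variable. Starting the functional after time \<open>s + 1\<close> makes
  the limit insensitive to conditioning on the observations up to that time.\<close>

section \<open>The thinning kernel and its Poisson equation\<close>

text \<open>The conditional variance of a martingale increment is a cubic polynomial in the current
  state, so the third moments are spent on the variance and nothing is left for a Lyapunov-type
  estimate. Error terms are dominated by \<open>W x = (1 + x)^3\<close> and vanish for each fixed
  state, but they must vanish in mean uniformly over all times, for which bounded moments do not
  suffice. A dominating variable controls the expectation of every increasing function, in
  particular of the truncated tails of \<open>W\<close>. The functional limit carries an arbitrary
  event of the early history as a factor. This serves conditioning, and the whole space gives the
  unconditional case. A law of large numbers is the same statement with the characteristic function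
  of a constant as limit. The criterion is not quadratic, because \<open>a\<close> multiplies the
  outlier size in one residual. No convenient formula for the minimiser exists; it is unique once
  the sum of squares exceeds the Lipschitz constant of the derivative of the perturbation, which
  happens with probability tending to one.\<close>

lemma integral_bind_pmf_nonneg:
  fixes f :: "'b \<Rightarrow> real"
  assumes int: "integrable (bind_pmf p q) f" and pos: "\<And>x. 0 \<le> f x"
  shows "AE x in p. integrable (q x) f"
    and "integrable p (\<lambda>x. \<integral>y. f y \<partial>q x)"
    and "(\<integral>y. f y \<partial>bind_pmf p q) = (\<integral>x. \<integral>y. f y \<partial>q x \<partial>p)"
proof -
  have fin: "(\<integral>\<^sup>+x. \<integral>\<^sup>+y. f y \<partial>q x \<partial>p) < \<infinity>"
    using int pos by (simp add: integrable_iff_bounded)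
  \<comment> \<open>Where the inner integral is infinite the Bochner integral has the default value
    0, so both can be compared only off this null set.\<close>
  then have "AE x in p. (\<integral>\<^sup>+y. f y \<partial>q x) \<noteq> \<infinity>"
    by (intro nn_integral_PInf_AE) auto
  then show ae: "AE x in p. integrable (q x) f"
    by eventually_elim (auto simp: integrable_iff_bounded pos less_top)
  have ae_eq: "AE x in p. (\<integral>\<^sup>+y. f y \<partial>q x) = ennreal (\<integral>y. f y \<partial>q x)"
    using ae by eventually_elim (auto intro!: nn_integral_eq_integral simp: pos)
  have eq: "(\<integral>\<^sup>+x. \<integral>\<^sup>+y. f y \<partial>q x \<partial>p) = (\<integral>\<^sup>+x. ennreal (\<integral>y. f y \<partial>q x) \<partial>p)"
    by (intro nn_integral_cong_AE ae_eq)
  show i2: "integrable p (\<lambda>x. \<integral>y. f y \<partial>q x)"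
    using fin unfolding eq by (simp add: integrable_iff_bounded pos)
  have "ennreal (\<integral>y. f y \<partial>bind_pmf p q) = (\<integral>\<^sup>+y. f y \<partial>bind_pmf p q)"
    by (intro nn_integral_eq_integral[symmetric] int) (simp add: pos)
  also have "\<dots> = ennreal (\<integral>x. \<integral>y. f y \<partial>q x \<partial>p)"
    unfolding nn_integral_bind_pmf eq
    by (intro nn_integral_eq_integral i2) (simp add: pos)
  finally show "(\<integral>y. f y \<partial>bind_pmf p q) = (\<integral>x. \<integral>y. f y \<partial>q x \<partial>p)"
    by (simp add: pos)
qed

text \<open>Positive and negative parts reduce this to the nonnegative case. Integrability is
  demanded under the mixture only.\<close>

lemma integral_bind_pmf_real:
  fixes f :: "'b \<Rightarrow> real"
  assumes int: "integrable (bind_pmf p q) f"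
  shows "AE x in p. integrable (q x) f"
    and "integrable p (\<lambda>x. \<integral>y. f y \<partial>q x)"
    and "(\<integral>y. f y \<partial>bind_pmf p q) = (\<integral>x. \<integral>y. f y \<partial>q x \<partial>p)"
proof -
  define g h where "g = (\<lambda>y. max 0 (f y))" and "h = (\<lambda>y. max 0 (- f y))"
  have f: "f = (\<lambda>y. g y - h y)" by (auto simp: g_def h_def max_def)
  have ig: "integrable (bind_pmf p q) g" and ih: "integrable (bind_pmf p q) h"
    using int by (auto simp: g_def h_def)
  have pos: "\<And>y. 0 \<le> g y" "\<And>y. 0 \<le> h y" by (auto simp: g_def h_def)
  note G = integral_bind_pmf_nonneg[OF ig pos(1)] and H = integral_bind_pmf_nonneg[OF ih pos(2)]
  show "AE x in p. integrable (q x) f"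
    using G(1) H(1) by eventually_elim (auto simp: f)
  have ae: "AE x in p. (\<integral>y. f y \<partial>q x) = (\<integral>y. g y \<partial>q x) - (\<integral>y. h y \<partial>q x)"
    using G(1) H(1) by eventually_elim (auto simp: f)
  show "integrable p (\<lambda>x. \<integral>y. f y \<partial>q x)"
    by (subst integrable_cong_AE[OF _ _ ae]) (auto intro: G(2) H(2))
  have "(\<integral>y. f y \<partial>bind_pmf p q) = (\<integral>y. g y \<partial>bind_pmf p q) - (\<integral>y. h y \<partial>bind_pmf p q)"
    by (simp add: f ig ih)
  also have "\<dots> = (\<integral>x. (\<integral>y. g y \<partial>q x) - (\<integral>y. h y \<partial>q x) \<partial>p)"
    using G H by simp
  also have "\<dots> = (\<integral>x. \<integral>y. f y \<partial>q x \<partial>p)"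
    using ae by (intro integral_cong_AE) auto
  finally show "(\<integral>y. f y \<partial>bind_pmf p q) = (\<integral>x. \<integral>y. f y \<partial>q x \<partial>p)" .
qed

lemma complex_integrable_iff:
  "complex_integrable M f \<longleftrightarrow> integrable M (\<lambda>x. Re (f x)) \<and> integrable M (\<lambda>x. Im (f x))"
proof safe
  assume "integrable M (\<lambda>x. Re (f x))" "integrable M (\<lambda>x. Im (f x))"
  then have "complex_integrable M (\<lambda>x. of_real (Re (f x)) + \<i> * of_real (Im (f x)))"
    by (intro Bochner_Integration.integrable_add integrable_mult_right integrable_of_real)
  then show "complex_integrable M f" by (simp only: complex_eq[symmetric])
qed auto

text \<open>Characteristic functions force complex integrands; real and imaginary parts reduce them
  to the real case.\<close>

lemma integral_bind_pmf_complex: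
  fixes f :: "'b \<Rightarrow> complex"
  assumes int: "integrable (bind_pmf p q) f"
  shows "integrable p (\<lambda>x. \<integral>y. f y \<partial>q x)"
    and "(\<integral>y. f y \<partial>bind_pmf p q) = (\<integral>x. \<integral>y. f y \<partial>q x \<partial>p)"
proof -
  have iR: "integrable (bind_pmf p q) (\<lambda>y. Re (f y))" and iI: "integrable (bind_pmf p q) (\<lambda>y. Im (f y))"
    by (rule integrable_Re[OF int], rule integrable_Im[OF int])
  note R = integral_bind_pmf_real[OF iR] and I = integral_bind_pmf_real[OF iI]
  have ae: "AE x in p. integrable (q x) f"
    using R(1) I(1) by eventually_elim (simp only: complex_integrable_iff simp_thms)
  have aeR: "AE x in p. (\<integral>y. Re (f y) \<partial>q x) = Re (\<integral>y. f y \<partial>q x)"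
    and aeI: "AE x in p. (\<integral>y. Im (f y) \<partial>q x) = Im (\<integral>y. f y \<partial>q x)"
    using ae by (eventually_elim, simp)+
  have "integrable p (\<lambda>x. Re (\<integral>y. f y \<partial>q x))" "integrable p (\<lambda>x. Im (\<integral>y. f y \<partial>q x))"
    by (rule integrable_cong_AE_imp[OF R(2)], simp, use aeR in eventually_elim, simp)
      (rule integrable_cong_AE_imp[OF I(2)], simp, use aeI in eventually_elim, simp)
  then show i: "integrable p (\<lambda>x. \<integral>y. f y \<partial>q x)"
    by (simp only: complex_integrable_iff simp_thms)
  show "(\<integral>y. f y \<partial>bind_pmf p q) = (\<integral>x. \<integral>y. f y \<partial>q x \<partial>p)"
  proof (rule complex_eqI)
    have "Re (\<integral>y. f y \<partial>bind_pmf p q) = (\<integral>x. \<integral>y. Re (f y) \<partial>q x \<partial>p)"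
      unfolding R(3)[symmetric] by (rule integral_Re[OF int, symmetric])
    also have "\<dots> = (\<integral>x. Re (\<integral>y. f y \<partial>q x) \<partial>p)"
      by (rule integral_cong_AE[OF _ _ aeR]) simp_all
    finally show "Re (\<integral>y. f y \<partial>bind_pmf p q) = Re (\<integral>x. \<integral>y. f y \<partial>q x \<partial>p)"
      unfolding integral_Re[OF i] .
    have "Im (\<integral>y. f y \<partial>bind_pmf p q) = (\<integral>x. \<integral>y. Im (f y) \<partial>q x \<partial>p)"
      unfolding I(3)[symmetric] by (rule integral_Im[OF int, symmetric])
    also have "\<dots> = (\<integral>x. Im (\<integral>y. f y \<partial>q x) \<partial>p)"
      by (rule integral_cong_AE[OF _ _ aeI]) simp_all
    finally show "Im (\<integral>y. f y \<partial>bind_pmf p q) = Im (\<integral>x. \<integral>y. f y \<partial>q x \<partial>p)"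
      unfolding integral_Im[OF i] .
  qed
qed

section \<open>One step of the chain on functions of cubic growth\<close>

locale inar_law =
  fixes \<alpha> :: real and p :: "nat pmf"
  assumes \<alpha>: "0 < \<alpha>" "\<alpha> < 1"
    and p3: "integrable p (\<lambda>x. real x ^ 3)"
    and p0: "pmf p 0 < 1"
begin

abbreviation K :: "nat \<Rightarrow> nat pmf" where "K \<equiv> Defs.inar_kernel \<alpha> p"

text \<open>The polynomial growth whose expectation third moments guarantee. The shift by one keeps
  the weight above 1, so that constants are dominated, and makes it submultiplicative.\<close>

definition W :: "nat \<Rightarrow> real" where "W x = (1 + real x) ^ 3"

lemma K_0: "K 0 = p"
  using \<alpha> by (simp add: Defs.inar_kernel_def binomial_pmf_0 pair_return_pmf1 pmf.map_comp comp_def)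

text \<open>Thinning acts on individuals independently: one more parent contributes one Bernoulli
  survivor. Properties of \<open>K\<close> follow by induction on the number of parents, without the
  binomial mass function.\<close>

lemma K_Suc: "K (Suc x) = bind_pmf (bernoulli_pmf \<alpha>) (\<lambda>b. map_pmf (\<lambda>y. of_bool b + y) (K x))"
proof -
  have "K (Suc x) = bind_pmf (bernoulli_pmf \<alpha>) (\<lambda>b. bind_pmf (binomial_pmf x \<alpha>)
     (\<lambda>k. bind_pmf p (\<lambda>e. return_pmf (of_bool b + k + e))))"
    using \<alpha> by (simp add: Defs.inar_kernel_def binomial_pmf_Suc pair_pmf_def map_bind_pmf
        bind_assoc_pmf bind_return_pmf of_bool_def)
  also have "\<dots> = bind_pmf (bernoulli_pmf \<alpha>) (\<lambda>b. map_pmf (\<lambda>y. of_bool b + y) (K x))"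
    by (simp add: Defs.inar_kernel_def pair_pmf_def map_bind_pmf bind_assoc_pmf bind_return_pmf add.assoc)
  finally show ?thesis .
qed

lemma nn_integral_K_Suc:
  "(\<integral>\<^sup>+y. f y \<partial>K (Suc x)) = ennreal \<alpha> * (\<integral>\<^sup>+y. f (Suc y) \<partial>K x) + ennreal (1 - \<alpha>) * (\<integral>\<^sup>+y. f y \<partial>K x)"
  using \<alpha> by (simp add: K_Suc mult.commute)

lemma W_ge1: "1 \<le> W x"
  by (simp add: W_def one_le_power)

lemma W_pos: "0 < W x" using W_ge1[of x] by linarith

lemma W_Suc: "W (Suc y) \<le> 8 * W y"
proof -
  have "W (Suc y) \<le> (2 * (1 + real y)) ^ 3" unfolding W_def by (intro power_mono) auto
  then show ?thesis unfolding W_def power_mult_distrib by simp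
qed

lemma W_le_power3: "W x \<le> 8 * (real x ^ 3 + 1)"
proof (cases x)
  case (Suc n)
  then have "W x \<le> (2 * real x) ^ 3" unfolding W_def by (intro power_mono) auto
  then show ?thesis by (simp add: power_mult_distrib)
qed (simp add: W_def)

lemma integrable_W_K: "integrable (K x) W"
proof -
  have "(\<integral>\<^sup>+y. ennreal (W y) \<partial>K x) < \<infinity>"
  proof (induction x)
    case 0
    have "integrable p W"
    proof (rule Bochner_Integration.integrable_bound)
      show "integrable p (\<lambda>x. 8 * (real x ^ 3 + 1))" using p3 by simp
      show "AE x in p. norm (W x) \<le> norm (8 * (real x ^ 3 + 1))"
        using W_pos W_le_power3 by (simp add: less_imp_le)
    qed simp
    then show ?case using W_pos by (simp add: K_0 integrable_iff_bounded less_imp_le)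
  next
    case (Suc x)
    have "(\<integral>\<^sup>+y. ennreal (W (Suc y)) \<partial>K x) \<le> (\<integral>\<^sup>+y. 8 * ennreal (W y) \<partial>K x)"
      using W_Suc W_pos by (intro nn_integral_mono) (simp add: less_imp_le flip: ennreal_mult' ennreal_numeral)
    also have "\<dots> = 8 * (\<integral>\<^sup>+y. ennreal (W y) \<partial>K x)" by (simp add: nn_integral_cmult)
    also have "\<dots> < \<infinity>" using Suc by (simp add: ennreal_mult_less_top)
    finally show ?case using Suc by (simp add: nn_integral_K_Suc ennreal_mult_less_top)
  qed
  then show ?thesis using W_pos by (simp add: integrable_iff_bounded less_imp_le)
qed

text \<open>Finiteness of the supremum norm weighted by \<open>W\<close>. No sign condition on
  \<open>C\<close> is needed, since \<open>W 0 = 1\<close> forces \<open>C\<close> to be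
  nonnegative.\<close>

definition cubic :: "(nat \<Rightarrow> 'b::real_normed_vector) \<Rightarrow> bool" where
  "cubic f \<longleftrightarrow> (\<exists>C. \<forall>x. norm (f x) \<le> C * W x)"

lemma cubicI: "(\<And>x. norm (f x) \<le> C * W x) \<Longrightarrow> cubic f"
  by (auto simp: cubic_def)

lemma cubicE:
  assumes "cubic f" obtains C where "0 \<le> C" "\<And>x. norm (f x) \<le> C * W x"
proof -
  obtain C where C: "\<And>x. norm (f x) \<le> C * W x" using assms by (auto simp: cubic_def)
  have "0 \<le> C * W 0" using C[of 0] norm_ge_zero order_trans by blast
  then have "0 \<le> C" by (simp add: W_def)
  with C that show ?thesis by blast
qed

lemma cubic_const [intro, simp]: "cubic (\<lambda>x. c)"
  by (rule cubicI[of _ "norm c"]) (use W_ge1 in \<open>simp add: mult_le_cancel_left1\<close>)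

lemma cubic_add [intro]:
  assumes "cubic f" "cubic g" shows "cubic (\<lambda>x. f x + g x)"
proof -
  obtain C where C: "\<And>x. norm (f x) \<le> C * W x" using cubicE[OF assms(1)] by blast
  obtain D where D: "\<And>x. norm (g x) \<le> D * W x" using cubicE[OF assms(2)] by blast
  have "norm (f x + g x) \<le> (C + D) * W x" for x
    using norm_triangle_mono[OF C D, of x x] by (simp add: distrib_right)
  then show ?thesis by (rule cubicI)
qed

lemma cubic_cmult [intro]:
  fixes f :: "nat \<Rightarrow> 'b::real_normed_algebra"
  assumes "cubic f" shows "cubic (\<lambda>x. c * f x)"
proof -
  obtain C where C: "0 \<le> C" "\<And>x. norm (f x) \<le> C * W x" using cubicE[OF assms(1)] by blast
  have "norm (c * f x) \<le> (norm c * C) * W x" for x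
    using order_trans[OF norm_mult_ineq mult_left_mono[OF C(2)[of x], of "norm c"]]
    by (simp add: mult.assoc)
  then show ?thesis by (rule cubicI)
qed

lemma cubic_diff [intro]: "cubic f \<Longrightarrow> cubic g \<Longrightarrow> cubic (\<lambda>x. f x - g x)"
  using cubic_add[of f "\<lambda>x. - g x"] by (simp add: cubic_def)

lemma cubic_of_real [intro]: "cubic f \<Longrightarrow> cubic (\<lambda>x. of_real (f x) :: 'b::real_normed_algebra_1)"
  by (simp add: cubic_def)

lemma cubic_bound: "(\<And>x. norm (g x) \<le> norm (f x)) \<Longrightarrow> cubic f \<Longrightarrow> cubic g"
  unfolding cubic_def by (meson order_trans)

lemma integrable_cubic:
  fixes f :: "nat \<Rightarrow> 'b::{banach, second_countable_topology}"
  assumes "cubic f" "integrable (measure_pmf q) W" shows "integrable (measure_pmf q) f"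
proof -
  obtain C where C: "0 \<le> C" "\<And>x. norm (f x) \<le> C * W x" using cubicE[OF assms(1)] by blast
  show ?thesis
  proof (rule Bochner_Integration.integrable_bound)
    show "integrable q (\<lambda>x. C * W x)" using assms by simp
    show "AE x in q. norm (f x) \<le> norm (C * W x)"
      using C W_pos by (simp add: abs_mult less_imp_le)
  qed simp
qed

lemmas integrable_cubic_K = integrable_cubic[OF _ integrable_W_K]

lemma cubic_Suc: assumes "cubic f" shows "cubic (\<lambda>x. f (Suc x))"
proof -
  obtain C where C: "0 \<le> C" "\<And>x. norm (f x) \<le> C * W x" using cubicE[OF assms(1)] by blast
  have "norm (f (Suc x)) \<le> (8 * C) * W x" for x
    using order_trans[OF C(2) mult_left_mono[OF W_Suc C(1)], of x] by (simp add: ac_simps)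
  then show ?thesis by (rule cubicI)
qed

text \<open>Subtracting the integral over \<open>K x\<close> shows that differencing commutes with
  the kernel up to the factor \<alpha>. This yields both the triangular action on binomial
  coefficients and the contraction of Lipschitz constants.\<close>

lemma integral_K_Suc:
  fixes f :: "nat \<Rightarrow> real"
  assumes "cubic f"
  shows "(\<integral>y. f y \<partial>K (Suc x)) = \<alpha> * (\<integral>y. f (Suc y) \<partial>K x) + (1 - \<alpha>) * (\<integral>y. f y \<partial>K x)"
proof -
  have "integrable (K (Suc x)) f" by (rule integrable_cubic_K[OF assms])
  then show ?thesis using \<alpha> unfolding K_Suc
    by (subst integral_bind_pmf_real(3)) auto
qed

section \<open>Binomial coefficients as a triangular basis, and solvability of the Poisson
  equation\<close>

definition binom :: "nat \<Rightarrow> nat \<Rightarrow> real" where "binom j x = real (x choose j)"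

definition eps_moment :: "nat \<Rightarrow> real" where "eps_moment j = (\<integral>y. binom j y \<partial>p)"

lemma binom_1: "binom 1 x = real x"
  by (simp add: binom_def)

lemma binom_Suc: "binom (Suc j) (Suc x) = binom (Suc j) x + binom j x"
  by (simp add: binom_def)

lemma binom_Suc_low: "binom 1 (Suc x) = binom 1 x + 1" "binom 2 (Suc x) = binom 2 x + binom 1 x"
    "binom 3 (Suc x) = binom 3 x + binom 2 x"
  using binom_Suc[of 1 x] binom_Suc[of 2 x] by (simp_all add: binom_def eval_nat_numeral)

lemma binom_2: "binom 2 x = real x * (real x - 1) / 2"
  by (induction x) (simp_all add: binom_Suc_low binom_1 field_simps del: One_nat_def, simp add: binom_def)

lemma binom_3: "binom 3 x = real x * (real x - 1) * (real x - 2) / 6"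
  by (induction x) (simp_all add: binom_Suc_low binom_2 field_simps del: One_nat_def, simp add: binom_def)

lemma powers_binom: "real x ^ 2 = 2 * binom 2 x + binom 1 x" "real x ^ 3 = 6 * binom 3 x + 6 * binom 2 x + binom 1 x"
  unfolding binom_1 binom_2 binom_3 by (simp_all add: power2_eq_square power3_eq_cube field_simps)

lemma W_binom: "W x = 6 * binom 3 x + 12 * binom 2 x + 7 * binom 1 x + 1"
  unfolding binom_1 binom_2 binom_3 W_def by (simp add: power3_eq_cube field_simps)

lemma binom_nonneg: "0 \<le> binom j x" by (simp add: binom_def)

lemma binom_le_W: "binom 1 x \<le> W x" "binom 2 x \<le> W x" "binom 3 x \<le> W x"
  using binom_nonneg[of 1 x] binom_nonneg[of 2 x] binom_nonneg[of 3 x] unfolding W_binom by linarith+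

lemma cubic_binom: "cubic (binom 1)" "cubic (binom 2)" "cubic (binom 3)"
  by (rule cubicI[of _ 1]; use binom_le_W binom_nonneg in simp)+

lemma eps_moment_nonneg: "0 \<le> eps_moment j" unfolding eps_moment_def by (simp add: binom_nonneg)

text \<open>Pascal's rule lowers the degree under differencing, so the action of the kernel in
  degree \<open>Suc j\<close> is a discrete antiderivative of \<alpha> times its action in degree
  \<open>j\<close>.\<close>

lemma integral_K_binom_step:
  assumes "cubic (binom (Suc j))" "cubic (binom j)"
  shows "(\<integral>y. binom (Suc j) y \<partial>K (Suc x)) = (\<integral>y. binom (Suc j) y \<partial>K x) + \<alpha> * (\<integral>y. binom j y \<partial>K x)"
  using integral_K_Suc[OF assms(1), of x] assms[THEN integrable_cubic_K, of x]
  by (simp add: binom_Suc algebra_simps)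

lemma integral_K_binom_1: "(\<integral>y. binom 1 y \<partial>K x) = eps_moment 1 + \<alpha> * binom 1 x"
proof (induction x)
  case (Suc x)
  have c: "binom 0 = (\<lambda>x. 1)" by (simp add: binom_def fun_eq_iff)
  have "(\<integral>y. binom (Suc 0) y \<partial>K (Suc x)) = (\<integral>y. binom (Suc 0) y \<partial>K x) + \<alpha> * (\<integral>y. binom 0 y \<partial>K x)"
    by (rule integral_K_binom_step) (use cubic_binom c in simp_all)
  then show ?case using Suc c unfolding binom_Suc_low by (simp add: algebra_simps)
qed (simp add: K_0 eps_moment_def binom_def)

lemma integral_K_binom_2: "(\<integral>y. binom 2 y \<partial>K x) = eps_moment 2 + \<alpha> * eps_moment 1 * binom 1 x + \<alpha>\<^sup>2 * binom 2 x"
proof (induction x)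
  case (Suc x)
  have "(\<integral>y. binom (Suc 1) y \<partial>K (Suc x)) = (\<integral>y. binom (Suc 1) y \<partial>K x) + \<alpha> * (\<integral>y. binom 1 y \<partial>K x)"
    by (rule integral_K_binom_step) (use cubic_binom in \<open>simp_all add: numeral_2_eq_2\<close>)
  then have "(\<integral>y. binom 2 y \<partial>K (Suc x)) = (\<integral>y. binom 2 y \<partial>K x) + \<alpha> * (\<integral>y. binom 1 y \<partial>K x)"
    by (simp add: numeral_2_eq_2)
  then show ?case using Suc unfolding integral_K_binom_1 binom_Suc_low
    by (simp add: power2_eq_square algebra_simps)
qed (simp add: K_0 eps_moment_def binom_def)

text \<open>With the two preceding formulas this is Vandermonde's identity in expectation: the
  binomial count contributes \<open>\<alpha> ^ i * binom i x\<close> and the innovation its moment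
  of complementary degree.\<close>

lemma integral_K_binom_3:
  "(\<integral>y. binom 3 y \<partial>K x) = eps_moment 3 + \<alpha> * eps_moment 2 * binom 1 x + \<alpha>\<^sup>2 * eps_moment 1 * binom 2 x + \<alpha> ^ 3 * binom 3 x"
proof (induction x)
  case (Suc x)
  have "(\<integral>y. binom (Suc 2) y \<partial>K (Suc x)) = (\<integral>y. binom (Suc 2) y \<partial>K x) + \<alpha> * (\<integral>y. binom 2 y \<partial>K x)"
    by (rule integral_K_binom_step) (use cubic_binom in \<open>simp_all add: eval_nat_numeral\<close>)
  then have "(\<integral>y. binom 3 y \<partial>K (Suc x)) = (\<integral>y. binom 3 y \<partial>K x) + \<alpha> * (\<integral>y. binom 2 y \<partial>K x)"
    by (simp add: eval_nat_numeral)
  then show ?case using Suc unfolding integral_K_binom_2 binom_Suc_low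
    by (simp add: power2_eq_square power3_eq_cube algebra_simps)
qed (simp add: K_0 eps_moment_def binom_def numeral_3_eq_3 numeral_2_eq_2)

text \<open>\<open>W\<close> is a nonnegative combination of binomial coefficients up to degree 3,
  and \<open>K\<close> maps their span into itself.\<close>

lemma cubic_integral_K:
  fixes f :: "nat \<Rightarrow> 'b::{banach, second_countable_topology}"
  assumes "cubic f" shows "cubic (\<lambda>x. \<integral>y. f y \<partial>K x)"
proof -
  obtain C where C: "0 \<le> C" "\<And>x. norm (f x) \<le> C * W x" using cubicE[OF assms(1)] by blast
  have "norm (\<integral>y. f y \<partial>K x) \<le> norm (C * (\<integral>y. W y \<partial>K x))" for x
  proof -
    have "norm (\<integral>y. f y \<partial>K x) \<le> (\<integral>y. norm (f y) \<partial>K x)" by simp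
    also have "\<dots> \<le> (\<integral>y. C * W y \<partial>K x)"
      by (intro integral_mono) (use C integrable_W_K integrable_cubic_K[OF assms] in auto)
    finally show ?thesis by simp
  qed
  moreover have W: "(\<integral>y. W y \<partial>K x) = 6 * (\<integral>y. binom 3 y \<partial>K x) + 12 * (\<integral>y. binom 2 y \<partial>K x) + 7 * (\<integral>y. binom 1 y \<partial>K x) + 1" for x
    unfolding W_binom using cubic_binom[THEN integrable_cubic_K] by simp
  have "cubic (\<lambda>x. C * (\<integral>y. W y \<partial>K x))"
    unfolding W integral_K_binom_1 integral_K_binom_2 integral_K_binom_3
    by (intro cubic_add cubic_cmult cubic_binom cubic_const)
  ultimately show ?thesis by (rule cubic_bound)
qed

text \<open>The additive constant stays free, so that sums and multiples can be formed before a
  stationary law is known; \<open>poisson_equation\<close> identifies it.\<close>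

definition solvable :: "(nat \<Rightarrow> real) \<Rightarrow> bool" where
  "solvable g \<longleftrightarrow> (\<exists>h v. cubic h \<and> (\<forall>x. h x - (\<integral>y. h y \<partial>K x) = g x - v))"

lemma solvable_const: "solvable (\<lambda>x. c)"
  unfolding solvable_def by (rule exI[of _ "\<lambda>x. 0"], rule exI[of _ c]) auto

lemma solvable_range: "cubic h \<Longrightarrow> solvable (\<lambda>x. h x - (\<integral>y. h y \<partial>K x))"
  unfolding solvable_def by (rule exI[of _ h], rule exI[of _ 0]) auto

lemma solvable_add: assumes "solvable f" "solvable g" shows "solvable (\<lambda>x. f x + g x)"
proof -
  obtain h v where h: "cubic h" "\<And>x. h x - (\<integral>y. h y \<partial>K x) = f x - v"
    using assms by (auto simp: solvable_def)
  obtain k w where k: "cubic k" "\<And>x. k x - (\<integral>y. k y \<partial>K x) = g x - w"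
    using assms by (auto simp: solvable_def)
  have "(h x + k x) - (\<integral>y. h y + k y \<partial>K x) = (f x + g x) - (v + w)" for x
    using h(2)[of x] k(2)[of x] h(1) k(1)
    by (subst Bochner_Integration.integral_add) (auto intro: integrable_cubic_K)
  then show ?thesis unfolding solvable_def using h(1) k(1) by (blast intro: cubic_add)
qed

lemma solvable_cmult: assumes "solvable f" shows "solvable (\<lambda>x. c * f x)"
proof -
  obtain h v where h: "cubic h" "\<And>x. h x - (\<integral>y. h y \<partial>K x) = f x - v"
    using assms by (auto simp: solvable_def)
  have "c * h x - (\<integral>y. c * h y \<partial>K x) = c * f x - c * v" for x
    using arg_cong[OF h(2)[of x], of "\<lambda>z. c * z"] by (simp add: algebra_simps)
  then show ?thesis unfolding solvable_def using h(1) by (blast intro: cubic_cmult)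
qed

lemma solvable_divide: "d \<noteq> 0 \<Longrightarrow> solvable (\<lambda>x. d * f x) \<Longrightarrow> solvable f"
  using solvable_cmult[of "\<lambda>x. d * f x" "1 / d"] by simp

text \<open>In degree \<open>j\<close> the diagonal entry of the kernel is
  \<open>\<alpha> ^ j\<close>, different from 1, so \<open>binom j\<close> divided by
  \<open>1 - \<alpha> ^ j\<close> solves the equation up to lower degrees, which are already
  settled.\<close>

lemma solvable_binom: "solvable (binom 1)" "solvable (binom 2)" "solvable (binom 3)"
proof -
  have ne: "1 - \<alpha> \<noteq> 0" "1 - \<alpha>\<^sup>2 \<noteq> 0" "1 - \<alpha> ^ 3 \<noteq> 0"
    using \<alpha> power_less_one_iff[of \<alpha> 2] power_less_one_iff[of \<alpha> 3] by simp_all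
  have 1: "(\<lambda>x. (1 - \<alpha>) * binom 1 x) = (\<lambda>x. (binom 1 x - (\<integral>y. binom 1 y \<partial>K x)) + eps_moment 1)"
    unfolding integral_K_binom_1 by (simp add: fun_eq_iff algebra_simps del: One_nat_def)
  show s1: "solvable (binom 1)"
    by (rule solvable_divide[OF ne(1)], unfold 1)
      (rule solvable_add[OF solvable_range[OF cubic_binom(1)] solvable_const])
  have 2: "(\<lambda>x. (1 - \<alpha>\<^sup>2) * binom 2 x) =
      (\<lambda>x. (binom 2 x - (\<integral>y. binom 2 y \<partial>K x)) + (eps_moment 2 + (\<alpha> * eps_moment 1) * binom 1 x))"
    unfolding integral_K_binom_2 by (simp add: fun_eq_iff algebra_simps del: One_nat_def)
  show s2: "solvable (binom 2)"
    by (rule solvable_divide[OF ne(2)], unfold 2)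
      (rule solvable_add[OF solvable_range[OF cubic_binom(2)] solvable_add[OF solvable_const solvable_cmult[OF s1]]])
  have 3: "(\<lambda>x. (1 - \<alpha>^3) * binom 3 x) = (\<lambda>x. (binom 3 x - (\<integral>y. binom 3 y \<partial>K x)) +
      (eps_moment 3 + ((\<alpha> * eps_moment 2) * binom 1 x + (\<alpha>\<^sup>2 * eps_moment 1) * binom 2 x)))"
    unfolding integral_K_binom_3 by (simp add: fun_eq_iff algebra_simps del: One_nat_def)
  show "solvable (binom 3)"
    by (rule solvable_divide[OF ne(3)], unfold 3)
      (rule solvable_add[OF solvable_range[OF cubic_binom(3)] solvable_add[OF solvable_const
        solvable_add[OF solvable_cmult[OF s1] solvable_cmult[OF s2]]]])
qed

end

section \<open>The stationary distribution and uniform integrability\<close>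

text \<open>Both total masses are 1, so a pointwise inequality leaves no slack. Fatou's lemma yields
  invariance of a limit law only as an inequality, and this closes the gap.\<close>

lemma pmf_le_imp_eq:
  assumes "\<And>i. pmf p i \<le> pmf q i" shows "p = q"
proof (rule pmf_eqI, rule antisym)
  fix i
  have "emeasure p (- {i}) \<le> emeasure q (- {i})"
    unfolding nn_integral_pmf[symmetric] by (intro nn_integral_mono ennreal_leI assms)
  then have "measure p (- {i}) \<le> measure q (- {i})"
    by (simp add: measure_pmf.emeasure_eq_measure)
  moreover have "measure r (- {i}) = 1 - pmf r i" for r :: "'a pmf"
    using measure_pmf.prob_compl[of "{i}" r] by (simp add: Compl_eq_Diff_UNIV measure_pmf_single)
  ultimately show "pmf q i \<le> pmf p i" by simp
qed (rule assms)

lemma affine_recursion_bounded: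
  fixes u :: "nat \<Rightarrow> real"
  assumes "0 \<le> \<beta>" "\<beta> < 1" "\<And>n. u (Suc n) \<le> \<beta> * u n + C"
  obtains D where "\<And>n. u n \<le> D"
proof -
  \<comment> \<open>The larger of the starting value and the fixed point of the affine map, so that
    \<open>D\<close> is mapped to at most \<open>D\<close>.\<close>
  define D where "D = max (u 0) (C / (1 - \<beta>))"
  have "C \<le> D * (1 - \<beta>)" using assms by (simp add: D_def field_simps max_def)
  then have D: "\<beta> * D + C \<le> D" by (simp add: algebra_simps)
  have "u n \<le> D" for n
  proof (induction n)
    case (Suc n)
    then have "\<beta> * u n \<le> \<beta> * D" using assms by (simp add: mult_left_mono)
    then show ?case using assms(3)[of n] D by linarith
  qed (simp add: D_def)
  then show ?thesis using that by blast
qed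

lemma integrable_bounded_pmf:
  fixes f :: "'a \<Rightarrow> real"
  assumes "\<And>x. \<bar>f x\<bar> \<le> C" shows "integrable (measure_pmf q) f"
  by (rule measure_pmf.integrable_const_bound[where B=C]) (use assms in auto)

context inar_law
begin

section \<open>Contraction of the transition operator and uniqueness of the stationary law\<close>

abbreviation B :: "nat pmf \<Rightarrow> nat pmf" where "B q \<equiv> bind_pmf q K"

abbreviation T :: "(nat \<Rightarrow> real) \<Rightarrow> nat \<Rightarrow> real" where "T f x \<equiv> \<integral>y. f y \<partial>K x"

lemma bounded_imp_cubic: "(\<And>x. norm (f x) \<le> C) \<Longrightarrow> cubic f"
  by (rule cubic_bound[of _ "\<lambda>x. C"]) (auto intro: order_trans[OF _ abs_ge_self])

text \<open>This is the dual form of a Wasserstein contraction: chains started one individual apart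
  can be coupled so that the extra individual survives a step with probability \<alpha>.\<close>

lemma T_contraction:
  assumes "cubic f" "\<And>x. \<bar>f (Suc x) - f x\<bar> \<le> L"
  shows "\<bar>T f (Suc x) - T f x\<bar> \<le> \<alpha> * L"
proof -
  have "T f (Suc x) - T f x = \<alpha> * (\<integral>y. f (Suc y) - f y \<partial>K x)"
    using integral_K_Suc[OF assms(1)] integrable_cubic_K[OF assms(1)] integrable_cubic_K[OF cubic_Suc[OF assms(1)]]
    by (simp add: algebra_simps)
  moreover have "\<bar>\<integral>y. f (Suc y) - f y \<partial>K x\<bar> \<le> L"
  proof -
    have "\<bar>\<integral>y. f (Suc y) - f y \<partial>K x\<bar> \<le> (\<integral>y. \<bar>f (Suc y) - f y\<bar> \<partial>K x)"
      by (rule integral_abs_bound)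
    also have "\<dots> \<le> (\<integral>y. L \<partial>K x)"
      using integrable_cubic_K[OF assms(1)] integrable_cubic_K[OF cubic_Suc[OF assms(1)]] assms(2)
      by (intro integral_mono) auto
    finally show ?thesis by simp
  qed
  ultimately show ?thesis using \<alpha> by (simp add: abs_mult)
qed

lemma iterate_T_bounded:
  assumes "\<And>x. \<bar>f x\<bar> \<le> C" shows "\<bar>(T ^^ n) f x\<bar> \<le> C"
proof (induction n arbitrary: x)
  case (Suc n)
  have "\<bar>T ((T ^^ n) f) x\<bar> \<le> (\<integral>y. \<bar>(T ^^ n) f y\<bar> \<partial>K x)" by (rule integral_abs_bound)
  also have "\<dots> \<le> (\<integral>y. C \<partial>K x)"
    by (intro integral_mono integrable_abs integrable_bounded_pmf[OF Suc] Suc) simp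
  finally show ?case by simp
qed (use assms in simp)

lemma iterate_T_contraction:
  assumes f: "\<And>x. \<bar>f x\<bar> \<le> C"
  shows "\<bar>(T ^^ n) f x - (T ^^ n) f 0\<bar> \<le> \<alpha> ^ n * (2 * C) * real x"
proof -
  have step: "\<bar>(T ^^ n) f (Suc x) - (T ^^ n) f x\<bar> \<le> \<alpha> ^ n * (2 * C)" for x
  proof (induction n arbitrary: x)
    case 0
    show ?case using f[of x] f[of "Suc x"] by simp
  next
    case (Suc n)
    have "cubic ((T ^^ n) f)" by (rule bounded_imp_cubic[of _ C]) (use iterate_T_bounded[OF f] in simp)
    from T_contraction[OF this Suc] show ?case by (simp add: mult.assoc)
  qed
  show ?thesis
  proof (induction x)
    case (Suc x)
    then show ?case using step[of x] by (simp add: algebra_simps)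
  qed simp
qed

lemma integral_iterate_T:
  fixes q :: "nat pmf"
  assumes f: "\<And>x. \<bar>f x\<bar> \<le> C"
  shows "(\<integral>x. (T ^^ n) f x \<partial>q) = (\<integral>x. f x \<partial>(B ^^ n) q)"
proof (induction n arbitrary: q)
  case (Suc n)
  have "(\<integral>x. (T ^^ Suc n) f x \<partial>q) = (\<integral>x. (T ^^ n) f x \<partial>B q)"
    by (subst integral_bind_pmf_real(3)) (auto intro: integrable_bounded_pmf iterate_T_bounded[OF f])
  also have "\<dots> = (\<integral>x. f x \<partial>(B ^^ n) (B q))" by (rule Suc)
  finally show ?case by (simp only: funpow_Suc_right o_apply)
qed simp

text \<open>The Lipschitz constants of the iterates decay geometrically while their values stay
  bounded, so dominated convergence works even for an initial law without moments.\<close>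

lemma iterate_T_flat:
  fixes q :: "nat pmf"
  assumes f: "\<And>x. \<bar>f x\<bar> \<le> C"
  shows "(\<lambda>n. (\<integral>x. f x \<partial>(B ^^ n) q) - (T ^^ n) f 0) \<longlonglongrightarrow> 0"
proof -
  have bnd: "\<bar>(T ^^ n) f x\<bar> \<le> C" for n x by (rule iterate_T_bounded[OF f])
  have "(\<lambda>n. \<integral>x. (T ^^ n) f x - (T ^^ n) f 0 \<partial>q) \<longlonglongrightarrow> (\<integral>x. 0 \<partial>q)"
  proof (rule integral_dominated_convergence)
    show "AE x in q. (\<lambda>n. (T ^^ n) f x - (T ^^ n) f 0) \<longlonglongrightarrow> 0"
    proof (rule AE_I2)
      fix x
      have "(\<lambda>n. \<alpha> ^ n * (2 * C) * real x) \<longlonglongrightarrow> 0 * (2 * C) * real x"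
        using \<alpha> by (intro tendsto_intros LIMSEQ_power_zero) auto
      then show "(\<lambda>n. (T ^^ n) f x - (T ^^ n) f 0) \<longlonglongrightarrow> 0"
        unfolding mult_zero_left
        by (rule Lim_null_comparison[rotated])
          (intro always_eventually allI, simp only: real_norm_def iterate_T_contraction[OF f])
    qed
    show "AE x in q. norm ((T ^^ n) f x - (T ^^ n) f 0) \<le> 2 * C" for n
    proof (rule AE_I2)
      fix x
      show "norm ((T ^^ n) f x - (T ^^ n) f 0) \<le> 2 * C"
        using norm_triangle_ineq4[of "(T ^^ n) f x" "(T ^^ n) f 0"] bnd[of n x] bnd[of n 0]
        unfolding real_norm_def by linarith
    qed
  qed auto
  moreover have "(\<integral>x. (T ^^ n) f x - (T ^^ n) f 0 \<partial>q) = (\<integral>x. f x \<partial>(B ^^ n) q) - (T ^^ n) f 0" for n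
    unfolding integral_iterate_T[OF f, symmetric]
    by (subst Bochner_Integration.integral_diff) (auto intro: integrable_bounded_pmf bnd)
  ultimately show ?thesis by simp
qed

lemma pmf_eq_integral: fixes q :: "nat pmf" shows "pmf q m = (\<integral>x. indicator {m} x \<partial>measure_pmf q)"
  by (simp add: measure_pmf_single)

text \<open>\<open>inar_stationary\<close> is a definite description over all distributions, so
  uniqueness must hold among laws without moments as well. Every stationary law gives
  \<open>m\<close> the limit of the iterates at state 0.\<close>

lemma stationary_unique:
  assumes "B \<pi> = \<pi>" "B \<rho> = \<rho>" shows "\<pi> = \<rho>"
proof (rule pmf_eqI)
  fix m
  let ?f = "indicator {m} :: nat \<Rightarrow> real"
  have f: "\<bar>?f x\<bar> \<le> 1" for x by (simp add: indicator_def)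
  have lim: "(\<lambda>n. (T ^^ n) ?f 0) \<longlonglongrightarrow> pmf \<sigma> m" if "B \<sigma> = \<sigma>" for \<sigma>
  proof -
    have it: "(B ^^ n) \<sigma> = \<sigma>" for n using that by (induction n) auto
    have "(\<lambda>n. pmf \<sigma> m - (T ^^ n) ?f 0) \<longlonglongrightarrow> 0"
      using iterate_T_flat[where f="?f" and q=\<sigma>, OF f] unfolding it pmf_eq_integral .
    from tendsto_diff[OF tendsto_const this, of "pmf \<sigma> m"] show ?thesis
      by (simp only: diff_diff_eq2 diff_zero add_diff_cancel_left')
  qed
  have "(\<lambda>n. (T ^^ n) ?f 0) \<longlonglongrightarrow> pmf \<pi> m" "(\<lambda>n. (T ^^ n) ?f 0) \<longlonglongrightarrow> pmf \<rho> m"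
    by (intro lim assms)+
  then show "pmf \<pi> m = pmf \<rho> m" by (rule LIMSEQ_unique)
qed

section \<open>Moment bounds and existence of the stationary law\<close>

lemma integrable_W_B:
  fixes q :: "nat pmf"
  assumes "integrable (measure_pmf q) W" shows "integrable (B q) W"
proof -
  have "integrable q (T W)"
    by (rule integrable_cubic[OF cubic_integral_K assms]) (rule cubicI[of _ 1], use W_pos in \<open>simp add: less_imp_le\<close>)
  moreover have "0 \<le> T W x" for x using W_pos by (simp add: less_imp_le)
  moreover have "(\<integral>\<^sup>+y. W y \<partial>K x) = ennreal (T W x)" for x
    by (rule nn_integral_eq_integral[OF integrable_W_K]) (use W_pos in \<open>simp add: less_imp_le\<close>)
  ultimately show ?thesis using W_pos by (simp add: integrable_iff_bounded less_imp_le)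
qed

text \<open>The binomial moments of the chain from 0 obey a triangular system of affine recursions
  with leading coefficients \<open>\<alpha>\<close>, \<open>\<alpha>\<^sup>2\<close>,
  \<open>\<alpha> ^ 3\<close> below 1; the bound in each degree uses those in lower degrees.\<close>

lemma moments_bounded:
  obtains C where "\<And>n. integrable ((B ^^ n) (return_pmf 0)) W" "\<And>n. (\<integral>x. W x \<partial>(B ^^ n) (return_pmf 0)) \<le> C"
proof -
  let ?k = "\<lambda>n. (B ^^ n) (return_pmf 0)"
  have int: "integrable (?k n) W" for n
  proof (induction n)
    case (Suc n)
    then show ?case using integrable_W_B by simp
  qed (simp add: integrable_measure_pmf_finite)
  note i = integrable_cubic[OF cubic_binom(1) int] integrable_cubic[OF cubic_binom(2) int] integrable_cubic[OF cubic_binom(3) int]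
  define u where "u = (\<lambda>j n. \<integral>x. binom j x \<partial>?k n)"
  have step: "u j (Suc n) = (\<integral>x. T (binom j) x \<partial>?k n)" if "cubic (binom j)" for j n
    unfolding u_def using integral_bind_pmf_real(3)[of "?k n" K "binom j"] integrable_cubic[OF that int[of "Suc n"]]
    by simp
  have 1: "u 1 (Suc n) = eps_moment 1 + \<alpha> * u 1 n" for n
    unfolding step[OF cubic_binom(1)] unfolding u_def integral_K_binom_1 using i by simp
  have 2: "u 2 (Suc n) = eps_moment 2 + \<alpha> * eps_moment 1 * u 1 n + \<alpha>\<^sup>2 * u 2 n" for n
    unfolding step[OF cubic_binom(2)] unfolding u_def integral_K_binom_2 using i by simp
  have 3: "u 3 (Suc n) = eps_moment 3 + \<alpha> * eps_moment 2 * u 1 n + \<alpha>\<^sup>2 * eps_moment 1 * u 2 n + \<alpha> ^ 3 * u 3 n" for n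
    unfolding step[OF cubic_binom(3)] unfolding u_def integral_K_binom_3 using i by simp
  have al: "\<alpha>\<^sup>2 < 1" "\<alpha> ^ 3 < 1" using \<alpha> power_less_one_iff[of \<alpha> 2] power_less_one_iff[of \<alpha> 3] by simp_all
  obtain D1 where D1: "\<And>n. u 1 n \<le> D1"
    by (rule affine_recursion_bounded[of \<alpha> "u 1" "eps_moment 1"]) (use \<alpha> 1 in auto)
  have "u 2 (Suc n) \<le> \<alpha>\<^sup>2 * u 2 n + (eps_moment 2 + \<alpha> * eps_moment 1 * D1)" for n
    unfolding 2 using mult_left_mono[OF D1[of n], of "\<alpha> * eps_moment 1"] \<alpha> eps_moment_nonneg[of 1] by simp
  then obtain D2 where D2: "\<And>n. u 2 n \<le> D2"
    using affine_recursion_bounded[of "\<alpha>\<^sup>2" "u 2"] al by auto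
  have "u 3 (Suc n) \<le> \<alpha> ^ 3 * u 3 n + (eps_moment 3 + \<alpha> * eps_moment 2 * D1 + \<alpha>\<^sup>2 * eps_moment 1 * D2)" for n
  proof -
    have "\<alpha> * eps_moment 2 * u 1 n \<le> \<alpha> * eps_moment 2 * D1" "\<alpha>\<^sup>2 * eps_moment 1 * u 2 n \<le> \<alpha>\<^sup>2 * eps_moment 1 * D2"
      using D1[of n] D2[of n] \<alpha> eps_moment_nonneg[of 1] eps_moment_nonneg[of 2] by (auto intro!: mult_left_mono)
    then show ?thesis unfolding 3 by linarith
  qed
  then obtain D3 where D3: "\<And>n. u 3 n \<le> D3"
    using affine_recursion_bounded[of "\<alpha> ^ 3" "u 3"] al \<alpha> by auto
  have "(\<integral>x. W x \<partial>?k n) = 6 * u 3 n + 12 * u 2 n + 7 * u 1 n + 1" for n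
    unfolding W_binom u_def using i by simp
  then have "(\<integral>x. W x \<partial>?k n) \<le> 6 * D3 + 12 * D2 + 7 * D1 + 1" for n
    using D1[of n] D2[of n] D3[of n] by simp
  then show ?thesis using that int by blast
qed

text \<open>The laws of the chain from 0 converge atom by atom at a geometric rate. Bounded
  \<open>W\<close>-moments keep mass from escaping, and Fatou's lemma carries invariance and the
  moment to the limit.\<close>

lemma stationary_exists: "\<exists>\<pi>. B \<pi> = \<pi> \<and> integrable (measure_pmf \<pi>) W"
proof -
  define k where "k = (\<lambda>n. (B ^^ n) (return_pmf 0))"
  obtain C where int: "\<And>n. integrable (k n) W" and C: "\<And>n. (\<integral>x. W x \<partial>k n) \<le> C"
    using moments_bounded unfolding k_def by blast
  have "convergent (\<lambda>n. pmf (k n) m)" for m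
  proof -
    let ?f = "indicator {m} :: nat \<Rightarrow> real"
    have f: "\<bar>?f x\<bar> \<le> 1" for x by (simp add: indicator_def)
    have q: "pmf (k n) m = (T ^^ n) ?f 0" for n
      using integral_iterate_T[where f="?f" and n=n and q="return_pmf 0", OF f] by (simp add: k_def measure_pmf_single)
    have step: "\<bar>pmf (k (Suc n)) m - pmf (k n) m\<bar> \<le> \<alpha> ^ n * (2 * eps_moment 1)" for n
    proof -
      have bnd: "\<bar>(T ^^ n) ?f x\<bar> \<le> 1" for x by (rule iterate_T_bounded[where f="?f", OF f])
      have i: "integrable (K 0) ((T ^^ n) ?f)"
        by (rule integrable_bounded_pmf[OF bnd])
      \<comment> \<open>One step from 0 has law \<open>K 0\<close>, so the value after
        \<open>Suc n\<close> steps is the average over \<open>K 0\<close> of the value after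
        \<open>n\<close> steps; the contraction compares it with the value at 0.\<close>
      have "pmf (k (Suc n)) m - pmf (k n) m = (\<integral>y. (T ^^ n) ?f y - (T ^^ n) ?f 0 \<partial>K 0)"
        unfolding q using i by simp
      also have "\<bar>\<dots>\<bar> \<le> (\<integral>y. \<bar>(T ^^ n) ?f y - (T ^^ n) ?f 0\<bar> \<partial>K 0)"
        by (rule integral_abs_bound)
      also have "\<dots> \<le> (\<integral>y. \<alpha> ^ n * 2 * binom 1 y \<partial>K 0)"
      proof (rule integral_mono)
        show "integrable (K 0) (\<lambda>y. \<bar>(T ^^ n) ?f y - (T ^^ n) ?f 0\<bar>)"
          by (intro integrable_abs Bochner_Integration.integrable_diff i) simp
        show "integrable (K 0) (\<lambda>y. \<alpha> ^ n * 2 * binom 1 y)"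
          by (intro integrable_mult_right integrable_cubic_K cubic_binom)
        show "\<bar>(T ^^ n) ?f y - (T ^^ n) ?f 0\<bar> \<le> \<alpha> ^ n * 2 * binom 1 y" for y
          using iterate_T_contraction[where f="?f" and C=1, OF f, of n y] unfolding binom_1 by simp
      qed
      also have "\<dots> = \<alpha> ^ n * (2 * eps_moment 1)" by (simp add: K_0 eps_moment_def)
      finally show ?thesis .
    qed
    have "summable (\<lambda>n. \<alpha> ^ n * (2 * eps_moment 1))"
      by (intro summable_mult2 summable_geometric) (use \<alpha> in simp)
    then have "summable (\<lambda>n. pmf (k (Suc n)) m - pmf (k n) m)"
      by (rule summable_comparison_test'[where N=0]) (simp only: real_norm_def step)
    then have "convergent (\<lambda>n. \<Sum>i<n. pmf (k (Suc i)) m - pmf (k i) m)"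
      by (simp add: summable_iff_convergent)
    from convergent_add[OF this[unfolded sum_lessThan_telescope[of "\<lambda>n. pmf (k n) m"]] convergent_const[of "pmf (k 0) m"]]
    show ?thesis by (simp only: diff_add_cancel)
  qed
  then obtain q where q: "\<And>m. (\<lambda>n. pmf (k n) m) \<longlonglongrightarrow> q m"
    unfolding convergent_def by metis
  have q0: "0 \<le> q m" for m by (rule LIMSEQ_le_const[OF q]) auto
  have fatou: "(\<integral>\<^sup>+x. ennreal (q x) * ennreal (g x) \<partial>count_space UNIV) \<le> liminf (\<lambda>n. \<integral>\<^sup>+x. ennreal (g x) \<partial>k n)"
    if g: "\<And>x. 0 \<le> g x" for g
  proof -
    have "(\<lambda>n. ennreal (pmf (k n) x * g x)) \<longlonglongrightarrow> ennreal (q x * g x)" for x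
      by (intro tendsto_ennrealI tendsto_intros q)
    then have "liminf (\<lambda>n. ennreal (pmf (k n) x * g x)) = ennreal (q x * g x)" for x
      by (intro lim_imp_Liminf) auto
    then have "(\<integral>\<^sup>+x. ennreal (q x * g x) \<partial>count_space UNIV) =
      (\<integral>\<^sup>+x. liminf (\<lambda>n. ennreal (pmf (k n) x * g x)) \<partial>count_space UNIV)" by simp
    also have "\<dots> \<le> liminf (\<lambda>n. \<integral>\<^sup>+x. ennreal (pmf (k n) x * g x) \<partial>count_space UNIV)"
      by (rule nn_integral_liminf) simp
    finally show ?thesis using g q0 by (simp add: nn_integral_measure_pmf ennreal_mult)
  qed
  have sum1: "(\<integral>\<^sup>+x. ennreal (q x) \<partial>count_space UNIV) = 1"
  proof (rule antisym)
    show "(\<integral>\<^sup>+x. ennreal (q x) \<partial>count_space UNIV) \<le> 1"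
      using fatou[of "\<lambda>x. 1"] by (simp add: Liminf_const)
    have C0: "0 \<le> C" using order_trans[OF _ C[of 0]] W_pos by (simp add: less_imp_le)
    \<comment> \<open>Markov's inequality bounds the mass beyond \<open>N\<close> uniformly in
      \<open>n\<close>, so the finite sums of the limit masses come within
      \<open>C / real (Suc N)\<close> of 1.\<close>
    have "1 - ennreal (C / real (Suc N)) \<le> (\<integral>\<^sup>+x. ennreal (q x) \<partial>count_space UNIV)" for N
    proof -
      have "1 - C / real (Suc N) \<le> (\<Sum>m\<le>N. pmf (k n) m)" for n
      proof -
        have "measure (k n) {x \<in> space (k n). real (Suc N) \<le> W x} \<le> (\<integral>x. W x \<partial>k n) / real (Suc N)"
          by (rule integral_Markov_inequality_measure[where A="{}"]) (use int W_pos in \<open>auto simp: less_imp_le\<close>)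
        also have "\<dots> \<le> C / real (Suc N)" using C[of n] by (simp add: divide_right_mono)
        finally have "measure (k n) {x. real (Suc N) \<le> W x} \<le> C / real (Suc N)" by simp
        moreover have "measure (k n) (UNIV - {..N}) \<le> measure (k n) {x. real (Suc N) \<le> W x}"
        proof (rule measure_pmf.finite_measure_mono)
          have "real (Suc N) \<le> W x" if "x > N" for x
          proof -
            have "real (Suc N) \<le> 1 + real x" using that by simp
            also have "\<dots> \<le> W x" unfolding W_def by (rule self_le_power) auto
            finally show ?thesis .
          qed
          then show "UNIV - {..N} \<subseteq> {x. real (Suc N) \<le> W x}" by auto
        qed simp
        moreover have "measure (k n) (UNIV - {..N}) = 1 - measure (k n) {..N}"
          using measure_pmf.prob_compl[of "{..N}" "k n"] by simp
        moreover have "measure (k n) {..N} = (\<Sum>m\<le>N. pmf (k n) m)"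
          by (simp add: measure_measure_pmf_finite)
        ultimately show ?thesis by linarith
      qed
      then have "1 - C / real (Suc N) \<le> (\<Sum>m\<le>N. q m)"
        by (intro LIMSEQ_le_const[OF tendsto_sum[OF q]]) auto
      then have "ennreal (1 - C / real (Suc N)) \<le> (\<integral>\<^sup>+x\<in>{..N}. ennreal (q x) \<partial>count_space UNIV)"
        by (simp add: nn_integral_count_space_indicator[symmetric] nn_integral_count_space_finite q0 ennreal_leI)
      also have "\<dots> \<le> (\<integral>\<^sup>+x. ennreal (q x) \<partial>count_space UNIV)"
        by (intro nn_integral_mono) (simp add: indicator_def)
      finally show ?thesis using C0 by (simp add: ennreal_minus flip: ennreal_1)
    qed
    moreover have "(\<lambda>N. ennreal (1 - C / real (Suc N))) \<longlonglongrightarrow> ennreal (1 - 0)"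
      by (intro tendsto_ennrealI tendsto_diff tendsto_const LIMSEQ_Suc[OF lim_const_over_n])
    ultimately show "1 \<le> (\<integral>\<^sup>+x. ennreal (q x) \<partial>count_space UNIV)"
      using C0 by (intro LIMSEQ_le_const2[of "\<lambda>N. ennreal (1 - C / real (Suc N))"]) (auto simp: ennreal_minus simp flip: ennreal_1)
  qed
  define \<pi> where "\<pi> = embed_pmf q"
  have \<pi>: "pmf \<pi> m = q m" for m
    unfolding \<pi>_def by (rule pmf_embed_pmf) (use q0 sum1 in auto)
  have fatou': "(\<integral>\<^sup>+x. ennreal (g x) \<partial>\<pi>) \<le> liminf (\<lambda>n. \<integral>\<^sup>+x. ennreal (g x) \<partial>k n)"
    if g: "\<And>x. 0 \<le> g x" for g
    using fatou[OF g] by (simp add: nn_integral_measure_pmf \<pi>)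
  have "B \<pi> = \<pi>"
  proof (rule pmf_le_imp_eq)
    fix m
    have "ennreal (pmf (B \<pi>) m) \<le> liminf (\<lambda>n. \<integral>\<^sup>+x. ennreal (pmf (K x) m) \<partial>k n)"
      unfolding ennreal_pmf_bind by (rule fatou') simp
    also have "\<dots> = liminf (\<lambda>n. ennreal (pmf (k (Suc n)) m))"
      by (simp add: k_def ennreal_pmf_bind)
    also have "\<dots> = ennreal (q m)"
      by (intro lim_imp_Liminf tendsto_ennrealI LIMSEQ_Suc q) auto
    finally show "pmf (B \<pi>) m \<le> pmf \<pi> m" by (simp add: \<pi> q0)
  qed
  moreover have "integrable \<pi> W"
  proof -
    have "(\<integral>\<^sup>+x. ennreal (W x) \<partial>\<pi>) \<le> liminf (\<lambda>n. \<integral>\<^sup>+x. ennreal (W x) \<partial>k n)"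
      by (rule fatou') (use W_pos in \<open>simp add: less_imp_le\<close>)
    also have "(\<lambda>n. \<integral>\<^sup>+x. ennreal (W x) \<partial>k n) = (\<lambda>n. ennreal (\<integral>x. W x \<partial>k n))"
      by (intro ext nn_integral_eq_integral int) (use W_pos in \<open>simp add: less_imp_le\<close>)
    also have "liminf \<dots> \<le> liminf (\<lambda>n::nat. ennreal C)"
      by (intro Liminf_mono always_eventually) (use C in \<open>simp add: ennreal_leI\<close>)
    also have "\<dots> < \<infinity>" by (simp add: Liminf_const)
    finally show ?thesis using W_pos by (simp add: integrable_iff_bounded less_imp_le)
  qed
  ultimately show ?thesis by blast
qed

abbreviation \<pi> :: "nat pmf" where "\<pi> \<equiv> inar_stationary \<alpha> p"

lemma stationary: "B \<pi> = \<pi>" and integrable_W_stationary: "integrable (measure_pmf \<pi>) W"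
proof -
  obtain \<rho> where \<rho>: "B \<rho> = \<rho>" "integrable (measure_pmf \<rho>) W" using stationary_exists by blast
  have "\<pi> = \<rho>" unfolding inar_stationary_def
    by (rule the_equality) (use \<rho> stationary_unique in auto)
  with \<rho> show "B \<pi> = \<pi>" "integrable (measure_pmf \<pi>) W" by simp_all
qed

text \<open>Integration against the invariant law annihilates the left side, which forces the free
  constant to be the stationary mean.\<close>

lemma poisson_equation:
  assumes "solvable g" "cubic g"
  obtains h where "cubic h" "\<And>x. h x - T h x = g x - (\<integral>y. g y \<partial>\<pi>)"
proof -
  obtain h v where h: "cubic h" "\<And>x. h x - T h x = g x - v"
    using assms by (auto simp: solvable_def)
  note i = integrable_cubic[OF _ integrable_W_stationary]
  have "(\<integral>x. h x - T h x \<partial>\<pi>) = (\<integral>x. h x \<partial>\<pi>) - (\<integral>x. h x \<partial>B \<pi>)"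
    using i[OF h(1)] i[OF cubic_integral_K[OF h(1)]]
    by (subst integral_bind_pmf_real(3)) (simp_all add: stationary)
  moreover have "(\<integral>x. h x - T h x \<partial>\<pi>) = (\<integral>x. g x \<partial>\<pi>) - v"
    unfolding h(2) using i[OF assms(2)] by simp
  ultimately have "v = (\<integral>x. g x \<partial>\<pi>)" by (simp add: stationary)
  with h that show ?thesis by blast
qed

section \<open>Stochastic monotonicity and uniform integrability of the cubic weight\<close>

lemma mono_K:
  fixes f :: "nat \<Rightarrow> ennreal"
  assumes "mono f"
  shows "(\<integral>\<^sup>+y. f y \<partial>K x) \<le> (\<integral>\<^sup>+y. f y \<partial>K (Suc x))" "(\<integral>\<^sup>+y. f y \<partial>K (Suc x)) \<le> (\<integral>\<^sup>+y. f (Suc y) \<partial>K x)"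
proof -
  have le: "(\<integral>\<^sup>+y. f y \<partial>K x) \<le> (\<integral>\<^sup>+y. f (Suc y) \<partial>K x)"
    using assms by (intro nn_integral_mono) (auto simp: mono_def)
  have one: "c = ennreal \<alpha> * c + ennreal (1 - \<alpha>) * c" for c
    using \<alpha> by (simp flip: distrib_right ennreal_plus)
  show "(\<integral>\<^sup>+y. f y \<partial>K x) \<le> (\<integral>\<^sup>+y. f y \<partial>K (Suc x))"
    unfolding nn_integral_K_Suc by (subst one) (intro add_mono mult_left_mono le order_refl; simp)
  show "(\<integral>\<^sup>+y. f y \<partial>K (Suc x)) \<le> (\<integral>\<^sup>+y. f (Suc y) \<partial>K x)"
    unfolding nn_integral_K_Suc
    by (subst (3) one) (intro add_mono mult_left_mono le order_refl; simp)
qed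

lemma K_add_le:
  fixes f :: "nat \<Rightarrow> ennreal"
  assumes "mono f"
  shows "(\<integral>\<^sup>+y. f y \<partial>K (x + z)) \<le> (\<integral>\<^sup>+y. f (x + y) \<partial>K z)"
  using assms
proof (induction x arbitrary: f)
  case (Suc x)
  have "(\<integral>\<^sup>+y. f y \<partial>K (Suc x + z)) \<le> (\<integral>\<^sup>+y. f (Suc y) \<partial>K (x + z))"
    using mono_K(2)[OF Suc.prems] by simp
  also have "\<dots> \<le> (\<integral>\<^sup>+y. f (Suc (x + y)) \<partial>K z)"
    by (rule Suc.IH) (use Suc.prems in \<open>simp add: mono_def\<close>)
  finally show ?case by simp
qed simp

text \<open>Compare with a population whose initial individuals never die while an independent
  stationary population evolves beside them: \<open>K_add_le\<close> keeps the first group alive in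
  each step, and invariance restores the second.\<close>

lemma stochastic_domination:
  fixes f :: "nat \<Rightarrow> ennreal" and q :: "nat pmf"
  assumes "mono f"
  shows "(\<integral>\<^sup>+y. f y \<partial>(B ^^ n) q) \<le> (\<integral>\<^sup>+x. \<integral>\<^sup>+z. f (x + z) \<partial>\<pi> \<partial>q)"
  using assms
proof (induction n arbitrary: f)
  case 0
  have "f x \<le> (\<integral>\<^sup>+z. f (x + z) \<partial>\<pi>)" for x
  proof -
    have "(\<integral>\<^sup>+z. f x \<partial>\<pi>) \<le> (\<integral>\<^sup>+z. f (x + z) \<partial>\<pi>)"
      using 0 by (intro nn_integral_mono) (auto simp: mono_def)
    then show ?thesis by simp
  qed
  then show ?case by (auto intro: nn_integral_mono)
next
  case (Suc n)
  have m: "mono (\<lambda>x. \<integral>\<^sup>+y. f y \<partial>K x)"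
    using mono_K(1)[OF Suc.prems] by (simp add: mono_iff_le_Suc)
  have "(\<integral>\<^sup>+y. f y \<partial>(B ^^ Suc n) q) = (\<integral>\<^sup>+x. \<integral>\<^sup>+y. f y \<partial>K x \<partial>(B ^^ n) q)" by simp
  also have "\<dots> \<le> (\<integral>\<^sup>+x. \<integral>\<^sup>+z. \<integral>\<^sup>+y. f y \<partial>K (x + z) \<partial>\<pi> \<partial>q)" by (rule Suc.IH[OF m])
  also have "\<dots> \<le> (\<integral>\<^sup>+x. \<integral>\<^sup>+z. \<integral>\<^sup>+y. f (x + y) \<partial>K z \<partial>\<pi> \<partial>q)"
    by (intro nn_integral_mono K_add_le Suc.prems)
  also have "\<dots> = (\<integral>\<^sup>+x. \<integral>\<^sup>+y. f (x + y) \<partial>B \<pi> \<partial>q)" by simp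
  finally show ?case unfolding stationary .
qed

lemma W_add: "W (x + z) \<le> W x * W z"
proof -
  have "W (x + z) \<le> ((1 + real x) * (1 + real z)) ^ 3"
    unfolding W_def by (intro power_mono) (auto simp: algebra_simps)
  then show ?thesis by (simp only: W_def power_mult_distrib)
qed

lemma mono_W: "mono W"
  unfolding W_def by (intro monoI power_mono) auto

context
  fixes q :: "nat pmf"
  assumes q: "integrable (measure_pmf q) W"
begin

lemma integrable_W_iterate: "integrable (measure_pmf ((B ^^ n) q)) W"
  by (induction n) (use q integrable_W_B in auto)

text \<open>The sum \<nu> of the initial and an independent stationary variable dominates all times
  at once, and submultiplicativity bounds its \<open>W\<close>-moment by a product. Since
  \<open>W\<close> set to zero below \<open>N\<close> is still increasing, its integral under \<nu>
  bounds every tail.\<close>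

lemma tail_W_uniform:
  assumes "0 < \<epsilon>"
  obtains N where "\<And>n. (\<integral>x. W x * indicator {N..} x \<partial>(B ^^ n) q) \<le> \<epsilon>"
proof -
  define \<nu> where "\<nu> = map_pmf (\<lambda>(x, z). x + z) (pair_pmf q \<pi>)"
  have "(\<integral>\<^sup>+x. W x \<partial>\<nu>) \<le> (\<integral>\<^sup>+x. \<integral>\<^sup>+z. ennreal (W x) * ennreal (W z) \<partial>\<pi> \<partial>q)"
    unfolding \<nu>_def using W_add W_pos
    by (simp add: nn_integral_pair_pmf' less_imp_le flip: ennreal_mult) (intro nn_integral_mono ennreal_leI W_add)
  also have "\<dots> = (\<integral>\<^sup>+x. W x \<partial>q) * (\<integral>\<^sup>+z. W z \<partial>\<pi>)"
    by (simp add: nn_integral_cmult nn_integral_multc)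
  also have "\<dots> < \<infinity>"
    using q integrable_W_stationary W_pos by (simp add: integrable_iff_bounded less_imp_le ennreal_mult_less_top)
  finally have \<nu>: "integrable \<nu> W" using W_pos by (simp add: integrable_iff_bounded less_imp_le)
  have "(\<lambda>N. \<integral>x. W x * indicator {N..} x \<partial>\<nu>) \<longlonglongrightarrow> (\<integral>x. 0 \<partial>\<nu>)"
  proof (rule integral_dominated_convergence[where w=W])
    show "AE x in \<nu>. (\<lambda>N. W x * indicator {N..} x) \<longlonglongrightarrow> 0"
    proof (rule AE_I2)
      fix x
      have "eventually (\<lambda>N. W x * indicator {N..} x = 0) sequentially"
        using eventually_gt_at_top[of x] by eventually_elim auto
      then show "(\<lambda>N. W x * indicator {N..} x) \<longlonglongrightarrow> 0" by (rule tendsto_eventually)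
    qed
    show "AE x in \<nu>. norm (W x * indicator {N..} x) \<le> W x" for N
      using W_pos by (auto simp: indicator_def less_imp_le)
  qed (use \<nu> in auto)
  then have "eventually (\<lambda>N. (\<integral>x. W x * indicator {N..} x \<partial>\<nu>) < \<epsilon>) sequentially"
    using assms by (intro order_tendstoD) auto
  then obtain N where N: "(\<integral>x. W x * indicator {N..} x \<partial>\<nu>) < \<epsilon>"
    by (auto simp: eventually_sequentially)
  have i: "integrable (measure_pmf r) (\<lambda>x. W x * indicator {N..} x)" if "integrable (measure_pmf r) W" for r
    using that by (rule Bochner_Integration.integrable_bound) (auto simp: indicator_def)
  have "(\<integral>x. W x * indicator {N..} x \<partial>(B ^^ n) q) \<le> \<epsilon>" for n
  proof -
    have m: "mono (\<lambda>x. ennreal (W x * indicator {N..} x))"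
      using mono_W W_pos by (auto simp: mono_def indicator_def intro!: ennreal_leI)
    have "ennreal (\<integral>x. W x * indicator {N..} x \<partial>(B ^^ n) q) = (\<integral>\<^sup>+x. W x * indicator {N..} x \<partial>(B ^^ n) q)"
      by (rule nn_integral_eq_integral[symmetric, OF i[OF integrable_W_iterate]])
        (use W_pos in \<open>simp add: less_imp_le\<close>)
    also have "\<dots> \<le> (\<integral>\<^sup>+x. W x * indicator {N..} x \<partial>\<nu>)"
      using stochastic_domination[OF m, where n=n and q=q] by (simp add: \<nu>_def nn_integral_pair_pmf')
    also have "\<dots> = ennreal (\<integral>x. W x * indicator {N..} x \<partial>\<nu>)"
      by (rule nn_integral_eq_integral[OF i[OF \<nu>]]) (use W_pos in \<open>simp add: less_imp_le\<close>)
    also have "\<dots> \<le> ennreal \<epsilon>" using N by (simp add: ennreal_leI)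
    finally show ?thesis using assms by simp
  qed
  then show ?thesis using that by blast
qed

text \<open>Each step will carry such an error divided by \<open>n\<close>, and there are about
  \<open>n\<close> steps, so smallness must be uniform in the time \<open>j\<close>. Below
  \<open>N\<close> only finitely many states occur; above it uniform integrability takes
  over.\<close>

lemma uniform_dominated_convergence:
  fixes w :: "nat \<Rightarrow> nat \<Rightarrow> real"
  assumes bnd: "\<And>n x. \<bar>w n x\<bar> \<le> C * W x" and lim: "\<And>x. (\<lambda>n. w n x) \<longlonglongrightarrow> 0" and "0 < \<epsilon>"
  shows "eventually (\<lambda>n. \<forall>j. (\<integral>x. \<bar>w n x\<bar> \<partial>(B ^^ j) q) \<le> \<epsilon>) sequentially"
proof -
  have "0 \<le> C * W 0" using bnd[of 0 0] by (rule order_trans[OF abs_ge_zero])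
  then have C: "0 \<le> C" by (simp add: W_def)
  \<comment> \<open>The factor 2 leaves half of \<epsilon> for the states below \<open>N\<close>;
    adding 1 covers \<open>C = 0\<close>.\<close>
  obtain N where N: "\<And>n. (\<integral>x. W x * indicator {N..} x \<partial>(B ^^ n) q) \<le> \<epsilon> / (2 * (C + 1))"
    using tail_W_uniform[of "\<epsilon> / (2 * (C + 1))"] assms C by auto
  have "eventually (\<lambda>n. \<forall>x\<in>{..<N}. \<bar>w n x\<bar> < \<epsilon> / 2) sequentially"
    using lim \<open>0 < \<epsilon>\<close> by (intro eventually_ball_finite ballI order_tendstoD(2)[of _ 0] tendsto_rabs_zero) auto
  then show ?thesis
  proof eventually_elim
    case (elim n)
    show ?case
    proof
      fix j
      note iW = integrable_W_iterate[of j]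
      have cub: "cubic (\<lambda>x. \<bar>w n x\<bar>)" by (rule cubicI[of _ C]) (use bnd in simp)
      have i: "integrable ((B ^^ j) q) (\<lambda>x. W x * indicator {N..} x)"
        using iW by (rule Bochner_Integration.integrable_bound) (auto simp: indicator_def)
      have "(\<integral>x. \<bar>w n x\<bar> \<partial>(B ^^ j) q) \<le> (\<integral>x. \<epsilon> / 2 + C * (W x * indicator {N..} x) \<partial>(B ^^ j) q)"
      proof (rule integral_mono)
        show "integrable ((B ^^ j) q) (\<lambda>x. \<bar>w n x\<bar>)" by (rule integrable_cubic[OF cub iW])
        show "integrable ((B ^^ j) q) (\<lambda>x. \<epsilon> / 2 + C * (W x * indicator {N..} x))" using i by simp
        show "\<bar>w n x\<bar> \<le> \<epsilon> / 2 + C * (W x * indicator {N..} x)" for x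
        proof (cases "x < N")
          case True
          then have "\<bar>w n x\<bar> < \<epsilon> / 2" using elim by auto
          then show ?thesis using True by simp
        next
          case False
          then have "indicator {N..} x = (1::real)" by simp
          then show ?thesis using bnd[of n x] \<open>0 < \<epsilon>\<close> by simp
        qed
      qed
      also have "\<dots> = \<epsilon> / 2 + C * (\<integral>x. W x * indicator {N..} x \<partial>(B ^^ j) q)" using i by simp
      also have "\<dots> \<le> \<epsilon> / 2 + C * (\<epsilon> / (2 * (C + 1)))"
        using mult_left_mono[OF N[of j] C] by simp
      also have "C * (\<epsilon> / (2 * (C + 1))) \<le> \<epsilon> / 2"
        using C \<open>0 < \<epsilon>\<close> by (simp add: field_simps)
      finally show "(\<integral>x. \<bar>w n x\<bar> \<partial>(B ^^ j) q) \<le> \<epsilon>" by simp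
    qed
  qed
qed

end

end

section \<open>The Markov property\<close>

lemma (in prob_space) distr_eq_measure_pmf_iff:
  fixes f :: "'a \<Rightarrow> 'b::countable"
  assumes [measurable]: "f \<in> measurable M (count_space UNIV)"
  shows "distr M (count_space UNIV) f = measure_pmf q \<longleftrightarrow> (\<forall>x. measure M (f -` {x} \<inter> space M) = pmf q x)"
proof
  assume eq: "distr M (count_space UNIV) f = measure_pmf q"
  show "\<forall>x. measure M (f -` {x} \<inter> space M) = pmf q x"
  proof
    fix x
    have "measure M (f -` {x} \<inter> space M) = measure (distr M (count_space UNIV) f) {x}"
      by (simp add: measure_distr)
    then show "measure M (f -` {x} \<inter> space M) = pmf q x" by (simp add: eq measure_pmf_single)
  qed
next
  assume eq: "\<forall>x. measure M (f -` {x} \<inter> space M) = pmf q x"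
  show "distr M (count_space UNIV) f = measure_pmf q"
    by (rule measure_eqI_countable[where A=UNIV])
      (auto simp: emeasure_distr emeasure_eq_measure eq emeasure_pmf_single)
qed

lemma (in prob_space) ex_pmf_distr:
  fixes f :: "'a \<Rightarrow> 'b::countable"
  assumes [measurable]: "f \<in> measurable M (count_space UNIV)"
  obtains q where "distr M (count_space UNIV) f = measure_pmf q"
proof -
  let ?D = "distr M (count_space UNIV) f"
  interpret D: prob_space ?D by (rule prob_space_distr) simp
  define q where "q = embed_pmf (\<lambda>x. measure ?D {x})"
  have "(\<integral>\<^sup>+x. ennreal (measure ?D {x}) \<partial>count_space UNIV) = (\<integral>\<^sup>+x. emeasure ?D {x} \<partial>count_space UNIV)"
    by (simp add: D.emeasure_eq_measure)
  also have "\<dots> = emeasure ?D (\<Union>x\<in>UNIV. {x})"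
    by (rule emeasure_UN_countable[symmetric]) (auto simp: disjoint_family_on_def)
  also have "\<dots> = 1" using D.emeasure_space_1 by simp
  finally have "pmf q x = measure ?D {x}" for x
    unfolding q_def by (subst pmf_embed_pmf) auto
  then have "?D = measure_pmf q"
    by (subst distr_eq_measure_pmf_iff) (auto simp: measure_distr)
  then show ?thesis by (rule that)
qed

lemma measurable_Pair_countable:
  fixes f :: "'a \<Rightarrow> 'b::countable" and g :: "'a \<Rightarrow> 'c::countable"
  assumes "f \<in> measurable N (count_space UNIV)" "g \<in> measurable N (count_space UNIV)"
  shows "(\<lambda>x. (f x, g x)) \<in> measurable N (count_space UNIV)"
  by (rule measurable_compose_countable[OF _ assms(1)]) (rule measurable_compose[OF assms(2)], simp)

lemma (in prob_space) distr_indep_pmf: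
  fixes A C :: "'a \<Rightarrow> 'b::countable"
  assumes ind: "indep_var (count_space UNIV) A (count_space UNIV) C"
    and "distr M (count_space UNIV) A = measure_pmf a" "distr M (count_space UNIV) C = measure_pmf c"
  shows "distr M (count_space UNIV) (\<lambda>\<omega>. (A \<omega>, C \<omega>)) = measure_pmf (pair_pmf a c)"
proof -
  have [measurable]: "A \<in> measurable M (count_space UNIV)" "C \<in> measurable M (count_space UNIV)"
    using indep_var_rv1[OF ind] indep_var_rv2[OF ind] by auto
  have AC: "(\<lambda>\<omega>. (A \<omega>, C \<omega>)) \<in> measurable M (count_space UNIV)"
    by (intro measurable_Pair_countable) auto
  have "measure M ((\<lambda>\<omega>. (A \<omega>, C \<omega>)) -` {(x, y)} \<inter> space M) = pmf a x * pmf c y" for x y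
    using indep_varD[OF ind, of "{x}" "{y}"] assms(2,3) by (simp add: distr_eq_measure_pmf_iff)
  then show ?thesis
    unfolding distr_eq_measure_pmf_iff[OF AC] by (auto simp: pmf_pair)
qed

section \<open>The process as a Markov chain with kernel \<open>K\<close>\<close>

locale inar_process = prob_space M + inar_law \<alpha> p
  for M :: "'a measure" and \<alpha> p +
  fixes X0 :: "'a \<Rightarrow> nat" and eps :: "nat \<Rightarrow> 'a \<Rightarrow> nat" and xi :: "nat \<Rightarrow> nat \<Rightarrow> 'a \<Rightarrow> nat"
  assumes indep: "indep_vars (\<lambda>_. count_space UNIV) (inar_family X0 eps xi) inar_indices"
    and eps_law: "\<And>k. k \<ge> 1 \<Longrightarrow> distr M (count_space UNIV) (eps k) = measure_pmf p"
    and xi_law: "\<And>k j. k \<ge> 1 \<Longrightarrow> j \<ge> 1 \<Longrightarrow>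
           distr M (count_space UNIV) (xi k j) = measure_pmf (map_pmf of_bool (bernoulli_pmf \<alpha>))"
    and X0_3: "integrable M (\<lambda>\<omega>. real (X0 \<omega>) ^ 3)"
begin

abbreviation X :: "nat \<Rightarrow> 'a \<Rightarrow> nat" where "X \<equiv> inar_X X0 eps xi"

text \<open>The recursion run on coordinate functions. Factoring \<open>X\<close> through the
  coordinates in \<open>past k\<close> turns independence of the family into independence of the
  history from the next step.\<close>

abbreviation path_X :: "nat \<Rightarrow> (inar_idx \<Rightarrow> nat) \<Rightarrow> nat" where
  "path_X \<equiv> inar_X (\<lambda>z. z IX0) (\<lambda>k z. z (IEps k)) (\<lambda>k j z. z (IXi k j))"

fun level :: "inar_idx \<Rightarrow> nat" where
  "level IX0 = 0" | "level (IEps k) = k" | "level (IXi k j) = k"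

definition past :: "nat \<Rightarrow> inar_idx set" where "past k = {i \<in> inar_indices. level i \<le> k}"

definition present :: "nat \<Rightarrow> inar_idx set" where "present k = {i \<in> inar_indices. level i = k}"

definition hist :: "nat \<Rightarrow> 'a \<Rightarrow> nat list" where "hist k \<omega> = map (\<lambda>i. X i \<omega>) [0..<Suc k]"

text \<open>The next state with the current one frozen at a deterministic \<open>x\<close>. Freezing
  separates the number of summands, which belongs to the past, from the summands, which do
  not.\<close>

definition innov :: "nat \<Rightarrow> nat \<Rightarrow> 'a \<Rightarrow> nat" where
  "innov k x \<omega> = (\<Sum>i = 1..x. xi (Suc k) i \<omega>) + eps (Suc k) \<omega>"

lemma X_Suc: "X (Suc k) \<omega> = innov k (X k \<omega>) \<omega>"
  by (simp add: innov_def)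

lemma mem_past:
  "IX0 \<in> past k" "1 \<le> j \<Longrightarrow> j \<le> k \<Longrightarrow> IEps j \<in> past k" "1 \<le> j \<Longrightarrow> j \<le> k \<Longrightarrow> 1 \<le> i \<Longrightarrow> IXi j i \<in> past k"
  by (auto simp: past_def inar_indices_def)

lemma mem_present: "IEps (Suc k) \<in> present (Suc k)" "1 \<le> i \<Longrightarrow> IXi (Suc k) i \<in> present (Suc k)"
  by (auto simp: present_def inar_indices_def)

lemma measurable_coord:
  "i \<in> I \<Longrightarrow> (\<lambda>z. z i) \<in> measurable (PiM I (\<lambda>_. count_space UNIV)) (count_space UNIV)"
  by (rule measurable_component_singleton)

lemma measurable_add_nat:
  fixes f g :: "'c \<Rightarrow> nat"
  assumes "f \<in> measurable N (count_space UNIV)" "g \<in> measurable N (count_space UNIV)"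
  shows "(\<lambda>x. f x + g x) \<in> measurable N (count_space UNIV)"
  using measurable_sum_nat[of "UNIV :: bool set" "\<lambda>b. if b then f else g" N] assms by (simp add: UNIV_bool add.commute)

lemma measurable_path_X:
  assumes "j \<le> k"
  shows "path_X j \<in> measurable (PiM (past k) (\<lambda>_. count_space UNIV)) (count_space UNIV)"
  using assms
proof (induction j)
  case 0
  then show ?case using measurable_coord[OF mem_past(1)] by (simp cong: measurable_cong)
next
  case (Suc j)
  then have "(\<lambda>z. (\<Sum>i = 1..x. z (IXi (Suc j) i)) + (z (IEps (Suc j)) :: nat))
      \<in> measurable (PiM (past k) (\<lambda>_. count_space UNIV)) (count_space UNIV)" for x
    by (intro measurable_add_nat measurable_sum_nat measurable_coord mem_past) auto
  from measurable_compose_countable[OF this Suc.IH] Suc.prems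
  show ?case by (simp cong: measurable_cong)
qed

lemma measurable_path_hist:
  "(\<lambda>z. map (\<lambda>i. path_X i z) [0..<n]) \<in> measurable (PiM (past k) (\<lambda>_. count_space UNIV)) (count_space UNIV)"
  if "n \<le> Suc k"
  using that
proof (induction n)
  case (Suc n)
  have "(\<lambda>z. l @ [path_X n z]) \<in> measurable (PiM (past k) (\<lambda>_. count_space UNIV)) (count_space UNIV)" for l
    by (rule measurable_compose[OF measurable_path_X]) (use Suc in auto)
  from measurable_compose_countable[OF this Suc.IH] Suc.prems
  show ?case by simp
qed simp

lemma path_X_past:
  assumes "j \<le> k" shows "path_X j (\<lambda>i\<in>past k. inar_family X0 eps xi i \<omega>) = X j \<omega>"
  using assms
  by (induction j) (auto simp: inar_family_def mem_past intro!: arg_cong2[where f="(+)"] sum.cong)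

lemma hist_past: "hist k \<omega> = map (\<lambda>j. path_X j (\<lambda>i\<in>past k. inar_family X0 eps xi i \<omega>)) [0..<Suc k]"
  unfolding hist_def by (intro map_cong refl path_X_past[symmetric]) auto

lemma innov_present:
  "innov k x \<omega> = (\<lambda>z. (\<Sum>i = 1..x. z (IXi (Suc k) i)) + z (IEps (Suc k)))
     (\<lambda>i\<in>present (Suc k). inar_family X0 eps xi i \<omega>)"
  by (auto simp: innov_def inar_family_def mem_present intro!: sum.cong)

text \<open>The two sides depend on disjoint sets of indices, those of level at most
  \<open>k\<close> and those of level \<open>Suc k\<close>. The singleton list gives both variables
  one type, as \<open>indep_var\<close> requires.\<close>

lemma indep_hist_innov:
  "indep_var (count_space UNIV) (hist k) (count_space UNIV) (\<lambda>\<omega>. [innov k x \<omega>])"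
proof -
  have "indep_var (PiM (past k) (\<lambda>_. count_space UNIV)) (\<lambda>\<omega>. \<lambda>i\<in>past k. inar_family X0 eps xi i \<omega>)
     (PiM (present (Suc k)) (\<lambda>_. count_space UNIV)) (\<lambda>\<omega>. \<lambda>i\<in>present (Suc k). inar_family X0 eps xi i \<omega>)"
    by (rule indep_var_restrict[OF indep]) (auto simp: past_def present_def)
  moreover have "(\<lambda>z. [(\<Sum>i = 1..x. z (IXi (Suc k) i)) + (z (IEps (Suc k)) :: nat)])
      \<in> measurable (PiM (present (Suc k)) (\<lambda>_. count_space UNIV)) (count_space UNIV)"
    by (rule measurable_compose[OF measurable_add_nat[OF measurable_sum_nat measurable_coord[OF mem_present(1)]]])
      (auto intro!: measurable_coord mem_present simp del: One_nat_def)
  ultimately show ?thesis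
    unfolding hist_past[abs_def] innov_present[abs_def]
    by (rule indep_var_compose[OF _ measurable_path_hist[OF order_refl], unfolded comp_def])
qed

lemma measurable_hist [measurable]: "hist k \<in> measurable M (count_space UNIV)"
  using indep_var_rv1[OF indep_hist_innov] .

lemma measurable_innov: "innov k x \<in> measurable M (count_space UNIV)"
  using measurable_compose[OF indep_var_rv2[OF indep_hist_innov[of k x]], of hd "count_space UNIV"] by simp

lemma length_hist [simp]: "length (hist k \<omega>) = Suc k"
  by (simp add: hist_def)

lemma nth_hist [simp]: "i \<le> k \<Longrightarrow> hist k \<omega> ! i = X i \<omega>"
  unfolding hist_def by (subst nth_map) (auto simp del: upt_Suc)

lemma last_hist [simp]: "last (hist k \<omega>) = X k \<omega>"
  by (simp add: hist_def)

lemma take_hist: "r \<le> k \<Longrightarrow> take (Suc r) (hist k \<omega>) = hist r \<omega>"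
  by (rule nth_equalityI) (auto simp: less_Suc_eq_le)

lemma measurable_X [measurable]: "X k \<in> measurable M (count_space UNIV)"
  using measurable_compose[OF measurable_hist[of k], of last "count_space UNIV"] by simp

lemma indep_innov_step:
  "indep_var (count_space UNIV) (xi (Suc k) (Suc x)) (count_space UNIV) (innov k x)"
proof -
  let ?A = "{IXi (Suc k) (Suc x)}" and ?B = "insert (IEps (Suc k)) (IXi (Suc k) ` {1..x})"
  let ?f = "\<lambda>z. (\<Sum>i = 1..x. z (IXi (Suc k) i)) + (z (IEps (Suc k)) :: nat)"
  have ind: "indep_var (PiM ?A (\<lambda>_. count_space UNIV)) (\<lambda>\<omega>. \<lambda>i\<in>?A. inar_family X0 eps xi i \<omega>)
     (PiM ?B (\<lambda>_. count_space UNIV)) (\<lambda>\<omega>. \<lambda>i\<in>?B. inar_family X0 eps xi i \<omega>)"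
    by (rule indep_var_restrict[OF indep]) (auto simp: inar_indices_def)
  have f: "?f \<in> measurable (PiM ?B (\<lambda>_. count_space UNIV)) (count_space UNIV)"
    by (intro measurable_add_nat measurable_sum_nat measurable_coord) auto
  have 1: "(\<lambda>z. z (IXi (Suc k) (Suc x))) \<circ> (\<lambda>\<omega>. \<lambda>i\<in>?A. inar_family X0 eps xi i \<omega>) = xi (Suc k) (Suc x)"
    by (auto simp: fun_eq_iff inar_family_def)
  have 2: "?f \<circ> (\<lambda>\<omega>. \<lambda>i\<in>?B. inar_family X0 eps xi i \<omega>) = innov k x"
    by (auto simp: fun_eq_iff inar_family_def innov_def intro!: sum.cong)
  show ?thesis
    using indep_var_compose[OF ind measurable_coord f, of "IXi (Suc k) (Suc x)"] unfolding 1 2 by simp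
qed

text \<open>The induction mirrors \<open>K_Suc\<close>: the last thinning variable is independent of
  the remaining sum.\<close>

lemma distr_innov: "distr M (count_space UNIV) (innov k x) = measure_pmf (K x)"
proof (induction x)
  case 0
  have "innov k 0 = eps (Suc k)" by (auto simp: innov_def)
  then show ?case using eps_law[of "Suc k"] by (simp add: K_0)
next
  case (Suc x)
  have [measurable]: "xi (Suc k) (Suc x) \<in> measurable M (count_space UNIV)"
    "innov k x \<in> measurable M (count_space UNIV)"
    using indep_var_rv1[OF indep_innov_step] measurable_innov by auto
  let ?P = "pair_pmf (map_pmf of_bool (bernoulli_pmf \<alpha>)) (K x)"
  have P: "distr M (count_space UNIV) (\<lambda>\<omega>. (xi (Suc k) (Suc x) \<omega>, innov k x \<omega>)) = measure_pmf ?P"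
    by (rule distr_indep_pmf[OF indep_innov_step]) (use xi_law Suc in auto)
  have m: "(\<lambda>\<omega>. (xi (Suc k) (Suc x) \<omega>, innov k x \<omega>)) \<in> measurable M (count_space UNIV)"
    by (intro measurable_Pair_countable) auto
  have "innov k (Suc x) = (\<lambda>(a, b). a + b) \<circ> (\<lambda>\<omega>. (xi (Suc k) (Suc x) \<omega>, innov k x \<omega>))"
    by (auto simp: innov_def fun_eq_iff)
  then have "distr M (count_space UNIV) (innov k (Suc x)) = distr (measure_pmf ?P) (count_space UNIV) (\<lambda>(a, b). a + b)"
    unfolding P[symmetric] by (subst distr_distr) (use m in auto)
  also have "\<dots> = measure_pmf (map_pmf (\<lambda>(a, b). a + b) ?P)"
    by (simp add: map_pmf_rep_eq)
  also have "map_pmf (\<lambda>(a, b). a + b) ?P = K (Suc x)"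
    by (simp add: K_Suc pair_pmf_def map_pmf_def bind_assoc_pmf bind_return_pmf)
  finally show ?case .
qed

definition H :: "nat \<Rightarrow> nat list pmf" where
  "H k = (SOME q. distr M (count_space UNIV) (hist k) = measure_pmf q)"

lemma distr_hist: "distr M (count_space UNIV) (hist k) = measure_pmf (H k)"
  unfolding H_def by (rule ex_pmf_distr[OF measurable_hist]) (rule someI)

lemma measurable_hist_X: "(\<lambda>\<omega>. (hist k \<omega>, X (Suc k) \<omega>)) \<in> measurable M (count_space UNIV)"
  by (intro measurable_Pair_countable measurable_hist measurable_X)

text \<open>On the atom where the history equals \<open>l\<close> the next state is the innovation
  frozen at \<open>last l\<close>, which is independent of the history. Lists are countable, so the
  atoms determine the joint law.\<close>

lemma distr_hist_X:
  "distr M (count_space UNIV) (\<lambda>\<omega>. (hist k \<omega>, X (Suc k) \<omega>)) =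
     measure_pmf (bind_pmf (H k) (\<lambda>l. map_pmf (Pair l) (K (last l))))"
proof -
  have "measure M ((\<lambda>\<omega>. (hist k \<omega>, X (Suc k) \<omega>)) -` {(l, y)} \<inter> space M) =
      pmf (bind_pmf (H k) (\<lambda>l. map_pmf (Pair l) (K (last l)))) (l, y)" for l y
  proof -
    have "measure M ((\<lambda>\<omega>. (hist k \<omega>, X (Suc k) \<omega>)) -` {(l, y)} \<inter> space M) =
        measure M ((\<lambda>\<omega>. (hist k \<omega>, [innov k (last l) \<omega>])) -` ({l} \<times> {[y]}) \<inter> space M)"
      by (rule arg_cong[where f="measure M"]) (auto simp: X_Suc simp del: inar_X.simps)
    also have "\<dots> = measure M (hist k -` {l} \<inter> space M) * measure M ((\<lambda>\<omega>. [innov k (last l) \<omega>]) -` {[y]} \<inter> space M)"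
      by (rule indep_varD[OF indep_hist_innov]) auto
    also have "\<dots> = pmf (H k) l * pmf (K (last l)) y"
      using distr_hist[of k] distr_innov[of k "last l"]
      by (simp add: distr_eq_measure_pmf_iff measurable_innov vimage_def)
    also have "\<dots> = pmf (bind_pmf (H k) (\<lambda>l. map_pmf (Pair l) (K (last l)))) (l, y)"
    proof -
      have "pmf (map_pmf (Pair l') (K (last l'))) (l, y) = indicator {l} l' * pmf (K (last l)) y" for l'
        by (cases "l' = l") (auto simp: pmf_map_inj' inj_def pmf_eq_0_set_pmf)
      then show ?thesis by (simp add: pmf_bind measure_pmf_single)
    qed
    finally show ?thesis .
  qed
  then show ?thesis unfolding distr_eq_measure_pmf_iff[OF measurable_hist_X] by auto
qed

text \<open>The integrand may depend on the whole history, because the initial event and the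
  exponential accumulated so far are carried along as factors.\<close>

lemma markov_property:
  fixes f :: "nat list \<Rightarrow> nat \<Rightarrow> complex"
  assumes "integrable M (\<lambda>\<omega>. f (hist k \<omega>) (X (Suc k) \<omega>))"
  shows "(\<integral>\<omega>. f (hist k \<omega>) (X (Suc k) \<omega>) \<partial>M) = (\<integral>\<omega>. \<integral>y. f (hist k \<omega>) y \<partial>K (X k \<omega>) \<partial>M)"
proof -
  let ?P = "bind_pmf (H k) (\<lambda>l. map_pmf (Pair l) (K (last l)))"
  have "integrable (distr M (count_space UNIV) (\<lambda>\<omega>. (hist k \<omega>, X (Suc k) \<omega>))) (\<lambda>(l, y). f l y)"
    using assms by (subst integrable_distr_eq[OF measurable_hist_X]) auto
  then have i: "integrable (measure_pmf ?P) (\<lambda>(l, y). f l y)" unfolding distr_hist_X .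
  have "(\<integral>\<omega>. f (hist k \<omega>) (X (Suc k) \<omega>) \<partial>M) =
     integral\<^sup>L (distr M (count_space UNIV) (\<lambda>\<omega>. (hist k \<omega>, X (Suc k) \<omega>))) (\<lambda>(l, y). f l y)"
    by (subst integral_distr[OF measurable_hist_X]) auto
  also have "\<dots> = (\<integral>l. \<integral>z. (case z of (l, y) \<Rightarrow> f l y) \<partial>map_pmf (Pair l) (K (last l)) \<partial>H k)"
    unfolding distr_hist_X by (rule integral_bind_pmf_complex(2)[OF i])
  also have "\<dots> = (\<integral>l. \<integral>y. f l y \<partial>K (last l) \<partial>H k)" by simp
  also have "\<dots> = (\<integral>\<omega>. \<integral>y. f (hist k \<omega>) y \<partial>K (last (hist k \<omega>)) \<partial>M)"
    unfolding distr_hist[symmetric] by (subst integral_distr[OF measurable_hist]) auto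
  finally show ?thesis by simp
qed

definition L0 :: "nat pmf" where "L0 = map_pmf last (H 0)"

abbreviation law :: "nat \<Rightarrow> nat pmf" where "law k \<equiv> (B ^^ k) L0"

lemma distr_X: "distr M (count_space UNIV) (X k) = measure_pmf (law k)"
proof (induction k)
  case 0
  have "distr M (count_space UNIV) (X 0) = distr M (count_space UNIV) (last \<circ> hist 0)"
    by (intro arg_cong[where f="distr M (count_space UNIV)"]) (auto simp: comp_def simp del: inar_X.simps)
  also have "\<dots> = distr (measure_pmf (H 0)) (count_space UNIV) last"
    unfolding distr_hist[symmetric] by (rule distr_distr[symmetric]) auto
  finally show ?case unfolding L0_def by (simp add: map_pmf_rep_eq del: inar_X.simps)
next
  case (Suc k)
  have "distr M (count_space UNIV) (X k) = distr M (count_space UNIV) (last \<circ> hist k)"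
    by (intro arg_cong[where f="distr M (count_space UNIV)"]) (auto simp: comp_def simp del: inar_X.simps)
  also have "\<dots> = distr (measure_pmf (H k)) (count_space UNIV) last"
    unfolding distr_hist[symmetric] by (rule distr_distr[symmetric]) auto
  finally have "measure_pmf (map_pmf last (H k)) = measure_pmf (law k)"
    unfolding Suc by (simp add: map_pmf_rep_eq)
  then have last: "map_pmf last (H k) = (law k)" by (simp add: measure_pmf_inject)
  have "distr M (count_space UNIV) (X (Suc k)) =
      distr M (count_space UNIV) (snd \<circ> (\<lambda>\<omega>. (hist k \<omega>, X (Suc k) \<omega>)))"
    by (intro arg_cong[where f="distr M (count_space UNIV)"]) (auto simp: comp_def simp del: inar_X.simps)
  also have "\<dots> = distr (measure_pmf (bind_pmf (H k) (\<lambda>l. map_pmf (Pair l) (K (last l))))) (count_space UNIV) snd"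
    unfolding distr_hist_X[symmetric] by (rule distr_distr[symmetric, OF _ measurable_hist_X]) auto
  also have "\<dots> = measure_pmf (bind_pmf (H k) (\<lambda>l. K (last l)))"
    by (simp add: map_pmf_rep_eq[symmetric] map_bind_pmf pmf.map_comp comp_def)
  also have "bind_pmf (H k) (\<lambda>l. K (last l)) = B (law k)"
    unfolding last[symmetric] by (simp add: bind_map_pmf)
  finally show ?case by simp
qed

lemma
  fixes f :: "nat \<Rightarrow> 'b::{banach, second_countable_topology}"
  shows integral_X: "(\<integral>\<omega>. f (X k \<omega>) \<partial>M) = (\<integral>x. f x \<partial>(law k))"
    and integrable_X: "integrable M (\<lambda>\<omega>. f (X k \<omega>)) \<longleftrightarrow> integrable (measure_pmf (law k)) f"
  unfolding distr_X[symmetric]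
  by (simp_all add: integral_distr integrable_distr_eq)

lemma integrable_W_L0: "integrable (measure_pmf L0) W"
proof -
  have "integrable M (\<lambda>\<omega>. W (X0 \<omega>))"
  proof (rule Bochner_Integration.integrable_bound)
    show "integrable M (\<lambda>\<omega>. 8 * (real (X0 \<omega>) ^ 3 + 1))" using X0_3 by simp
    have [measurable]: "X0 \<in> measurable M (count_space UNIV)" using measurable_X[of 0] by (simp cong: measurable_cong)
    show "(\<lambda>\<omega>. W (X0 \<omega>)) \<in> borel_measurable M" by measurable
    show "AE \<omega> in M. norm (W (X0 \<omega>)) \<le> norm (8 * (real (X0 \<omega>) ^ 3 + 1))"
      using W_pos W_le_power3 by (simp add: less_imp_le)
  qed
  then show ?thesis using integrable_X[of W 0] by simp
qed

lemma integrable_cubic_X: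
  fixes f :: "nat \<Rightarrow> 'b::{banach, second_countable_topology}"
  shows "cubic f \<Longrightarrow> integrable M (\<lambda>\<omega>. f (X k \<omega>))"
  unfolding integrable_X by (rule integrable_cubic[OF _ integrable_W_iterate[OF integrable_W_L0]])

end

section \<open>Limits of additive functionals\<close>

text \<open>This is the derivative of the exponential at 0, taken along
  \<open>z / n\<close>.\<close>

lemma scaled_exp_limit: "(\<lambda>n. of_nat n * (exp (z / of_nat n) - 1)) \<longlonglongrightarrow> (z :: complex)"
proof (cases "z = 0")
  case False
  have "((\<lambda>h. (exp h - 1) / h) \<longlongrightarrow> 1) (at (0::complex))"
    using DERIV_exp[of "0::complex"] by (simp add: DERIV_def)
  moreover have "filterlim (\<lambda>n. z / of_nat n) (at 0) sequentially"
  proof (rule filterlim_atI)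
    show "(\<lambda>n. z / of_nat n) \<longlonglongrightarrow> 0" by (rule lim_const_over_n)
    show "eventually (\<lambda>n. z / of_nat n \<noteq> 0) sequentially"
      using eventually_gt_at_top[of 0] by eventually_elim (use False in auto)
  qed
  ultimately have "(\<lambda>n. (exp (z / of_nat n) - 1) / (z / of_nat n)) \<longlonglongrightarrow> 1"
    by (rule filterlim_compose)
  from tendsto_mult[OF tendsto_const[of z] this]
  have "(\<lambda>n. z * ((exp (z / of_nat n) - 1) / (z / of_nat n))) \<longlonglongrightarrow> z" by simp
  moreover have "eventually (\<lambda>n. z * ((exp (z / of_nat n) - 1) / (z / of_nat n)) = of_nat n * (exp (z / of_nat n) - 1)) sequentially"
    using eventually_gt_at_top[of 0] by eventually_elim (use False in \<open>simp add: field_simps\<close>)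
  ultimately show ?thesis by (rule Lim_transform_eventually)
qed simp

context inar_process
begin

text \<open>Let \<open>h\<close> solve the Poisson equation \<open>h - K h = g - \<integral>g d\<pi>\<close>. Weighting the exponential functional
  by \<open>1 - (c/n) h(X\<^sub>j)\<close> replaces the random factor \<open>1 - (c/n) g(X\<^sub>j)\<close> gained in each step by a
  constant one, up to an error that is \<open>o(1/n)\<close> uniformly in \<open>j\<close>.\<close>

theorem exponential_functional_limit:
  fixes \<zeta> :: "nat \<Rightarrow> nat \<Rightarrow> nat \<Rightarrow> real" and c :: complex
  assumes g: "solvable g" "cubic g"
    and lim: "\<And>x. (\<lambda>n. of_nat n * ((\<integral>y. iexp (\<zeta> n x y) \<partial>measure_pmf (K x)) - 1)) \<longlonglongrightarrow> - c * complex_of_real (g x)"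
    and bnd: "\<And>n x. norm (of_nat n * ((\<integral>y. iexp (\<zeta> n x y) \<partial>measure_pmf (K x)) - 1)) \<le> C * W x"
    and \<zeta>0: "\<And>x y. (\<lambda>n. \<zeta> n x y) \<longlonglongrightarrow> 0"
  shows "(\<lambda>n. \<integral>\<omega>. indicator A (hist r \<omega>) * iexp (\<Sum>j\<in>{r..<n}. \<zeta> n (X j \<omega>) (X (Suc j) \<omega>)) \<partial>M)
     \<longlonglongrightarrow> complex_of_real (measure M {\<omega>\<in>space M. hist r \<omega> \<in> A}) * exp (- c * complex_of_real (\<integral>x. g x \<partial>measure_pmf \<pi>))"
proof -
  define v where "v = (\<integral>x. g x \<partial>measure_pmf \<pi>)"
  obtain h where h: "cubic h" "\<And>x. h x - T h x = g x - v"
    using poisson_equation[OF g] unfolding v_def by blast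
  have hc: "cubic (\<lambda>x. complex_of_real (h x))" by (rule cubic_of_real[OF h(1)])
  define cor where "cor = (\<lambda>n x. 1 - c / of_nat n * complex_of_real (h x))"
  \<comment> \<open>An exponential instead of \<open>1 - c * v / n\<close>, so that the
    \<open>n\<close>-th power is exactly \<open>exp (- (c * v))\<close> for positive
    \<open>n\<close>.\<close>
  define \<rho> where "\<rho> = (\<lambda>n. exp (- (c * v) / of_nat n))"
  define \<Psi> where "\<Psi> = (\<lambda>n x. \<integral>y. iexp (\<zeta> n x y) * cor n y \<partial>measure_pmf (K x))"
  \<comment> \<open>The one-step defect magnified by \<open>n\<close>; its mean absolute value has
    to vanish uniformly over the times.\<close>
  define w where "w = (\<lambda>n x. of_nat n * (\<Psi> n x - \<rho> n * cor n x))"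
  define R where "R = exp (norm (c * v))"
  have cor: "cubic (cor n)" for n unfolding cor_def by (intro cubic_diff cubic_const cubic_cmult hc)
  have R1: "1 \<le> R" unfolding R_def by simp
  \<comment> \<open>The modulus of \<rho> may exceed 1. Boundedness of its powers up to
    \<open>n\<close> keeps the telescoped error proportional to the sum of the defects.\<close>
  have \<rho>_power: "norm (\<rho> n ^ m) \<le> R" if "m \<le> n" for m n
  proof (cases "n = 0")
    case False
    have "\<rho> n ^ m = exp (of_nat m * (- (c * v) / of_nat n))"
      unfolding \<rho>_def by (rule exp_of_nat_mult[symmetric])
    also have "norm \<dots> \<le> exp (norm (of_nat m * (- (c * v) / of_nat n)))" by (rule norm_exp)
    also have "norm (of_nat m * (- (c * v) / of_nat n)) = real m / real n * norm (c * v)"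
      by (simp add: norm_mult norm_divide)
    also have "\<dots> \<le> 1 * norm (c * v)"
      using that False by (intro mult_right_mono) auto
    finally show ?thesis unfolding R_def by simp
  qed (use that R1 in simp)
  have \<rho>_le: "norm (\<rho> n) \<le> R" for n
  proof (cases "n = 0")
    case True
    then show ?thesis using R1 by (simp add: \<rho>_def)
  next
    case False
    then show ?thesis using \<rho>_power[of 1 n] by simp
  qed
  have \<rho>_lim: "(\<lambda>n. of_nat n * (\<rho> n - 1)) \<longlonglongrightarrow> - (c * v)"
    unfolding \<rho>_def by (rule scaled_exp_limit)
  then obtain C\<rho> where C\<rho>: "\<And>n. norm (of_nat n * (\<rho> n - 1)) \<le> C\<rho>"
    using convergent_imp_Bseq[of "\<lambda>n. of_nat n * (\<rho> n - 1)"] unfolding convergent_def Bseq_def by blast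
  have \<rho>1: "\<rho> \<longlonglongrightarrow> 1"
  proof -
    have "(\<lambda>n. exp (- (c * v) / of_nat n)) \<longlonglongrightarrow> exp 0" by (intro tendsto_exp lim_const_over_n)
    then show ?thesis unfolding \<rho>_def by simp
  qed
  have int_e: "integrable (K x) (\<lambda>y. iexp (\<zeta> n x y))" for n x
    by (rule measure_pmf.integrable_const_bound[where B=1]) auto
  have int_eh: "integrable (K x) (\<lambda>y. iexp (\<zeta> n x y) * h y)" for n x
    by (rule integrable_cubic_K[OF cubic_bound[OF _ h(1)]]) (simp add: norm_mult)
  have w_eq: "w n x = of_nat n * ((\<integral>y. iexp (\<zeta> n x y) \<partial>measure_pmf (K x)) - 1) - of_nat n * (\<rho> n - 1)
      - c * (\<integral>y. iexp (\<zeta> n x y) * h y \<partial>measure_pmf (K x)) + \<rho> n * c * h x" if "0 < n" for n x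
  proof -
    have "\<Psi> n x = (\<integral>y. iexp (\<zeta> n x y) - c / of_nat n * (iexp (\<zeta> n x y) * h y) \<partial>measure_pmf (K x))"
      unfolding \<Psi>_def cor_def by (simp add: algebra_simps)
    also have "\<dots> = (\<integral>y. iexp (\<zeta> n x y) \<partial>measure_pmf (K x)) - c / of_nat n * (\<integral>y. iexp (\<zeta> n x y) * h y \<partial>measure_pmf (K x))"
      unfolding Bochner_Integration.integral_diff[OF int_e integrable_mult_right[OF int_eh]] by simp
    finally have \<Psi>: "\<Psi> n x = \<dots>" .
    have alg: "N * ((E - c / N * G) - q * (1 - c / N * z)) = N * (E - 1) - N * (q - 1) - c * G + q * c * z"
      if "N \<noteq> 0" for N E G q z :: complex
      using that by (simp add: field_simps)
    show ?thesis unfolding w_def cor_def \<Psi> by (rule alg) (use that in simp)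
  qed
  have w_lim: "(\<lambda>n. w n x) \<longlonglongrightarrow> 0" for x
  proof -
    have "(\<lambda>n. \<integral>y. iexp (\<zeta> n x y) * h y \<partial>measure_pmf (K x)) \<longlonglongrightarrow> (\<integral>y. complex_of_real (h y) \<partial>measure_pmf (K x))"
    proof (rule integral_dominated_convergence[where w="\<lambda>y. \<bar>h y\<bar>"])
      have "(\<lambda>n. exp (\<i> * complex_of_real (\<zeta> n x y)) * h y) \<longlonglongrightarrow> exp (\<i> * complex_of_real 0) * h y" for y
        by (intro tendsto_intros \<zeta>0)
      then show "AE y in K x. (\<lambda>n. iexp (\<zeta> n x y) * h y) \<longlonglongrightarrow> h y" by simp
      show "integrable (K x) (\<lambda>y. \<bar>h y\<bar>)" by (intro integrable_abs integrable_cubic_K h)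
    qed (simp_all add: norm_mult)
    then have "(\<lambda>n. of_nat n * ((\<integral>y. iexp (\<zeta> n x y) \<partial>measure_pmf (K x)) - 1) - of_nat n * (\<rho> n - 1)
      - c * (\<integral>y. iexp (\<zeta> n x y) * h y \<partial>measure_pmf (K x)) + \<rho> n * c * h x) \<longlonglongrightarrow>
       - c * g x - (- (c * v)) - c * (\<integral>y. complex_of_real (h y) \<partial>measure_pmf (K x)) + 1 * c * h x"
      by (intro tendsto_intros lim \<rho>_lim \<rho>1)
    \<comment> \<open>The limit collapses to zero exactly because \<open>h\<close> solves the
      Poisson equation.\<close>
    also have "- c * g x - (- (c * v)) - c * (\<integral>y. complex_of_real (h y) \<partial>measure_pmf (K x)) + 1 * c * h x
        = c * complex_of_real (h x - T h x - (g x - v))"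
      by (simp add: algebra_simps)
    also have "\<dots> = 0" unfolding h(2) by simp
    finally show ?thesis
      by (rule Lim_transform_eventually)
        (use eventually_gt_at_top[of 0] in \<open>eventually_elim, simp only: w_eq\<close>)
  qed
  obtain Ch where Ch: "0 \<le> Ch" "\<And>x. norm (h x) \<le> Ch * W x" using cubicE[OF h(1)] by blast
  have "cubic (\<lambda>x. \<bar>h x\<bar>)" using h(1) by (simp add: cubic_def)
  from cubicE[OF cubic_integral_K[OF this]]
  obtain CT where CT: "0 \<le> CT" "\<And>x. norm (\<integral>y. \<bar>h y\<bar> \<partial>measure_pmf (K x)) \<le> CT * W x" by blast
  have C0: "0 \<le> C" using order_trans[OF norm_ge_zero bnd[of 0 0]] by (simp add: W_def)
  have C\<rho>0: "0 \<le> C\<rho>" using order_trans[OF norm_ge_zero C\<rho>[of 0]] .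
  have w_bnd: "norm (w n x) \<le> (C + C\<rho> + norm c * CT + R * norm c * Ch) * W x" for n x
  proof (cases "n = 0")
    case True
    have "0 \<le> (C + C\<rho> + norm c * CT + R * norm c * Ch) * W x"
      using C0 C\<rho>0 CT Ch R1 W_pos[of x] by (intro mult_nonneg_nonneg add_nonneg_nonneg) auto
    then show ?thesis using True by (simp add: w_def)
  next
    case False
    have 1: "norm (\<integral>y. iexp (\<zeta> n x y) * h y \<partial>measure_pmf (K x)) \<le> CT * W x"
    proof -
      have "norm (\<integral>y. iexp (\<zeta> n x y) * h y \<partial>measure_pmf (K x)) \<le> (\<integral>y. norm (iexp (\<zeta> n x y) * h y) \<partial>measure_pmf (K x))"
        by (rule integral_norm_bound)
      also have "\<dots> = (\<integral>y. \<bar>h y\<bar> \<partial>measure_pmf (K x))" by (simp add: norm_mult)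
      finally show ?thesis using CT(2)[of x] by simp
    qed
    have "norm (w n x) \<le> norm (of_nat n * ((\<integral>y. iexp (\<zeta> n x y) \<partial>measure_pmf (K x)) - 1)) + norm (of_nat n * (\<rho> n - 1))
      + norm (c * (\<integral>y. iexp (\<zeta> n x y) * h y \<partial>measure_pmf (K x))) + norm (\<rho> n * c * h x)"
      unfolding w_eq[OF False[folded neq0_conv, unfolded neq0_conv]]
      by (intro norm_triangle_mono norm_triangle_ineq4[THEN order_trans] add_mono order_refl)
    also have "\<dots> \<le> C * W x + C\<rho> * W x + norm c * (CT * W x) + R * norm c * (Ch * W x)"
    proof (intro add_mono bnd)
      show "norm (of_nat n * (\<rho> n - 1)) \<le> C\<rho> * W x"
        using C\<rho>[of n] mult_left_mono[OF W_ge1[of x] C\<rho>0] by simp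
      show "norm (c * (\<integral>y. iexp (\<zeta> n x y) * h y \<partial>measure_pmf (K x))) \<le> norm c * (CT * W x)"
        unfolding norm_mult by (intro mult_left_mono 1 norm_ge_zero)
      show "norm (\<rho> n * c * h x) \<le> R * norm c * (Ch * W x)"
        unfolding norm_mult using Ch(2)[of x] \<rho>_le[of n] R1 by (intro mult_mono) auto
    qed
    finally show ?thesis by (simp add: algebra_simps)
  qed
  have unif: "eventually (\<lambda>n. \<forall>j. (\<integral>x. norm (w n x) \<partial>measure_pmf (law j)) \<le> \<epsilon>) sequentially" if "0 < \<epsilon>" for \<epsilon>
  proof -
    have "eventually (\<lambda>n. \<forall>j. (\<integral>x. \<bar>norm (w n x)\<bar> \<partial>measure_pmf (law j)) \<le> \<epsilon>) sequentially"
      by (rule uniform_dominated_convergence[OF integrable_W_L0 _ _ that,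
          where C="C + C\<rho> + norm c * CT + R * norm c * Ch"])
        (use w_bnd in simp, use w_lim tendsto_norm_zero in blast)
    then show ?thesis by simp
  qed
  define U where "U = (\<lambda>n j \<omega>. indicator A (hist r \<omega>) * iexp (\<Sum>i\<in>{r..<j}. \<zeta> n (X i \<omega>) (X (Suc i) \<omega>)))"
  define F where "F = (\<lambda>n j. \<integral>\<omega>. U n j \<omega> * cor n (X j \<omega>) \<partial>M)"
  have U_norm: "norm (U n j \<omega>) \<le> 1" for n j \<omega>
    by (simp add: U_def norm_mult indicator_def)
  \<comment> \<open>The same functional read off a history list, so that the Markov property
    applies; \<open>take (Suc r)\<close> recovers the early history.\<close>
  define u where "u = (\<lambda>n j l. indicator A (take (Suc r) l) * iexp (\<Sum>i\<in>{r..<j}. \<zeta> n (l ! i) (l ! Suc i)))"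
  have U_u: "U n j \<omega> = u n j (hist j \<omega>)" if "r \<le> j" for n j \<omega>
    unfolding U_def u_def using that
    by (intro arg_cong2[where f="(*)"] arg_cong[where f="\<lambda>x. iexp x"] sum.cong)
      (simp_all add: take_hist del: inar_X.simps)
  have U_meas: "U n j \<in> borel_measurable M" if "r \<le> j" for n j
    unfolding U_u[OF that, abs_def] by (rule measurable_compose[OF measurable_hist]) simp
  have U_int: "integrable M (\<lambda>\<omega>. U n j \<omega> * f (X j \<omega>))" if "r \<le> j" "cubic f" for n j and f :: "nat \<Rightarrow> complex"
  proof (rule Bochner_Integration.integrable_bound[OF integrable_cubic_X[OF that(2)]])
    show "(\<lambda>\<omega>. U n j \<omega> * f (X j \<omega>)) \<in> borel_measurable M"
      by (intro borel_measurable_times U_meas that measurable_compose[OF measurable_X]) simp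
    show "AE \<omega> in M. norm (U n j \<omega> * f (X j \<omega>)) \<le> norm (f (X j \<omega>))"
      using U_norm by (auto simp: norm_mult intro!: mult_left_le_one_le)
  qed
  have U_Suc: "U n (Suc j) \<omega> = u n j (hist j \<omega>) * iexp (\<zeta> n (last (hist j \<omega>)) (X (Suc j) \<omega>))" if "r \<le> j" for n j \<omega>
    using that unfolding U_u[OF that, symmetric] by (simp add: U_def distrib_left exp_add del: inar_X.simps)
  have F_Suc: "F n (Suc j) = (\<integral>\<omega>. U n j \<omega> * \<Psi> n (X j \<omega>) \<partial>M)" if "r \<le> j" for n j
  proof -
    define f where "f = (\<lambda>l y. u n j l * (iexp (\<zeta> n (last l) y) * cor n y))"
    have eq: "U n (Suc j) \<omega> * cor n (X (Suc j) \<omega>) = f (hist j \<omega>) (X (Suc j) \<omega>)" for \<omega>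
      unfolding U_Suc[OF that] f_def by (simp only: mult.assoc)
    have "integrable M (\<lambda>\<omega>. f (hist j \<omega>) (X (Suc j) \<omega>))"
      unfolding eq[symmetric] by (rule U_int) (use that cor in auto)
    from markov_property[OF this]
    have "F n (Suc j) = (\<integral>\<omega>. \<integral>y. f (hist j \<omega>) y \<partial>measure_pmf (K (X j \<omega>)) \<partial>M)"
      unfolding F_def eq .
    also have "\<dots> = (\<integral>\<omega>. U n j \<omega> * \<Psi> n (X j \<omega>) \<partial>M)"
      unfolding f_def \<Psi>_def U_u[OF that] by simp
    finally show ?thesis .
  qed
  have \<Psi>: "cubic (\<Psi> n)" for n
  proof -
    have "norm (\<Psi> n x) \<le> norm (\<integral>y. norm (cor n y) \<partial>measure_pmf (K x))" for x
    proof -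
      have "norm (\<Psi> n x) \<le> (\<integral>y. norm (iexp (\<zeta> n x y) * cor n y) \<partial>measure_pmf (K x))"
        unfolding \<Psi>_def by (rule integral_norm_bound)
      then show ?thesis by (simp add: norm_mult)
    qed
    moreover have "cubic (\<lambda>x. norm (cor n x))" using cor[of n] by (simp add: cubic_def)
    from cubic_integral_K[OF this] have "cubic (\<lambda>x. \<integral>y. norm (cor n y) \<partial>measure_pmf (K x))" .
    ultimately show ?thesis by (rule cubic_bound)
  qed
  have step: "norm (F n (Suc j) - \<rho> n * F n j) \<le> \<epsilon> / n"
    if "r \<le> j" "0 < n" and \<epsilon>: "\<And>j. (\<integral>x. norm (w n x) \<partial>measure_pmf (law j)) \<le> \<epsilon>" for n j \<epsilon>
  proof -
    let ?d = "\<lambda>x. \<Psi> n x - \<rho> n * cor n x"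
    have d: "cubic ?d" by (intro cubic_diff \<Psi> cubic_cmult cor)
    have "(\<integral>\<omega>. U n j \<omega> * ?d (X j \<omega>) \<partial>M) =
        (\<integral>\<omega>. U n j \<omega> * \<Psi> n (X j \<omega>) - \<rho> n * (U n j \<omega> * cor n (X j \<omega>)) \<partial>M)"
      by (intro Bochner_Integration.integral_cong refl) (simp add: algebra_simps)
    also have "\<dots> = F n (Suc j) - \<rho> n * F n j"
      unfolding F_Suc[OF that(1)]
      by (subst Bochner_Integration.integral_diff[OF U_int[OF that(1) \<Psi>] integrable_mult_right[OF U_int[OF that(1) cor]]])
        (simp add: F_def)
    finally have eq: "(\<integral>\<omega>. U n j \<omega> * ?d (X j \<omega>) \<partial>M) = F n (Suc j) - \<rho> n * F n j" .
    have "norm (F n (Suc j) - \<rho> n * F n j) \<le> (\<integral>\<omega>. norm (U n j \<omega> * ?d (X j \<omega>)) \<partial>M)"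
      unfolding eq[symmetric] by (rule integral_norm_bound)
    also have "\<dots> \<le> (\<integral>\<omega>. norm (?d (X j \<omega>)) \<partial>M)"
    proof (rule integral_mono)
      show "integrable M (\<lambda>\<omega>. norm (U n j \<omega> * ?d (X j \<omega>)))"
        using U_int[OF that(1) d] by (rule integrable_norm)
      show "integrable M (\<lambda>\<omega>. norm (?d (X j \<omega>)))"
        using integrable_cubic_X[OF d] by (rule integrable_norm)
      show "norm (U n j \<omega> * ?d (X j \<omega>)) \<le> norm (?d (X j \<omega>))" for \<omega>
        unfolding norm_mult by (rule mult_left_le_one_le[OF norm_ge_zero norm_ge_zero U_norm])
    qed
    also have "\<dots> = (\<integral>\<omega>. norm (w n (X j \<omega>)) / n \<partial>M)"
      using that(2) by (simp add: w_def norm_mult)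
    also have "\<dots> = (\<integral>x. norm (w n x) / n \<partial>measure_pmf (law j))"
      by (rule integral_X)
    also have "\<dots> \<le> \<epsilon> / n"
      using \<epsilon>[of j] that(2) by (simp add: divide_right_mono)
    finally show ?thesis .
  qed
  \<comment> \<open>The defects telescope with powers of \<rho> as weights: at most \<open>n\<close>
    steps with errors of size \<open>\<epsilon> / n\<close> add up to order \<epsilon>.\<close>
  have iterate: "norm (F n (r + m) - \<rho> n ^ m * F n r) \<le> real m * (R * (\<epsilon> / n))"
    if "r + m \<le> n" "0 < n" "0 \<le> \<epsilon>" and \<epsilon>: "\<And>j. (\<integral>x. norm (w n x) \<partial>measure_pmf (law j)) \<le> \<epsilon>" for n m \<epsilon>
  proof -
    have tel: "F n (r + m) - \<rho> n ^ m * F n r = (\<Sum>i<m. \<rho> n ^ (m - Suc i) * (F n (Suc (r + i)) - \<rho> n * F n (r + i)))" for m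
    proof (induction m)
      case (Suc m)
      have "(\<Sum>i<m. \<rho> n ^ (Suc m - Suc i) * (F n (Suc (r + i)) - \<rho> n * F n (r + i)))
         = \<rho> n * (\<Sum>i<m. \<rho> n ^ (m - Suc i) * (F n (Suc (r + i)) - \<rho> n * F n (r + i)))"
        unfolding sum_distrib_left
      proof (intro sum.cong refl)
        fix i assume "i \<in> {..<m}"
        then have "Suc m - Suc i = Suc (m - Suc i)" by auto
        then show "\<rho> n ^ (Suc m - Suc i) * (F n (Suc (r + i)) - \<rho> n * F n (r + i))
           = \<rho> n * (\<rho> n ^ (m - Suc i) * (F n (Suc (r + i)) - \<rho> n * F n (r + i)))" by simp
      qed
      also have "\<dots> = \<rho> n * (F n (r + m) - \<rho> n ^ m * F n r)" unfolding Suc.IH ..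
      finally show ?case by (simp add: algebra_simps)
    qed simp
    have "norm (F n (r + m) - \<rho> n ^ m * F n r) \<le> (\<Sum>i<m. R * (\<epsilon> / n))"
      unfolding tel
    proof (rule sum_norm_le)
      fix i assume i: "i \<in> {..<m}"
      show "norm (\<rho> n ^ (m - Suc i) * (F n (Suc (r + i)) - \<rho> n * F n (r + i))) \<le> R * (\<epsilon> / n)"
        unfolding norm_mult
        by (intro mult_mono \<rho>_power step \<epsilon>) (use that R1 i in auto)
    qed
    then show ?thesis by simp
  qed
  define P where "P = complex_of_real (measure M {\<omega>\<in>space M. hist r \<omega> \<in> A})"
  \<comment> \<open>The tail estimate alone bounds the mean of the corrector uniformly: below
    \<open>N\<close> monotonicity gives \<open>W x \<le> W N\<close>, and the rest contributes at
    most 1.\<close>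
  obtain DW where DW: "\<And>j. (\<integral>x. \<bar>h x\<bar> \<partial>measure_pmf (law j)) \<le> DW"
  proof -
    obtain N where N: "\<And>n. (\<integral>x. W x * indicator {N..} x \<partial>(law n)) \<le> 1"
      using tail_W_uniform[OF integrable_W_L0, of 1] by auto
    have "(\<integral>x. \<bar>h x\<bar> \<partial>measure_pmf (law j)) \<le> Ch * (W N + 1)" for j
    proof -
      note iW = integrable_W_iterate[OF integrable_W_L0, of j]
      have i: "integrable (law j) (\<lambda>x. W x * indicator {N..} x)"
        using iW by (rule Bochner_Integration.integrable_bound) (auto simp: indicator_def)
      have "(\<integral>x. \<bar>h x\<bar> \<partial>measure_pmf (law j)) \<le> (\<integral>x. Ch * (W N + W x * indicator {N..} x) \<partial>measure_pmf (law j))"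
      proof (rule integral_mono)
        show "integrable (law j) (\<lambda>x. \<bar>h x\<bar>)"
          by (intro integrable_abs integrable_cubic[OF h(1) iW])
        show "integrable (law j) (\<lambda>x. Ch * (W N + W x * indicator {N..} x))" using i by simp
        show "\<bar>h x\<bar> \<le> Ch * (W N + W x * indicator {N..} x)" for x
        proof -
          have "W x \<le> W N + W x * indicator {N..} x"
            using monoD[OF mono_W, of x N] W_pos[of N] by (cases "x < N") auto
          from mult_left_mono[OF this Ch(1)] show ?thesis using Ch(2)[of x] by simp
        qed
      qed
      also have "\<dots> = Ch * (W N + (\<integral>x. W x * indicator {N..} x \<partial>measure_pmf (law j)))" using i by simp
      also have "\<dots> \<le> Ch * (W N + 1)" using N[of j] Ch(1) by (intro mult_left_mono) auto
      finally show ?thesis .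
    qed
    then show ?thesis using that by blast
  qed
  have F_U: "norm ((\<integral>\<omega>. U n j \<omega> \<partial>M) - F n j) \<le> norm c * DW / n" if "r \<le> j" for n j
  proof -
    have i: "integrable M (\<lambda>\<omega>. U n j \<omega> * (c / of_nat n * h (X j \<omega>)))"
      by (rule U_int[OF that]) (intro cubic_cmult hc)
    have "F n j = (\<integral>\<omega>. U n j \<omega> * 1 - U n j \<omega> * (c / of_nat n * h (X j \<omega>)) \<partial>M)"
      unfolding F_def cor_def by (simp only: right_diff_distrib)
    also have "\<dots> = (\<integral>\<omega>. U n j \<omega> * 1 \<partial>M) - (\<integral>\<omega>. U n j \<omega> * (c / of_nat n * h (X j \<omega>)) \<partial>M)"
      by (rule Bochner_Integration.integral_diff[OF U_int[OF that cubic_const] i])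
    finally have eq: "(\<integral>\<omega>. U n j \<omega> \<partial>M) - F n j = (\<integral>\<omega>. U n j \<omega> * (c / of_nat n * h (X j \<omega>)) \<partial>M)"
      by simp
    have "norm ((\<integral>\<omega>. U n j \<omega> \<partial>M) - F n j) \<le> (\<integral>\<omega>. norm (U n j \<omega> * (c / of_nat n * h (X j \<omega>))) \<partial>M)"
      unfolding eq by (rule integral_norm_bound)
    also have "\<dots> \<le> (\<integral>\<omega>. norm c / n * \<bar>h (X j \<omega>)\<bar> \<partial>M)"
    proof (rule integral_mono)
      show "integrable M (\<lambda>\<omega>. norm (U n j \<omega> * (c / of_nat n * h (X j \<omega>))))" using i by (rule integrable_norm)
      show "integrable M (\<lambda>\<omega>. norm c / n * \<bar>h (X j \<omega>)\<bar>)"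
        by (intro integrable_mult_right integrable_abs integrable_cubic_X h)
      show "norm (U n j \<omega> * (c / of_nat n * h (X j \<omega>))) \<le> norm c / n * \<bar>h (X j \<omega>)\<bar>" for \<omega>
        using mult_right_mono[OF U_norm[of n j \<omega>], of "norm c / n * \<bar>h (X j \<omega>)\<bar>"]
        by (simp add: norm_mult norm_divide)
    qed
    also have "\<dots> = (\<integral>x. norm c / n * \<bar>h x\<bar> \<partial>measure_pmf (law j))" by (rule integral_X)
    also have "\<dots> \<le> norm c / n * DW" using DW[of j] by (simp add: mult_left_mono divide_right_mono)
    finally show ?thesis by simp
  qed
  have small: "(\<lambda>n. norm c * DW / real n) \<longlonglongrightarrow> 0" by (rule lim_const_over_n)
  have FP: "(\<lambda>n. F n r) \<longlonglongrightarrow> P"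
  proof -
    have "(\<integral>\<omega>. U n r \<omega> \<partial>M) = P" for n
    proof -
      have "(\<integral>\<omega>. U n r \<omega> \<partial>M) = (\<integral>\<omega>. complex_of_real (indicator {\<omega>\<in>space M. hist r \<omega> \<in> A} \<omega>) \<partial>M)"
        unfolding U_def by (intro Bochner_Integration.integral_cong refl) (simp add: indicator_def)
      also have "\<dots> = P" unfolding P_def integral_complex_of_real by simp
      finally show ?thesis .
    qed
    then have "(\<lambda>n. P - F n r) \<longlonglongrightarrow> 0"
      using F_U[of r] by (intro Lim_null_comparison[OF _ small] always_eventually) auto
    from tendsto_diff[OF tendsto_const this, of P] show ?thesis by simp
  qed
  have "(\<lambda>n. F n n - \<rho> n ^ (n - r) * F n r) \<longlonglongrightarrow> 0"
  proof (rule LIMSEQ_I)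
    fix \<delta> :: real assume \<delta>: "0 < \<delta>"
    define \<epsilon> where "\<epsilon> = \<delta> / (2 * R)"
    have \<epsilon>: "0 < \<epsilon>" using \<delta> R1 by (simp add: \<epsilon>_def)
    obtain n0 where n0: "\<And>n j. n0 \<le> n \<Longrightarrow> (\<integral>x. norm (w n x) \<partial>measure_pmf (law j)) \<le> \<epsilon>"
      using unif[OF \<epsilon>] unfolding eventually_sequentially by blast
    have "norm (F n n - \<rho> n ^ (n - r) * F n r - 0) < \<delta>" if "max n0 (Suc r) \<le> n" for n
    proof -
      have "norm (F n (r + (n - r)) - \<rho> n ^ (n - r) * F n r) \<le> real (n - r) * (R * (\<epsilon> / n))"
        by (rule iterate) (use that n0 \<epsilon> in auto)
      also have "\<dots> \<le> real n * (R * (\<epsilon> / n))"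
        using R1 \<epsilon> by (intro mult_right_mono) auto
      also have "\<dots> = \<delta> / 2" using that R1 by (simp add: \<epsilon>_def)
      finally show ?thesis using that \<delta> by simp
    qed
    then show "\<exists>no. \<forall>n\<ge>no. norm (F n n - \<rho> n ^ (n - r) * F n r - 0) < \<delta>" by blast
  qed
  \<comment> \<open>The functional starts at \<open>r\<close>, so \<open>r\<close> factors are
    missing from the \<open>n\<close>-th power; each of them tends to 1.\<close>
  moreover have "(\<lambda>n. \<rho> n ^ (n - r)) \<longlonglongrightarrow> exp (- (c * v))"
  proof -
    have "(\<lambda>n. exp (- (c * v)) / \<rho> n ^ r) \<longlonglongrightarrow> exp (- (c * v)) / 1 ^ r"
      by (intro tendsto_intros \<rho>1) simp
    moreover have "eventually (\<lambda>n. exp (- (c * v)) / \<rho> n ^ r = \<rho> n ^ (n - r)) sequentially"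
      using eventually_ge_at_top[of "Suc r"]
    proof eventually_elim
      case (elim n)
      have "\<rho> n ^ n = exp (- (c * v))"
        unfolding \<rho>_def exp_of_nat_mult[symmetric] using elim by simp
      moreover have "\<rho> n \<noteq> 0" by (simp add: \<rho>_def)
      ultimately show ?case using elim by (simp add: power_diff)
    qed
    ultimately show ?thesis using Lim_transform_eventually by fastforce
  qed
  ultimately have "(\<lambda>n. (F n n - \<rho> n ^ (n - r) * F n r) + \<rho> n ^ (n - r) * F n r) \<longlonglongrightarrow> 0 + exp (- (c * v)) * P"
    using FP by (intro tendsto_add tendsto_mult)
  then have FL: "(\<lambda>n. F n n) \<longlonglongrightarrow> exp (- (c * v)) * P" by simp
  have "(\<lambda>n. (\<integral>\<omega>. U n n \<omega> \<partial>M) - F n n) \<longlonglongrightarrow> 0"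
    by (rule Lim_null_comparison[OF eventually_mono[OF eventually_ge_at_top[of r] F_U] small])
  from tendsto_add[OF this FL] show ?thesis
    unfolding U_def P_def v_def by (simp add: mult.commute)
qed

end

section \<open>Weak convergence: characteristic functions, tightness, and Slutsky's lemma under
  conditioning\<close>

lemma char_normal_var:
  assumes "0 \<le> v"
  shows "char (normal_var v) t = exp (- complex_of_real (t\<^sup>2 * v / 2))"
proof (cases "v = 0")
  case True
  then show ?thesis by (simp add: normal_var_def char_def integral_return)
next
  case False
  define \<sigma> where "\<sigma> = sqrt v"
  have \<sigma>: "0 < \<sigma>" "\<sigma>\<^sup>2 = v" using assms False by (auto simp: \<sigma>_def)
  let ?N = "density lborel (normal_density 0 \<sigma>)"
  interpret N: prob_space ?N by (rule prob_space_normal_density) (use \<sigma> in simp)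
  have "distr ?N lborel (\<lambda>x. x) = ?N" by (rule distr_id2) simp
  then have "distributed ?N lborel (\<lambda>x. x) (normal_density 0 \<sigma>)" unfolding distributed_def by simp
  then have "distributed ?N lborel (\<lambda>x. x / \<sigma>) std_normal_density"
    using N.normal_standard_normal_convert[OF \<sigma>(1), of "\<lambda>x. x" 0] by simp
  then have std: "distr ?N lborel (\<lambda>x. x / \<sigma>) = std_normal_distribution"
    by (simp add: distributed_def)
  have "char ?N t = (\<integral>x. iexp (t * \<sigma> * (x / \<sigma>)) \<partial>?N)"
    unfolding char_def using \<sigma> by simp
  also have "\<dots> = (\<integral>y. iexp (t * \<sigma> * y) \<partial>distr ?N lborel (\<lambda>x. x / \<sigma>))"
    by (rule integral_distr[symmetric]) auto
  also have "\<dots> = char std_normal_distribution (t * \<sigma>)" unfolding std char_def ..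
  also have "\<dots> = exp (- complex_of_real (t\<^sup>2 * v / 2))"
    unfolding char_std_normal_distribution using \<sigma>(2) by (simp add: power_mult_distrib exp_of_real[symmetric])
  finally show ?thesis using False by (simp add: normal_var_def \<sigma>_def)
qed

lemma real_distribution_normal_var:
  assumes "0 \<le> v" shows "real_distribution (normal_var v)"
proof (cases "v = 0")
  case True
  then show ?thesis
    by (auto simp: normal_var_def real_distribution_def real_distribution_axioms_def intro!: prob_space_return)
next
  case False
  then show ?thesis using assms prob_space_normal_density[of "sqrt v" 0]
    by (auto simp: normal_var_def real_distribution_def real_distribution_axioms_def)
qed

text \<open>The degenerate law has its only atom at 0; excluding this point lets zero and positive
  variance be treated alike.\<close>

lemma isCont_cdf_normal_var:
  assumes "0 \<le> v" "x \<noteq> 0" shows "isCont (cdf (normal_var v)) x"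
proof -
  interpret real_distribution "normal_var v" by (rule real_distribution_normal_var[OF assms(1)])
  have "measure (normal_var v) {x} = 0"
  proof (cases "v = 0")
    case True
    then show ?thesis using assms by (simp add: normal_var_def measure_return)
  next
    case False
    have "emeasure (density lborel (normal_density 0 (sqrt v))) {x}
      = (\<integral>\<^sup>+y. ennreal (normal_density 0 (sqrt v) y) * indicator {x} y \<partial>lborel)"
      by (rule emeasure_density) auto
    also have "\<dots> = (\<integral>\<^sup>+(y::real). 0 \<partial>lborel)"
    proof (rule nn_integral_cong_AE)
      show "AE y in lborel. ennreal (normal_density 0 (sqrt v) y) * indicator {x} y = 0"
        using AE_lborel_singleton[of x] by eventually_elim (simp add: indicator_def)
    qed
    finally show ?thesis using False by (simp add: normal_var_def measure_def)
  qed
  then show ?thesis by (simp add: isCont_cdf)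
qed

lemma norm_iexp_diff_le: "norm (iexp x - iexp y) \<le> \<bar>x - y\<bar>"
proof -
  have "iexp x - iexp y = iexp y * (iexp (x - y) - 1)"
    by (simp add: right_diff_distrib flip: exp_add)
  then have "norm (iexp x - iexp y) = norm (iexp (x - y) - 1)" by (simp add: norm_mult)
  also have "\<dots> \<le> \<bar>x - y\<bar>" using iexp_approx1[of "x - y" 0] by simp
  finally show ?thesis .
qed

lemma inverse_sqrt_lim: "(\<lambda>n. 1 / sqrt (real n)) \<longlonglongrightarrow> 0"
  using tendsto_real_sqrt[OF lim_1_over_n] by (simp add: real_sqrt_divide)

context prob_space
begin

text \<open>A conditional characteristic function becomes an unconditional integral with an
  indicator, the form in which the functional limit is proved.\<close>

lemma integral_uniform_measure:
  fixes f :: "'a \<Rightarrow> complex"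
  assumes [measurable]: "A \<in> events" "f \<in> borel_measurable M" and "0 < prob A"
  shows "(\<integral>x. f x \<partial>uniform_measure M A) = (\<integral>x. indicator A x * f x \<partial>M) / prob A"
proof -
  have "uniform_measure M A = density M (\<lambda>x. ennreal (indicator A x / prob A))"
    unfolding uniform_measure_def using assms(3)
    by (intro density_cong) (auto simp: emeasure_eq_measure indicator_def divide_ennreal[symmetric])
  then have "(\<integral>x. f x \<partial>uniform_measure M A) = (\<integral>x. (indicator A x / prob A) *\<^sub>R f x \<partial>M)"
    by (simp add: integral_density)
  also have "\<dots> = (\<integral>x. (indicator A x * f x) / prob A \<partial>M)"
    by (intro Bochner_Integration.integral_cong refl) (simp add: indicator_def scaleR_conv_of_real)
  finally show ?thesis by simp
qed

text \<open>Makes the unconditional limit laws instances of the conditional ones.\<close>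

lemma uniform_measure_space: "uniform_measure M (space M) = M"
  by (rule measure_eqI) (auto simp: emeasure_space_1 sets.Int_space_eq1 divide_ennreal_def)

lemma cdf_distr:
  "f \<in> borel_measurable M \<Longrightarrow> cdf (distr M borel f) x = prob {\<omega>\<in>space M. f \<omega> \<le> x}"
  unfolding cdf_def by (subst measure_distr) (auto intro!: arg_cong[where f=prob])

lemma prob_outside_le:
  fixes f :: "'a \<Rightarrow> real"
  assumes [measurable]: "f \<in> borel_measurable M" and "\<And>\<omega>. P \<omega> \<Longrightarrow> f \<omega> \<le> l \<or> u < f \<omega>"
  shows "prob {\<omega>\<in>space M. P \<omega>} \<le> prob {\<omega>\<in>space M. f \<omega> \<le> l} + (1 - prob {\<omega>\<in>space M. f \<omega> \<le> u})"
proof -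
  let ?U = "{\<omega>\<in>space M. f \<omega> \<le> u}"
  have "prob {\<omega>\<in>space M. P \<omega>} \<le> prob ({\<omega>\<in>space M. f \<omega> \<le> l} \<union> (space M - ?U))"
    by (intro finite_measure_mono subsetI) (use assms(2) in \<open>auto simp: not_le\<close>)
  also have "\<dots> \<le> prob {\<omega>\<in>space M. f \<omega> \<le> l} + prob (space M - ?U)"
    by (rule measure_Un_le) auto
  also have "prob (space M - ?U) = 1 - prob ?U" by (intro prob_compl) auto
  finally show ?thesis .
qed

text \<open>Distribution functions converge at \<open>C\<close> and \<open>- C\<close>, which are
  continuity points of the limit because \<open>C\<close> is positive.\<close>

lemma weak_conv_normal_tight:
  fixes Z :: "nat \<Rightarrow> 'a \<Rightarrow> real"
  assumes [measurable]: "\<And>n. Z n \<in> borel_measurable M" and v: "0 \<le> v"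
    and conv: "weak_conv_m (\<lambda>n. distr M borel (Z n)) (normal_var v)" and \<epsilon>: "0 < \<epsilon>"
  obtains C where "0 < C" "eventually (\<lambda>n. prob {\<omega>\<in>space M. C < \<bar>Z n \<omega>\<bar>} < \<epsilon>) sequentially"
proof -
  interpret N: real_distribution "normal_var v" by (rule real_distribution_normal_var[OF v])
  have "eventually (\<lambda>x. 1 - \<epsilon> / 4 < cdf (normal_var v) x) at_top"
    using \<epsilon> by (intro order_tendstoD(1)[OF N.cdf_lim_at_top_prob]) auto
  moreover have "eventually (\<lambda>x. cdf (normal_var v) x < \<epsilon> / 4) at_bot"
    using \<epsilon> by (intro order_tendstoD(2)[OF N.cdf_lim_at_bot]) auto
  then have "eventually (\<lambda>x. cdf (normal_var v) (- x) < \<epsilon> / 4) at_top"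
    by (simp add: at_bot_mirror eventually_filtermap)
  ultimately have "eventually (\<lambda>x. 1 - \<epsilon> / 4 < cdf (normal_var v) x \<and> cdf (normal_var v) (- x) < \<epsilon> / 4 \<and> 0 < x) at_top"
    using eventually_gt_at_top[of 0] by eventually_elim auto
  then obtain C where C: "1 - \<epsilon> / 4 < cdf (normal_var v) C" "cdf (normal_var v) (- C) < \<epsilon> / 4" "0 < C"
    using eventually_happens'[OF trivial_limit_at_top_linorder] by blast
  have lim: "(\<lambda>n. cdf (distr M borel (Z n)) x) \<longlonglongrightarrow> cdf (normal_var v) x" if "x \<noteq> 0" for x
    using conv isCont_cdf_normal_var[OF v that] unfolding weak_conv_m_def weak_conv_def by blast
  have "eventually (\<lambda>n. 1 - \<epsilon> / 4 < cdf (distr M borel (Z n)) C) sequentially"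
    using C by (intro order_tendstoD(1)[OF lim]) auto
  moreover have "eventually (\<lambda>n. cdf (distr M borel (Z n)) (- C) < \<epsilon> / 4) sequentially"
    using C by (intro order_tendstoD(2)[OF lim]) auto
  ultimately have "eventually (\<lambda>n. prob {\<omega>\<in>space M. C < \<bar>Z n \<omega>\<bar>} < \<epsilon>) sequentially"
  proof eventually_elim
    case (elim n)
    have "prob {\<omega>\<in>space M. C < \<bar>Z n \<omega>\<bar>} \<le> prob {\<omega>\<in>space M. Z n \<omega> \<le> - C} + (1 - prob {\<omega>\<in>space M. Z n \<omega> \<le> C})"
      by (rule prob_outside_le) auto
    then show ?case using elim \<epsilon> by (simp add: cdf_distr)
  qed
  with C(3) show ?thesis by (rule that)
qed

text \<open>Levy's theorem gives weak convergence to a point mass, whose distribution function jumps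
  only at \<open>c\<close>; its values at \<open>c - \<epsilon>\<close> and
  \<open>c + \<epsilon>\<close> bound the deviation probability.\<close>

lemma char_const_imp_conv_in_prob:
  fixes Z :: "nat \<Rightarrow> 'a \<Rightarrow> real"
  assumes [measurable]: "\<And>n. Z n \<in> borel_measurable M"
    and ch: "\<And>t. (\<lambda>n. \<integral>\<omega>. iexp (t * Z n \<omega>) \<partial>M) \<longlonglongrightarrow> iexp (t * c)" and \<epsilon>: "0 < \<epsilon>"
  shows "(\<lambda>n. prob {\<omega>\<in>space M. \<epsilon> < \<bar>Z n \<omega> - c\<bar>}) \<longlonglongrightarrow> 0"
proof -
  let ?N = "return borel c :: real measure"
  have rd: "real_distribution ?N"
    by (auto simp: real_distribution_def real_distribution_axioms_def intro!: prob_space_return)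
  interpret N: real_distribution ?N by (rule rd)
  have "weak_conv_m (\<lambda>n. distr M borel (Z n)) ?N"
    by (rule levy_continuity[OF _ rd]) (use ch in \<open>auto simp: char_def integral_distr integral_return\<close>)
  moreover have "isCont (cdf ?N) x" if "x \<noteq> c" for x
    using that by (simp add: N.isCont_cdf measure_return)
  ultimately have lim: "(\<lambda>n. cdf (distr M borel (Z n)) x) \<longlonglongrightarrow> cdf ?N x" if "x \<noteq> c" for x
    using that unfolding weak_conv_m_def weak_conv_def by blast
  let ?b = "\<lambda>n. prob {\<omega>\<in>space M. Z n \<omega> \<le> c - \<epsilon>} + (1 - prob {\<omega>\<in>space M. Z n \<omega> \<le> c + \<epsilon>})"
  have "?b \<longlonglongrightarrow> 0 + (1 - 1)"
    using lim[of "c - \<epsilon>"] lim[of "c + \<epsilon>"] \<epsilon>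
    by (intro tendsto_intros) (simp_all add: cdf_distr, simp_all add: cdf_def measure_return indicator_def)
  then have lim0: "?b \<longlonglongrightarrow> 0" by simp
  have bnd: "norm (prob {\<omega>\<in>space M. \<epsilon> < \<bar>Z n \<omega> - c\<bar>}) \<le> ?b n" for n
    unfolding real_norm_def abs_of_nonneg[OF measure_nonneg] by (rule prob_outside_le) auto
  show ?thesis by (rule Lim_null_comparison[OF always_eventually[OF allI[OF bnd]] lim0])
qed

text \<open>Slutsky's lemma combined with scaling by \<open>k\<close>, restricted to
  \<open>A\<close>: closeness of \<open>V n\<close> and \<open>k * Z n\<close> is required on that
  event only.\<close>

lemma conditional_weak_limit:
  fixes Z V :: "nat \<Rightarrow> 'a \<Rightarrow> real"
  assumes [measurable]: "A \<in> events" "\<And>n. Z n \<in> borel_measurable M" "\<And>n. V n \<in> borel_measurable M"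
    and A: "0 < prob A" and v: "0 \<le> v"
    and ch: "\<And>t. (\<lambda>n. \<integral>\<omega>. indicator A \<omega> * iexp (t * Z n \<omega>) \<partial>M) \<longlonglongrightarrow>
       complex_of_real (prob A) * exp (- complex_of_real (t\<^sup>2 * v / 2))"
    and diff: "\<And>\<epsilon>. 0 < \<epsilon> \<Longrightarrow> (\<lambda>n. prob {\<omega>\<in>space M. \<omega> \<in> A \<and> \<epsilon> < \<bar>V n \<omega> - k * Z n \<omega>\<bar>}) \<longlonglongrightarrow> 0"
  shows "weak_conv_m (\<lambda>n. distr (uniform_measure M A) borel (V n)) (normal_var (k\<^sup>2 * v))"
proof -
  have A0: "emeasure M A \<noteq> 0" "emeasure M A \<noteq> \<infinity>" using A by (auto simp: emeasure_eq_measure)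
  interpret U: prob_space "uniform_measure M A" by (rule prob_space_uniform_measure[OF A0])
  have kv: "0 \<le> k\<^sup>2 * v" using v by simp
  have int: "integrable M (\<lambda>\<omega>. indicator A \<omega> * iexp (t * Q \<omega>))" if [measurable]: "Q \<in> borel_measurable M" for Q t
    by (rule integrable_const_bound[where B=1]) (auto simp: norm_mult indicator_def)
  have "(\<lambda>n. \<integral>\<omega>. indicator A \<omega> * iexp (t * V n \<omega>) \<partial>M) \<longlonglongrightarrow>
       complex_of_real (prob A) * exp (- complex_of_real (t\<^sup>2 * (k\<^sup>2 * v) / 2))" for t
  proof -
    have "(\<lambda>n. (\<integral>\<omega>. indicator A \<omega> * iexp (t * V n \<omega>) \<partial>M) - (\<integral>\<omega>. indicator A \<omega> * iexp (t * k * Z n \<omega>) \<partial>M)) \<longlonglongrightarrow> 0"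
    proof (rule LIMSEQ_I)
      fix \<delta> :: real assume \<delta>: "0 < \<delta>"
      \<comment> \<open>Off the bad set the exponentials differ by at most
        \<open>\<bar>t\<bar> * \<epsilon>\<close>, which is at most half of \<delta>; on it they
        differ by at most 2, with probability below a quarter of \<delta>. Adding 1 covers
        \<open>t = 0\<close>.\<close>
      define \<epsilon> where "\<epsilon> = \<delta> / (2 * (\<bar>t\<bar> + 1))"
      have \<epsilon>: "0 < \<epsilon>" using \<delta> by (simp add: \<epsilon>_def)
      have t\<epsilon>: "\<bar>t\<bar> * \<epsilon> \<le> \<delta> / 2" using \<delta> by (simp add: \<epsilon>_def field_simps)
      define E where "E = (\<lambda>n. {\<omega>\<in>space M. \<omega> \<in> A \<and> \<epsilon> < \<bar>V n \<omega> - k * Z n \<omega>\<bar>})"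
      have [measurable]: "E n \<in> events" for n unfolding E_def by measurable
      have "eventually (\<lambda>n. prob (E n) < \<delta> / 4) sequentially"
        unfolding E_def using \<delta> by (intro order_tendstoD(2)[OF diff[OF \<epsilon>]]) auto
      then obtain n0 where n0: "\<And>n. n0 \<le> n \<Longrightarrow> prob (E n) < \<delta> / 4"
        unfolding eventually_sequentially by blast
      have "norm ((\<integral>\<omega>. indicator A \<omega> * iexp (t * V n \<omega>) \<partial>M) - (\<integral>\<omega>. indicator A \<omega> * iexp (t * k * Z n \<omega>) \<partial>M) - 0) < \<delta>"
        if "n0 \<le> n" for n
      proof -
        let ?d = "\<lambda>\<omega>. indicator A \<omega> * iexp (t * V n \<omega>) - indicator A \<omega> * iexp (t * k * Z n \<omega>)"
        have i: "integrable M ?d" by (intro Bochner_Integration.integrable_diff int) auto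
        have "norm (\<integral>\<omega>. ?d \<omega> \<partial>M) \<le> (\<integral>\<omega>. norm (?d \<omega>) \<partial>M)" by (rule integral_norm_bound)
        also have "\<dots> \<le> (\<integral>\<omega>. \<bar>t\<bar> * \<epsilon> + 2 * indicator (E n) \<omega> \<partial>M)"
        proof (rule integral_mono)
          show "integrable M (\<lambda>\<omega>. norm (?d \<omega>))" using i by (rule integrable_norm)
          show "integrable M (\<lambda>\<omega>. \<bar>t\<bar> * \<epsilon> + 2 * indicator (E n) \<omega>)"
            by (rule integrable_const_bound[where B="\<bar>t\<bar> * \<epsilon> + 2"]) (use \<epsilon> in \<open>auto simp: indicator_def\<close>)
          fix \<omega> assume \<omega>: "\<omega> \<in> space M"
          show "norm (?d \<omega>) \<le> \<bar>t\<bar> * \<epsilon> + 2 * indicator (E n) \<omega>"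
          proof (cases "\<omega> \<in> A")
            case True
            then have d: "?d \<omega> = iexp (t * V n \<omega>) - iexp (t * k * Z n \<omega>)" by simp
            show ?thesis
            proof (cases "\<omega> \<in> E n")
              case in_E: True
              have "norm (?d \<omega>) \<le> norm (iexp (t * V n \<omega>)) + norm (iexp (t * k * Z n \<omega>))"
                unfolding d by (rule norm_triangle_ineq4)
              also have "\<dots> = 2" by simp
              finally have "norm (?d \<omega>) \<le> 2" .
              moreover have "indicator (E n) \<omega> = (1::real)" using in_E by simp
              moreover have "0 \<le> \<bar>t\<bar> * \<epsilon>" using \<epsilon> by simp
              ultimately show ?thesis by linarith
            next
              case False
              then have "\<bar>V n \<omega> - k * Z n \<omega>\<bar> \<le> \<epsilon>" using True \<omega> by (auto simp: E_def)
              then have "\<bar>t\<bar> * \<bar>V n \<omega> - k * Z n \<omega>\<bar> \<le> \<bar>t\<bar> * \<epsilon>" by (simp add: mult_left_mono)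
              moreover have "norm (?d \<omega>) \<le> \<bar>t * V n \<omega> - t * k * Z n \<omega>\<bar>" unfolding d by (rule norm_iexp_diff_le)
              moreover have "\<bar>t * V n \<omega> - t * k * Z n \<omega>\<bar> = \<bar>t\<bar> * \<bar>V n \<omega> - k * Z n \<omega>\<bar>"
                by (simp add: right_diff_distrib mult.assoc flip: abs_mult)
              ultimately show ?thesis using False by simp
            qed
          qed (use \<epsilon> in simp)
        qed
        also have "\<dots> = \<bar>t\<bar> * \<epsilon> + 2 * prob (E n)"
          by (subst Bochner_Integration.integral_add)
            (auto simp: prob_space intro!: integrable_const_bound[of "indicator (E n) :: 'a \<Rightarrow> real" 1])
        also have "\<dots> < \<delta>" using n0[OF that] t\<epsilon> \<delta> by linarith
        finally have "norm (\<integral>\<omega>. ?d \<omega> \<partial>M) < \<delta>" .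
        moreover have "(\<integral>\<omega>. ?d \<omega> \<partial>M) = (\<integral>\<omega>. indicator A \<omega> * iexp (t * V n \<omega>) \<partial>M) - (\<integral>\<omega>. indicator A \<omega> * iexp (t * k * Z n \<omega>) \<partial>M)"
          by (intro Bochner_Integration.integral_diff int) simp_all
        ultimately show ?thesis by (simp only: diff_zero)
      qed
      then show "\<exists>no. \<forall>n\<ge>no. norm ((\<integral>\<omega>. indicator A \<omega> * iexp (t * V n \<omega>) \<partial>M) - (\<integral>\<omega>. indicator A \<omega> * iexp (t * k * Z n \<omega>) \<partial>M) - 0) < \<delta>"
        by blast
    qed
    \<comment> \<open>The limit for \<open>Z\<close> at the rescaled argument \<open>t * k\<close>
      produces the variance \<open>k\<^sup>2 * v\<close>.\<close>
    from tendsto_add[OF this ch[of "t * k"]] show ?thesis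
      by (simp add: power_mult_distrib mult.assoc)
  qed
  note lim = tendsto_divide[OF this tendsto_const[of "complex_of_real (prob A)"]]
  show ?thesis
  proof (rule levy_continuity)
    show "real_distribution (distr (uniform_measure M A) borel (V n))" for n
      by (rule U.real_distribution_distr) simp
    show "real_distribution (normal_var (k\<^sup>2 * v))" by (rule real_distribution_normal_var[OF kv])
    show "(\<lambda>n. char (distr (uniform_measure M A) borel (V n)) t) \<longlonglongrightarrow> char (normal_var (k\<^sup>2 * v)) t" for t
      using lim[of t] A unfolding char_normal_var[OF kv]
      by (simp add: char_def integral_distr integral_uniform_measure)
  qed
qed

end

section \<open>Conditional moments, and the two applications of the functional limit\<close>

context inar_law
begin

lemma solvable_powers: "solvable (\<lambda>x. real x ^ 2)" "solvable (\<lambda>x. real x ^ 3)"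
  unfolding powers_binom by (intro solvable_add solvable_cmult solvable_binom)+

lemma cubic_powers: "cubic (\<lambda>x. real x ^ 2)" "cubic (\<lambda>x. real x ^ 3)"
  unfolding powers_binom by (intro cubic_add cubic_cmult cubic_binom)+

definition cvar :: "nat \<Rightarrow> real" where
  "cvar x = \<alpha> * (1 - \<alpha>) * real x + measure_pmf.variance p real"

lemma conditional_mean: "(\<integral>y. real y - \<alpha> * real x - eps_moment 1 \<partial>measure_pmf (K x)) = 0"
  using integral_K_binom_1[of x] integrable_cubic_K[OF cubic_binom(1), of x]
  by (simp add: binom_1 del: One_nat_def flip: binom_1)

lemma conditional_variance:
  "integrable (measure_pmf (K x)) (\<lambda>y. (real y - \<alpha> * real x - eps_moment 1)\<^sup>2)"
  "(\<integral>y. (real y - \<alpha> * real x - eps_moment 1)\<^sup>2 \<partial>measure_pmf (K x)) = cvar x"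
proof -
  define m where "m = \<alpha> * real x + eps_moment 1"
  have gen: "(real y - c)\<^sup>2 = 2 * binom 2 y + (1 - 2 * c) * binom 1 y + c\<^sup>2" for y and c :: real
    unfolding binom_1 binom_2 by (simp add: power2_eq_square field_simps)
  have sq: "(real y - \<alpha> * real x - eps_moment 1)\<^sup>2 = 2 * binom 2 y + (1 - 2 * m) * binom 1 y + m\<^sup>2" for y
    using gen[of y m] by (simp add: m_def diff_diff_eq)
  have i: "integrable (K z) (binom 1)" "integrable (K z) (binom 2)" for z
    by (intro integrable_cubic_K cubic_binom)+
  show "integrable (measure_pmf (K x)) (\<lambda>y. (real y - \<alpha> * real x - eps_moment 1)\<^sup>2)"
    unfolding sq using i by simp
  have var: "measure_pmf.variance p real = 2 * eps_moment 2 + eps_moment 1 - (eps_moment 1)\<^sup>2"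
  proof -
    have ip: "integrable p (binom 1)" "integrable p (binom 2)" using i[of 0] by (simp_all add: K_0)
    have e: "(\<integral>y. real y \<partial>measure_pmf p) = eps_moment 1" by (simp add: eps_moment_def binom_1[abs_def] del: One_nat_def)
    have "measure_pmf.variance p real = 2 * eps_moment 2 + (1 - 2 * eps_moment 1) * eps_moment 1 + (eps_moment 1)\<^sup>2"
      unfolding e gen using ip by (simp add: eps_moment_def del: One_nat_def)
    then show ?thesis by (simp add: power2_eq_square algebra_simps)
  qed
  have "(\<integral>y. (real y - \<alpha> * real x - eps_moment 1)\<^sup>2 \<partial>measure_pmf (K x)) =
      2 * (\<integral>y. binom 2 y \<partial>measure_pmf (K x)) + (1 - 2 * m) * (\<integral>y. binom 1 y \<partial>measure_pmf (K x)) + m\<^sup>2"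
    unfolding sq using i by simp
  also have "\<dots> = cvar x"
    unfolding integral_K_binom_1 integral_K_binom_2 cvar_def var m_def
    unfolding binom_1 binom_2
    by (simp add: power2_eq_square field_simps)
  finally show "(\<integral>y. (real y - \<alpha> * real x - eps_moment 1)\<^sup>2 \<partial>measure_pmf (K x)) = cvar x" .
qed

definition m2 :: real where "m2 = (\<integral>x. real x ^ 2 \<partial>measure_pmf \<pi>)"

text \<open>The variance of one martingale increment in the stationary regime.\<close>

definition asy_var :: real where "asy_var = (\<integral>x. real x ^ 2 * cvar x \<partial>measure_pmf \<pi>)"

lemma sq_cvar: "real x ^ 2 * cvar x = \<alpha> * (1 - \<alpha>) * real x ^ 3 + measure_pmf.variance p real * real x ^ 2"
  by (simp add: cvar_def power2_eq_square power3_eq_cube algebra_simps)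

lemma solvable_sq_cvar: "solvable (\<lambda>x. real x ^ 2 * cvar x)" and cubic_sq_cvar: "cubic (\<lambda>x. real x ^ 2 * cvar x)"
  unfolding sq_cvar
  by (intro solvable_add solvable_cmult solvable_powers, intro cubic_add cubic_cmult cubic_powers)

lemma sigma2_eq: "inar_sigma2 \<alpha> p = asy_var / m2\<^sup>2"
  unfolding inar_sigma2_def Let_def m2_def asy_var_def sq_cvar
  using integrable_cubic[OF cubic_powers(1) integrable_W_stationary] integrable_cubic[OF cubic_powers(2) integrable_W_stationary]
  by (subst Bochner_Integration.integral_add) simp_all

lemma asy_var_nonneg: "0 \<le> asy_var"
  unfolding asy_var_def cvar_def using \<alpha> by (intro integral_nonneg_AE) (auto intro!: mult_nonneg_nonneg add_nonneg_nonneg)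

text \<open>A vanishing second moment would make the stationary law the point mass at 0, and
  invariance would turn the innovation law into the same point mass.\<close>

lemma m2_pos: "0 < m2"
proof -
  have "0 \<le> m2" unfolding m2_def by (intro integral_nonneg_AE) auto
  moreover have "m2 \<noteq> 0"
  proof
    assume "m2 = 0"
    then have "AE x in \<pi>. real x ^ 2 = 0"
      unfolding m2_def
      by (subst (asm) integral_nonneg_eq_0_iff_AE) (auto intro: integrable_cubic[OF cubic_powers(1) integrable_W_stationary])
    then have "set_pmf \<pi> \<subseteq> {0}" by (auto simp: AE_measure_pmf_iff)
    then have "\<pi> = return_pmf 0" by (simp add: set_pmf_subset_singleton)
    then have "p = return_pmf 0" using stationary by (simp add: bind_return_pmf K_0)
    then show False using p0 by simp
  qed
  ultimately show ?thesis by simp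
qed

end

context inar_process
begin

text \<open>The linear term of the conditional characteristic function drops out because increments
  are centred; the quadratic term is \<open>real x ^ 2 * cvar x\<close>, a cubic polynomial with
  solvable Poisson equation. The functional limit applies with
  \<open>c = t\<^sup>2 / 2\<close>.\<close>

theorem martingale_clt:
  "(\<lambda>n. \<integral>\<omega>. indicator A (hist r \<omega>) * iexp (t * ((\<Sum>j\<in>{r..<n}.
      real (X j \<omega>) * (real (X (Suc j) \<omega>) - \<alpha> * real (X j \<omega>) - eps_moment 1)) / sqrt n)) \<partial>M)
   \<longlonglongrightarrow> complex_of_real (measure M {\<omega>\<in>space M. hist r \<omega> \<in> A}) * exp (- complex_of_real (t\<^sup>2 * asy_var / 2))"
proof -
  define z where "z = (\<lambda>x y. t * (real x * (real y - \<alpha> * real x - eps_moment 1)))"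
  define \<zeta> where "\<zeta> = (\<lambda>n x y. z x y / sqrt (real n))"
  have z_int: "integrable (measure_pmf (K x)) (z x)" for x
    unfolding z_def using integrable_cubic_K[OF cubic_binom(1), of x]
    by (intro integrable_mult_right Bochner_Integration.integrable_diff) (simp_all add: binom_1[abs_def] del: One_nat_def)
  have z0: "(\<integral>y. z x y \<partial>measure_pmf (K x)) = 0" for x
    unfolding z_def integral_mult_right_zero conditional_mean by simp
  have z2: "(z x y)\<^sup>2 = t\<^sup>2 * real x ^ 2 * (real y - \<alpha> * real x - eps_moment 1)\<^sup>2" for x y
    by (simp add: z_def power_mult_distrib)
  have z2_int: "integrable (measure_pmf (K x)) (\<lambda>y. (z x y)\<^sup>2)" for x
    unfolding z2 by (intro integrable_mult_right conditional_variance)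
  have z2_eq: "(\<integral>y. (z x y)\<^sup>2 \<partial>measure_pmf (K x)) = t\<^sup>2 * (real x ^ 2 * cvar x)" for x
    unfolding z2 integral_mult_right_zero conditional_variance by simp
  \<comment> \<open>Subtracting the centred linear term leaves the integral unchanged, and the
    remainder is dominated by \<open>(z x y)\<^sup>2 / 2\<close> for all \<open>n\<close>.\<close>
  define d where "d = (\<lambda>n x y. of_nat n * (iexp (\<zeta> n x y) - 1 - \<i> * complex_of_real (\<zeta> n x y)))"
  have d_bnd: "norm (d n x y) \<le> (z x y)\<^sup>2 / 2" for n x y
  proof (cases "n = 0")
    case False
    have "norm (d n x y) = real n * norm (iexp (\<zeta> n x y) - 1 - \<i> * complex_of_real (\<zeta> n x y))"
      by (simp add: d_def norm_mult)
    also have "\<dots> \<le> real n * (\<bar>\<zeta> n x y\<bar>\<^sup>2 / 2)"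
      using iexp_approx1[of "\<zeta> n x y" 1] by (intro mult_left_mono) (simp_all add: numeral_2_eq_2 diff_diff_eq)
    also have "\<dots> = (z x y)\<^sup>2 / 2" using False by (simp add: \<zeta>_def power_divide)
    finally show ?thesis .
  qed (simp add: d_def)
  have d_eq: "of_nat n * ((\<integral>y. iexp (\<zeta> n x y) \<partial>measure_pmf (K x)) - 1) = (\<integral>y. d n x y \<partial>measure_pmf (K x))" for n x
  proof -
    have i1: "integrable (measure_pmf (K x)) (\<lambda>y. iexp (\<zeta> n x y))"
      by (rule measure_pmf.integrable_const_bound[where B=1]) auto
    have i2: "integrable (measure_pmf (K x)) (\<lambda>y. complex_of_real (\<zeta> n x y))"
      unfolding \<zeta>_def using z_int by simp
    have "(\<integral>y. d n x y \<partial>measure_pmf (K x)) =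
       of_nat n * ((\<integral>y. iexp (\<zeta> n x y) \<partial>measure_pmf (K x)) - 1 - \<i> * (\<integral>y. complex_of_real (\<zeta> n x y) \<partial>measure_pmf (K x)))"
      unfolding d_def using i1 i2 by simp
    also have "(\<integral>y. complex_of_real (\<zeta> n x y) \<partial>measure_pmf (K x)) = 0"
      unfolding \<zeta>_def integral_complex_of_real using z0 by simp
    finally show ?thesis by simp
  qed
  obtain C where C: "0 \<le> C" "\<And>x. norm (real x ^ 2 * cvar x) \<le> C * W x"
    using cubicE[OF cubic_sq_cvar] by blast
  have "(\<lambda>n. \<integral>\<omega>. indicator A (hist r \<omega>) * iexp (\<Sum>j\<in>{r..<n}. \<zeta> n (X j \<omega>) (X (Suc j) \<omega>)) \<partial>M)
     \<longlonglongrightarrow> complex_of_real (measure M {\<omega>\<in>space M. hist r \<omega> \<in> A}) *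
       exp (- complex_of_real (t\<^sup>2 / 2) * complex_of_real (\<integral>x. real x ^ 2 * cvar x \<partial>measure_pmf \<pi>))"
  proof (rule exponential_functional_limit[OF solvable_sq_cvar cubic_sq_cvar])
    fix x
    have "(\<lambda>n. \<integral>y. d n x y \<partial>measure_pmf (K x)) \<longlonglongrightarrow> (\<integral>y. complex_of_real (- ((z x y)\<^sup>2 / 2)) \<partial>measure_pmf (K x))"
    proof (rule integral_dominated_convergence[where w="\<lambda>y. (z x y)\<^sup>2 / 2"])
      show "integrable (measure_pmf (K x)) (\<lambda>y. (z x y)\<^sup>2 / 2)" using z2_int by simp
      show "AE y in measure_pmf (K x). (\<lambda>n. d n x y) \<longlonglongrightarrow> complex_of_real (- ((z x y)\<^sup>2 / 2))"
      proof (rule AE_I2)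
        fix y
        \<comment> \<open>The cubic Taylor bound serves fixed \<open>x\<close> and \<open>y\<close>
          only; the quadratic one passes the limit under the integral.\<close>
        have "(\<lambda>n. \<bar>z x y\<bar> ^ 3 / 6 * (1 / sqrt (real n))) \<longlonglongrightarrow> \<bar>z x y\<bar> ^ 3 / 6 * 0"
          by (intro tendsto_intros inverse_sqrt_lim)
        then have lim0: "(\<lambda>n. \<bar>z x y\<bar> ^ 3 / 6 * (1 / sqrt (real n))) \<longlonglongrightarrow> 0" by simp
        have "norm (d n x y - complex_of_real (- ((z x y)\<^sup>2 / 2))) \<le> \<bar>z x y\<bar> ^ 3 / 6 * (1 / sqrt (real n))" if "0 < n" for n
        proof -
          have "(z x y)\<^sup>2 = real n * (\<zeta> n x y)\<^sup>2" using that by (simp add: \<zeta>_def power_divide)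
          then have "complex_of_real ((z x y)\<^sup>2) = of_nat n * complex_of_real ((\<zeta> n x y)\<^sup>2)"
            by (simp only: of_real_mult of_real_of_nat_eq)
          then have eq: "d n x y - complex_of_real (- ((z x y)\<^sup>2 / 2)) =
              of_nat n * (iexp (\<zeta> n x y) - (1 + \<i> * complex_of_real (\<zeta> n x y) - complex_of_real ((\<zeta> n x y)\<^sup>2) / 2))"
            by (simp add: d_def algebra_simps)
          have "norm (iexp (\<zeta> n x y) - (1 + \<i> * complex_of_real (\<zeta> n x y) - complex_of_real ((\<zeta> n x y)\<^sup>2) / 2)) \<le> \<bar>\<zeta> n x y\<bar> ^ 3 / 6"
            using iexp_approx1[of "\<zeta> n x y" 2] by (simp add: eval_nat_numeral power_mult_distrib algebra_simps)
          then have "norm (d n x y - complex_of_real (- ((z x y)\<^sup>2 / 2))) \<le> real n * (\<bar>\<zeta> n x y\<bar> ^ 3 / 6)"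
            unfolding eq norm_mult by (intro mult_mono) auto
          also have "\<dots> = \<bar>z x y\<bar> ^ 3 / 6 * (1 / sqrt (real n))"
          proof -
            have "sqrt (real n) ^ 3 = real n * sqrt (real n)" by (simp add: power3_eq_cube)
            then show ?thesis using that by (simp add: \<zeta>_def power_divide abs_divide)
          qed
          finally show ?thesis .
        qed
        then have "(\<lambda>n. d n x y - complex_of_real (- ((z x y)\<^sup>2 / 2))) \<longlonglongrightarrow> 0"
          by (intro Lim_null_comparison[OF eventually_mono[OF eventually_gt_at_top[of 0]] lim0]) auto
        then show "(\<lambda>n. d n x y) \<longlonglongrightarrow> complex_of_real (- ((z x y)\<^sup>2 / 2))"
          by (rule LIM_zero_cancel)
      qed
    qed (use d_bnd in auto)
    also have "(\<integral>y. complex_of_real (- ((z x y)\<^sup>2 / 2)) \<partial>measure_pmf (K x)) =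
        - complex_of_real (t\<^sup>2 / 2) * complex_of_real (real x ^ 2 * cvar x)"
      unfolding integral_complex_of_real using z2_eq[of x] by simp
    finally show "(\<lambda>n. of_nat n * ((\<integral>y. iexp (\<zeta> n x y) \<partial>measure_pmf (K x)) - 1)) \<longlonglongrightarrow>
        - complex_of_real (t\<^sup>2 / 2) * complex_of_real (real x ^ 2 * cvar x)"
      unfolding d_eq .
  next
    fix n x
    have "norm (\<integral>y. d n x y \<partial>measure_pmf (K x)) \<le> (\<integral>y. norm (d n x y) \<partial>measure_pmf (K x))"
      by (rule integral_norm_bound)
    also have "\<dots> \<le> (\<integral>y. (z x y)\<^sup>2 / 2 \<partial>measure_pmf (K x))"
    proof (rule integral_mono)
      show i: "integrable (measure_pmf (K x)) (\<lambda>y. (z x y)\<^sup>2 / 2)" using z2_int by simp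
      show "integrable (measure_pmf (K x)) (\<lambda>y. norm (d n x y))"
        by (rule Bochner_Integration.integrable_bound[OF i]) (use d_bnd in auto)
    qed (rule d_bnd)
    also have "\<dots> = t\<^sup>2 / 2 * (real x ^ 2 * cvar x)" using z2_eq[of x] by simp
    also have "\<dots> \<le> t\<^sup>2 / 2 * (C * W x)"
      by (rule mult_left_mono) (use C(2)[of x] in auto)
    finally show "norm (of_nat n * ((\<integral>y. iexp (\<zeta> n x y) \<partial>measure_pmf (K x)) - 1)) \<le>
       (t\<^sup>2 / 2 * C) * W x"
      unfolding d_eq by (simp only: mult.assoc)
  next
    fix x y
    have "(\<lambda>n. z x y * (1 / sqrt (real n))) \<longlonglongrightarrow> z x y * 0"
      by (intro tendsto_intros inverse_sqrt_lim)
    then show "(\<lambda>n. \<zeta> n x y) \<longlonglongrightarrow> 0" by (simp add: \<zeta>_def)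
  qed
  then show ?thesis
    unfolding \<zeta>_def z_def asy_var_def by (simp add: sum_divide_distrib[symmetric] sum_distrib_left[symmetric] del: inar_X.simps)
qed

text \<open>With increments of order \<open>1 / n\<close> the first-order term survives:
  \<open>c = - \<i> * t\<close> gives the characteristic function of the constant \<open>m2\<close>,
  and convergence in law to a constant is convergence in probability.\<close>

theorem weak_law_squares:
  assumes "0 < \<epsilon>"
  shows "(\<lambda>n. prob {\<omega>\<in>space M. \<epsilon> < \<bar>(\<Sum>j\<in>{r..<n}. real (X j \<omega>) ^ 2) / n - m2\<bar>}) \<longlonglongrightarrow> 0"
proof (rule char_const_imp_conv_in_prob[OF _ _ assms])
  fix t :: real
  define \<zeta> where "\<zeta> = (\<lambda>n x (y::nat). t * real x ^ 2 / real n)"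
  have "(\<lambda>n. \<integral>\<omega>. indicator UNIV (hist r \<omega>) * iexp (\<Sum>j\<in>{r..<n}. \<zeta> n (X j \<omega>) (X (Suc j) \<omega>)) \<partial>M)
     \<longlonglongrightarrow> complex_of_real (measure M {\<omega>\<in>space M. hist r \<omega> \<in> UNIV}) *
       exp (- (- \<i> * t) * complex_of_real (\<integral>x. real x ^ 2 \<partial>measure_pmf \<pi>))"
  proof (rule exponential_functional_limit[OF solvable_powers(1) cubic_powers(1)])
    show "(\<lambda>n. of_nat n * ((\<integral>y. iexp (\<zeta> n x y) \<partial>measure_pmf (K x)) - 1)) \<longlonglongrightarrow>
       - (- \<i> * complex_of_real t) * complex_of_real (real x ^ 2)" for x
      using scaled_exp_limit[of "\<i> * complex_of_real t * complex_of_real (real x ^ 2)"]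
      by (simp add: \<zeta>_def mult.assoc)
    show "norm (of_nat n * ((\<integral>y. iexp (\<zeta> n x y) \<partial>measure_pmf (K x)) - 1)) \<le> \<bar>t\<bar> * W x" for n x
    proof -
      have "real x ^ 2 \<le> (1 + real x) ^ 3"
        by (rule order_trans[OF power_mono[of "real x" "1 + real x" 2] power_increasing[of 2 3 "1 + real x"]]) auto
      moreover have "norm (of_nat n * (iexp (t * real x ^ 2 / real n) - 1)) \<le> \<bar>t\<bar> * real x ^ 2"
      proof (cases "n = 0")
        case False
        have "real n * norm (iexp (t * real x ^ 2 / real n) - 1) \<le> real n * \<bar>t * real x ^ 2 / real n\<bar>"
          using norm_iexp_diff_le[of "t * real x ^ 2 / real n" 0] by (intro mult_left_mono) simp_all
        then show ?thesis using False by (simp add: norm_mult abs_mult)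
      qed simp
      ultimately show ?thesis
        unfolding \<zeta>_def W_def using mult_left_mono[of "real x ^ 2" "(1 + real x) ^ 3" "\<bar>t\<bar>"] by simp
    qed
    show "(\<lambda>n. \<zeta> n x y) \<longlonglongrightarrow> 0" for x y
      unfolding \<zeta>_def by (rule lim_const_over_n)
  qed
  then have lim: "(\<lambda>n. \<integral>\<omega>. iexp (\<Sum>j\<in>{r..<n}. \<zeta> n (X j \<omega>) (X (Suc j) \<omega>)) \<partial>M) \<longlonglongrightarrow> iexp (t * m2)"
    unfolding m2_def by (simp add: prob_space mult.assoc del: inar_X.simps of_real_sum)
  have eq: "(\<Sum>j\<in>{r..<n}. \<zeta> n (X j \<omega>) (X (Suc j) \<omega>)) = t * ((\<Sum>j\<in>{r..<n}. real (X j \<omega>) ^ 2) / n)" for n \<omega>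
    unfolding \<zeta>_def by (simp add: sum_divide_distrib[symmetric] sum_distrib_left[symmetric])
  show "(\<lambda>n. \<integral>\<omega>. iexp (t * ((\<Sum>j\<in>{r..<n}. real (X j \<omega>) ^ 2) / n)) \<partial>M) \<longlonglongrightarrow> iexp (t * m2)"
    using lim unfolding eq .
qed (simp del: inar_X.simps)

end

section \<open>The conditional least squares estimator\<close>

lemma one_plus_square_neq_0: "1 + (a::real)\<^sup>2 \<noteq> 0"
  by (metis add_pos_nonneg less_numeral_extra(1) order_less_irrefl zero_le_power2)

lemma inverse_one_plus_square_lipschitz:
  fixes a b :: real
  shows "\<bar>1 / (1 + a\<^sup>2) - 1 / (1 + b\<^sup>2)\<bar> \<le> \<bar>a - b\<bar>" and "\<bar>a / (1 + a\<^sup>2) - b / (1 + b\<^sup>2)\<bar> \<le> \<bar>a - b\<bar>"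
proof -
  let ?P = "(1 + a\<^sup>2) * (1 + b\<^sup>2)"
  have pos: "0 < 1 + a\<^sup>2" "0 < 1 + b\<^sup>2" by (auto intro: add_pos_nonneg)
  then have P: "0 < ?P" by simp
  have am: "2 * \<bar>x\<bar> \<le> 1 + x\<^sup>2" for x :: real
    using zero_le_power2[of "\<bar>x\<bar> - 1"] by (simp add: power2_eq_square algebra_simps)
  have ge: "1 + a\<^sup>2 \<le> ?P" "1 + b\<^sup>2 \<le> ?P" by (simp_all add: algebra_simps)
  have "\<bar>a + b\<bar> \<le> \<bar>a\<bar> + \<bar>b\<bar>" by (rule abs_triangle_ineq)
  also have "\<dots> \<le> ?P" using am[of a] am[of b] ge by linarith
  finally have 1: "\<bar>a + b\<bar> \<le> ?P" .
  have "1 / (1 + a\<^sup>2) - 1 / (1 + b\<^sup>2) = (b - a) * ((a + b) / ?P)"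
    using pos by (simp add: field_simps power2_eq_square)
  also have "\<bar>\<dots>\<bar> = \<bar>a - b\<bar> * (\<bar>a + b\<bar> / ?P)"
    using P by (simp add: abs_mult abs_divide abs_minus_commute)
  also have "\<dots> \<le> \<bar>a - b\<bar> * 1" using 1 P by (intro mult_left_mono) auto
  finally show "\<bar>1 / (1 + a\<^sup>2) - 1 / (1 + b\<^sup>2)\<bar> \<le> \<bar>a - b\<bar>" by simp
  have "2 * \<bar>a * b\<bar> \<le> a\<^sup>2 + b\<^sup>2"
    using zero_le_power2[of "\<bar>a\<bar> - \<bar>b\<bar>"] by (simp add: power2_eq_square algebra_simps abs_mult)
  then have 2: "\<bar>1 - a * b\<bar> \<le> ?P" using zero_le_power2[of "a * b"]
    by (simp add: power2_eq_square algebra_simps)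
  have "a / (1 + a\<^sup>2) - b / (1 + b\<^sup>2) = (a - b) * ((1 - a * b) / ?P)"
    using pos by (simp add: field_simps power2_eq_square)
  also have "\<bar>\<dots>\<bar> = \<bar>a - b\<bar> * (\<bar>1 - a * b\<bar> / ?P)"
    using P by (simp add: abs_mult abs_divide)
  also have "\<dots> \<le> \<bar>a - b\<bar> * 1" using 2 P by (intro mult_left_mono) auto
  finally show "\<bar>a / (1 + a\<^sup>2) - b / (1 + b\<^sup>2)\<bar> \<le> \<bar>a - b\<bar>" by simp
qed

text \<open>The derivative of \<open>(\<kappa> - \<nu> * a) / (1 + a\<^sup>2)\<close>, arranged
  through \<open>1 / (1 + a\<^sup>2)\<close> and \<open>a / (1 + a\<^sup>2)\<close>, which are
  bounded by 1 and Lipschitz with constant 1.\<close>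

definition rat_deriv :: "real \<Rightarrow> real \<Rightarrow> real \<Rightarrow> real" where
  "rat_deriv \<kappa> \<nu> a = \<nu> * (1 / (1 + a\<^sup>2) - 2 * (1 / (1 + a\<^sup>2) * (1 / (1 + a\<^sup>2)))) - 2 * \<kappa> * (a / (1 + a\<^sup>2) * (1 / (1 + a\<^sup>2)))"

lemma DERIV_rat: "((\<lambda>a. (\<kappa> - \<nu> * a) / (1 + a\<^sup>2)) has_real_derivative rat_deriv \<kappa> \<nu> a) (at a)"
proof -
  have pos: "1 + a\<^sup>2 \<noteq> 0" by (rule one_plus_square_neq_0)
  define N where "N = 1 + a\<^sup>2"
  have N: "N \<noteq> 0" using pos by (simp add: N_def)
  have "((\<lambda>a. (\<kappa> - \<nu> * a) / (1 + a\<^sup>2)) has_real_derivative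
      ((0 - \<nu>) * (1 + a\<^sup>2) - (\<kappa> - \<nu> * a) * (2 * a)) / ((1 + a\<^sup>2) * (1 + a\<^sup>2))) (at a)"
    by (rule DERIV_divide) (auto intro!: derivative_eq_intros simp: pos)
  also have "(0 - \<nu>) * (1 + a\<^sup>2) - (\<kappa> - \<nu> * a) * (2 * a) = \<nu> * N - 2 * \<nu> - 2 * \<kappa> * a"
    by (simp add: N_def algebra_simps power2_eq_square)
  also have "(\<nu> * N - 2 * \<nu> - 2 * \<kappa> * a) / ((1 + a\<^sup>2) * (1 + a\<^sup>2)) = rat_deriv \<kappa> \<nu> a"
    unfolding rat_deriv_def N_def[symmetric] using N by (simp add: field_simps)
  finally show ?thesis .
qed

lemma abs_prod_diff_le:
  fixes x y x' y' :: real
  assumes "\<bar>x\<bar> \<le> 1" "\<bar>y'\<bar> \<le> 1" "\<bar>x - x'\<bar> \<le> d" "\<bar>y - y'\<bar> \<le> d"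
  shows "\<bar>x * y - x' * y'\<bar> \<le> 2 * d"
proof -
  have "x * y - x' * y' = x * (y - y') + (x - x') * y'" by (simp add: algebra_simps)
  also have "\<bar>\<dots>\<bar> \<le> \<bar>x\<bar> * \<bar>y - y'\<bar> + \<bar>x - x'\<bar> * \<bar>y'\<bar>"
    by (rule order_trans[OF abs_triangle_ineq]) (simp add: abs_mult)
  also have "\<dots> \<le> 1 * d + d * 1" using assms by (intro add_mono mult_mono) auto
  finally show ?thesis by simp
qed

text \<open>Products of the two building blocks have Lipschitz constant 2, whence
  \<open>1 + 2 * 2 = 5\<close> for \<nu> and \<open>2 * 2 = 4\<close> for \<kappa>. The bound on the
  value is relaxed to the same number, so that one constant serves both purposes.\<close>

lemma rat_deriv_bounds:
  shows "\<bar>rat_deriv \<kappa> \<nu> a - rat_deriv \<kappa> \<nu> b\<bar> \<le> (5 * \<bar>\<nu>\<bar> + 4 * \<bar>\<kappa>\<bar>) * \<bar>a - b\<bar>"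
    and "\<bar>rat_deriv \<kappa> \<nu> a\<bar> \<le> 5 * \<bar>\<nu>\<bar> + 4 * \<bar>\<kappa>\<bar>"
proof -
  define f g where "f = (\<lambda>a::real. 1 / (1 + a\<^sup>2))" and "g = (\<lambda>a::real. a / (1 + a\<^sup>2))"
  have f1: "\<bar>f x\<bar> \<le> 1" for x
  proof -
    have "1 / (1 + x\<^sup>2) \<le> 1 / 1" by (rule frac_le) auto
    then show ?thesis by (simp add: f_def)
  qed
  have g1: "\<bar>g x\<bar> \<le> 1" for x
  proof -
    have "\<bar>x\<bar> \<le> 1 + x\<^sup>2" using zero_le_power2[of "\<bar>x\<bar> - 1"] zero_le_power2[of x]
      by (simp add: power2_eq_square algebra_simps)
    then have "\<bar>x\<bar> / (1 + x\<^sup>2) \<le> 1" by (subst divide_le_eq_1_pos) (auto intro: add_pos_nonneg)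
    moreover have "\<bar>1 + x\<^sup>2\<bar> = 1 + x\<^sup>2" by (simp add: add_nonneg_nonneg)
    ultimately show ?thesis unfolding g_def abs_divide by simp
  qed
  have r: "rat_deriv \<kappa> \<nu> x = \<nu> * (f x - 2 * (f x * f x)) - 2 * \<kappa> * (g x * f x)" for x
    unfolding rat_deriv_def f_def g_def ..
  let ?d = "\<bar>a - b\<bar>"
  have fl: "\<bar>f a - f b\<bar> \<le> ?d" and gl: "\<bar>g a - g b\<bar> \<le> ?d"
    unfolding f_def g_def by (rule inverse_one_plus_square_lipschitz)+
  have ff: "\<bar>f a * f a - f b * f b\<bar> \<le> 2 * ?d" by (intro abs_prod_diff_le f1 fl)
  have gf: "\<bar>g a * f a - g b * f b\<bar> \<le> 2 * ?d" by (intro abs_prod_diff_le f1 g1 fl gl)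
  have "rat_deriv \<kappa> \<nu> a - rat_deriv \<kappa> \<nu> b =
      \<nu> * ((f a - f b) - 2 * (f a * f a - f b * f b)) - 2 * \<kappa> * (g a * f a - g b * f b)"
    unfolding r by (simp add: algebra_simps)
  also have "\<bar>\<dots>\<bar> \<le> \<bar>\<nu>\<bar> * \<bar>(f a - f b) - 2 * (f a * f a - f b * f b)\<bar> + 2 * \<bar>\<kappa>\<bar> * \<bar>g a * f a - g b * f b\<bar>"
    by (rule order_trans[OF abs_triangle_ineq4]) (simp add: abs_mult)
  also have "\<dots> \<le> \<bar>\<nu>\<bar> * (5 * ?d) + 2 * \<bar>\<kappa>\<bar> * (2 * ?d)"
  proof (intro add_mono mult_left_mono)
    have "\<bar>u - 2 * v\<bar> \<le> 5 * D" if "\<bar>u\<bar> \<le> D" "\<bar>v\<bar> \<le> 2 * D" for u v D :: real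
      using that by linarith
    from this[OF fl ff] show "\<bar>(f a - f b) - 2 * (f a * f a - f b * f b)\<bar> \<le> 5 * ?d" .
  qed (use gf in auto)
  finally show "\<bar>rat_deriv \<kappa> \<nu> a - rat_deriv \<kappa> \<nu> b\<bar> \<le> (5 * \<bar>\<nu>\<bar> + 4 * \<bar>\<kappa>\<bar>) * ?d"
    by (simp add: algebra_simps)
  have ff1: "\<bar>f a * f a\<bar> \<le> 1" "\<bar>g a * f a\<bar> \<le> 1"
    using mult_mono[OF f1 f1, of a a] mult_mono[OF g1 f1, of a a] by (simp_all add: abs_mult)
  have "\<bar>rat_deriv \<kappa> \<nu> a\<bar> \<le> \<bar>\<nu>\<bar> * \<bar>f a - 2 * (f a * f a)\<bar> + 2 * \<bar>\<kappa>\<bar> * \<bar>g a * f a\<bar>"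
    unfolding r by (rule order_trans[OF abs_triangle_ineq4]) (simp add: abs_mult)
  also have "\<dots> \<le> \<bar>\<nu>\<bar> * 5 + 2 * \<bar>\<kappa>\<bar> * 2"
  proof (intro add_mono mult_left_mono)
    show "\<bar>f a - 2 * (f a * f a)\<bar> \<le> 5" using f1[of a] ff1(1) by linarith
  qed (use ff1 in auto)
  finally show "\<bar>rat_deriv \<kappa> \<nu> a\<bar> \<le> 5 * \<bar>\<nu>\<bar> + 4 * \<bar>\<kappa>\<bar>" by simp
qed

text \<open>The quadratic gives the derivative slope \<open>2 * A\<close>, and the perturbation
  lowers it by at most its Lipschitz constant. So the derivative is strictly increasing, and its
  zero is the strict global minimum.\<close>

lemma perturbed_quadratic_min:
  fixes A B \<kappa> \<nu> :: real
  defines "G \<equiv> \<lambda>a. A * a\<^sup>2 - 2 * B * a + (\<kappa> - \<nu> * a) / (1 + a\<^sup>2)"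
  assumes A: "5 * \<bar>\<nu>\<bar> + 4 * \<bar>\<kappa>\<bar> < A"
  obtains a where "2 * A * a - 2 * B + rat_deriv \<kappa> \<nu> a = 0" "\<And>b. b \<noteq> a \<Longrightarrow> G a < G b"
proof -
  let ?L = "5 * \<bar>\<nu>\<bar> + 4 * \<bar>\<kappa>\<bar>"
  define G' where "G' = (\<lambda>a. 2 * A * a - 2 * B + rat_deriv \<kappa> \<nu> a)"
  have A0: "0 < A" using A by (smt (verit) abs_ge_zero)
  have D: "(G has_real_derivative G' a) (at a)" for a
    unfolding G_def G'_def by (rule derivative_eq_intros DERIV_rat refl | simp)+
  have incr: "(2 * A - ?L) * (y - x) \<le> G' y - G' x" if "x \<le> y" for x y
    using rat_deriv_bounds(1)[of \<kappa> \<nu> y x] that unfolding G'_def by (simp add: algebra_simps abs_le_iff)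
  have incr': "G' x < G' y" if "x < y" for x y
  proof -
    have "0 < (2 * A - ?L) * (y - x)" using that A A0 by (intro mult_pos_pos) auto
    then show ?thesis using incr[of x y] that by simp
  qed
  \<comment> \<open>At distance \<open>R\<close> the linear part outweighs
    \<open>2 * \<bar>B\<bar>\<close> and the bounded perturbation, so the derivative changes
    sign.\<close>
  define R where "R = (2 * \<bar>B\<bar> + ?L + 1) / (2 * A)"
  have R: "2 * A * R = 2 * \<bar>B\<bar> + ?L + 1" "0 \<le> R" using A0 by (auto simp: R_def)
  have cont: "isCont G' x" for x
  proof -
    have "1 + x\<^sup>2 \<noteq> 0" by (rule one_plus_square_neq_0)
    then show ?thesis unfolding G'_def rat_deriv_def by (intro continuous_intros) auto
  qed
  have "G' (- R) \<le> 0" "0 \<le> G' R"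
    using rat_deriv_bounds(2)[of \<kappa> \<nu> R] rat_deriv_bounds(2)[of \<kappa> \<nu> "- R"] R
    unfolding G'_def mult_minus_right by linarith+
  then obtain a where a: "G' a = 0"
    using IVT[of G' "- R" 0 R] R cont by auto
  have "G a < G b" if "b \<noteq> a" for b
  proof (cases "a < b")
    case True
    then obtain z where z: "a < z" "z < b" "G b - G a = (b - a) * G' z"
      using MVT2[of a b G G'] D by blast
    have "0 < (b - a) * G' z" using incr'[of a z] z True a by (intro mult_pos_pos) auto
    then show ?thesis using z by simp
  next
    case False
    then have "b < a" using that by simp
    then obtain z where z: "b < z" "z < a" "G a - G b = (a - b) * G' z"
      using MVT2[of b a G G'] D by blast
    have "(a - b) * G' z < 0" using incr'[of z a] z \<open>b < a\<close> a by (intro mult_pos_neg) auto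
    then show ?thesis using z by simp
  qed
  with a show ?thesis using that unfolding G'_def by blast
qed

section \<open>The profile criterion and the expansion of its minimiser\<close>

definition outlier_shift :: "real \<Rightarrow> real \<Rightarrow> real \<Rightarrow> real" where
  "outlier_shift \<mu> c a = - (a / (1 + a\<^sup>2) * c) - (1 - a) / (1 + a\<^sup>2) * \<mu>"

text \<open>Minimising over the outlier size first completes a square; the remaining function of \<open>a\<close> is a
  quadratic plus \<open>(\<kappa> - \<nu> a) / (1 + a\<^sup>2)\<close>, whose derivative is globally Lipschitz.\<close>

lemma inar_Q_profile:
  fixes y :: "nat \<Rightarrow> real" and \<mu> :: real and n s :: nat
  assumes s: "1 \<le> s"
  defines "d \<equiv> y (s + 1) - \<mu> + y (s - 1)"
  defines "\<kappa> \<equiv> d\<^sup>2 - \<mu>\<^sup>2" and "\<nu> \<equiv> 2 * d * \<mu>"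
  defines "A \<equiv> (\<Sum>k\<in>{1..n} - {s, s + 1}. (y (k - 1))\<^sup>2)"
  defines "B \<equiv> (\<Sum>k\<in>{1..n} - {s, s + 1}. y (k - 1) * (y k - \<mu>))"
  obtains C where "\<And>a t. inar_Q n s \<mu> y a t =
     ((A + (y (s - 1))\<^sup>2) * a\<^sup>2 - 2 * (B - y (s - 1) * \<mu>) * a + (\<kappa> - \<nu> * a) / (1 + a\<^sup>2)) + C
       + (1 + a\<^sup>2) * (t - (y s + outlier_shift \<mu> (y (s - 1) + y (s + 1)) a))\<^sup>2"
proof -
  define C0 where "C0 = (\<Sum>k\<in>{1..n} - {s, s + 1}. (y k - \<mu>)\<^sup>2)"
  define p q z where "p = y (s - 1)" and "q = y (s + 1)" and "z = y s"
  have sum: "(\<Sum>k\<in>{1..n} - {s, s + 1}. (y k - a * y (k - 1) - \<mu>)\<^sup>2) = C0 - 2 * B * a + A * a\<^sup>2" for a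
  proof -
    have "(\<Sum>k\<in>{1..n} - {s, s + 1}. (y k - a * y (k - 1) - \<mu>)\<^sup>2) =
      (\<Sum>k\<in>{1..n} - {s, s + 1}. (y k - \<mu>)\<^sup>2 - 2 * a * (y (k - 1) * (y k - \<mu>)) + a\<^sup>2 * (y (k - 1))\<^sup>2)"
      by (intro sum.cong refl) (simp add: power2_eq_square algebra_simps)
    then show ?thesis
      unfolding A_def B_def C0_def by (simp add: sum.distrib sum_subtractf sum_distrib_left ac_simps)
  qed
  have pos: "1 + a\<^sup>2 \<noteq> 0" for a :: real
    by (rule one_plus_square_neq_0)
  have pair: "(z - a * p - \<mu> - t)\<^sup>2 + (q - a * z - \<mu> + a * t)\<^sup>2 =
      p\<^sup>2 * a\<^sup>2 + 2 * p * \<mu> * a + (\<kappa> - \<nu> * a) / (1 + a\<^sup>2) + (p\<^sup>2 - 2 * p * d + \<mu>\<^sup>2)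
       + (1 + a\<^sup>2) * (t - (z + outlier_shift \<mu> (p + q) a))\<^sup>2" for a t
  proof -
    define N where "N = 1 + a\<^sup>2"
    have N: "N \<noteq> 0" "a\<^sup>2 = N - 1" using pos by (auto simp: N_def)
    define x where "x = t - z"
    \<comment> \<open>The minimising value of \<open>x\<close> is \<open>- e / N\<close>; this is
      where \<open>outlier_shift\<close> comes from.\<close>
    define e where "e = a * (p + q) + (1 - a) * \<mu>"
    have sh: "t - (z + outlier_shift \<mu> (p + q) a) = x + e / N"
      using N unfolding outlier_shift_def e_def x_def N_def[symmetric] by (simp add: field_simps)
    have "(1 + a\<^sup>2) * (t - (z + outlier_shift \<mu> (p + q) a))\<^sup>2 = N * x\<^sup>2 + 2 * x * e + e\<^sup>2 / N"
      unfolding sh N_def[symmetric] using N(1) by (simp add: power2_eq_square field_simps)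
    moreover have "(z - a * p - \<mu> - t)\<^sup>2 + (q - a * z - \<mu> + a * t)\<^sup>2 =
       (a * p + \<mu> + x)\<^sup>2 + (q - \<mu> + a * x)\<^sup>2"
      unfolding x_def by (simp add: power2_eq_square algebra_simps)
    moreover have "\<dots> = N * x\<^sup>2 + 2 * x * e + (a * p + \<mu>)\<^sup>2 + (q - \<mu>)\<^sup>2"
      unfolding N_def e_def by (simp add: power2_eq_square algebra_simps)
    \<comment> \<open>By Lagrange's identity the part left after completing the square in
      \<open>x\<close> is \<open>(p * N - d + a * \<mu>)\<^sup>2 / N\<close>. Polynomial division of
      the numerator by \<open>N\<close> leaves the remainder \<open>\<kappa> - \<nu> * a\<close>,
      which explains these two constants.\<close>
    moreover have "(a * p + \<mu>)\<^sup>2 + (q - \<mu>)\<^sup>2 =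
       p\<^sup>2 * a\<^sup>2 + 2 * p * \<mu> * a + (\<kappa> - \<nu> * a) / N + (p\<^sup>2 - 2 * p * d + \<mu>\<^sup>2) + e\<^sup>2 / N"
    proof -
      have "N * ((a * p + \<mu>)\<^sup>2 + (q - \<mu>)\<^sup>2) =
         N * (p\<^sup>2 * a\<^sup>2 + 2 * p * \<mu> * a + (p\<^sup>2 - 2 * p * d + \<mu>\<^sup>2)) + (\<kappa> - \<nu> * a) + e\<^sup>2"
        unfolding N_def e_def \<kappa>_def \<nu>_def d_def p_def[symmetric] q_def[symmetric]
        by (simp add: power2_eq_square algebra_simps)
      then show ?thesis using N(1) by (simp add: field_simps)
    qed
    ultimately show ?thesis unfolding N_def[symmetric] by linarith
  qed
  have "inar_Q n s \<mu> y a t =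
     ((A + (y (s - 1))\<^sup>2) * a\<^sup>2 - 2 * (B - y (s - 1) * \<mu>) * a + (\<kappa> - \<nu> * a) / (1 + a\<^sup>2))
       + (C0 + (p\<^sup>2 - 2 * p * d + \<mu>\<^sup>2))
       + (1 + a\<^sup>2) * (t - (y s + outlier_shift \<mu> (y (s - 1) + y (s + 1)) a))\<^sup>2" for a t
    using pair[of a t] sum[of a] unfolding inar_Q_def p_def q_def z_def by (simp add: algebra_simps)
  then show ?thesis using that by blast
qed

text \<open>A strict minimum settles existence and uniqueness together, so the default branch of
  \<open>inar_est\<close> is not taken.\<close>

lemma inar_est_unique_min:
  assumes "\<And>a t. (a, t) \<noteq> (a0, t0) \<Longrightarrow> inar_Q n s \<mu> y a0 t0 < inar_Q n s \<mu> y a t"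
  shows "inar_est n s \<mu> y = (a0, t0)"
proof -
  let ?m = "\<lambda>p. \<forall>q. inar_Q n s \<mu> y (fst p) (snd p) \<le> inar_Q n s \<mu> y (fst q) (snd q)"
  have m: "?m (a0, t0)"
  proof
    fix q :: "real \<times> real"
    show "inar_Q n s \<mu> y (fst (a0, t0)) (snd (a0, t0)) \<le> inar_Q n s \<mu> y (fst q) (snd q)"
      using assms[of "fst q" "snd q"] by (cases "q = (a0, t0)") (auto intro: less_imp_le)
  qed
  have u: "p = (a0, t0)" if "?m p" for p
  proof (rule ccontr)
    assume "p \<noteq> (a0, t0)"
    then have "inar_Q n s \<mu> y a0 t0 < inar_Q n s \<mu> y (fst p) (snd p)" using assms[of "fst p" "snd p"] by simp
    moreover have "inar_Q n s \<mu> y (fst p) (snd p) \<le> inar_Q n s \<mu> y a0 t0" using spec[OF that, of "(a0, t0)"] by simp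
    ultimately show False by simp
  qed
  have "\<exists>!p. ?m p" using m u by blast
  moreover have "(THE p. ?m p) = (a0, t0)" using m u by (intro the_equality) blast+
  ultimately show ?thesis unfolding inar_est_def by simp
qed

text \<open>The remainder bound depends on \<open>y 0, \<dots>, y (s + 1)\<close> only, hence stays bounded in probability as
  \<open>n\<close> grows.\<close>

definition remainder_const :: "real \<Rightarrow> real \<Rightarrow> nat \<Rightarrow> (nat \<Rightarrow> real) \<Rightarrow> real" where
  "remainder_const \<alpha> \<mu> s y =
     (let p = y (s - 1); d = y (s + 1) - \<mu> + p
      in 5 * \<bar>2 * d * \<mu>\<bar> + 4 * \<bar>d\<^sup>2 - \<mu>\<^sup>2\<bar> + p\<^sup>2 + \<bar>p * \<mu>\<bar>
         + (\<Sum>k\<in>{1..<s}. (y (k - 1))\<^sup>2) * (1 + \<bar>\<alpha>\<bar>) + \<bar>\<Sum>k\<in>{1..<s}. y (k - 1) * (y k - \<alpha> * y (k - 1) - \<mu>)\<bar>)"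

text \<open>The estimating equation is linear in \<open>a\<close> up to \<open>rat_deriv\<close> and
  terms built from the observations up to \<open>s + 1\<close>. Moved to one side, these are at most
  a fixed multiple of \<open>1 + \<bar>a\<bar>\<close>, without any prior control of
  \<open>a\<close>.\<close>

lemma inar_est_expansion:
  fixes y :: "nat \<Rightarrow> real" and \<alpha> \<mu> :: real
  assumes s: "1 \<le> s" "s + 1 \<le> n"
  defines "D \<equiv> remainder_const \<alpha> \<mu> s y"
  defines "S2 \<equiv> (\<Sum>j\<in>{s + 1..<n}. (y j)\<^sup>2)"
  defines "S \<equiv> (\<Sum>j\<in>{s + 1..<n}. y j * (y (Suc j) - \<alpha> * y j - \<mu>))"
  assumes big: "D < S2"
  obtains a where "inar_est n s \<mu> y = (a, y s + outlier_shift \<mu> (y (s - 1) + y (s + 1)) a)"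
    "\<bar>S2 * (a - \<alpha>) - S\<bar> \<le> D * (1 + \<bar>a\<bar>)"
proof -
  define p where "p = y (s - 1)"
  define d where "d = y (s + 1) - \<mu> + y (s - 1)"
  define \<kappa> where "\<kappa> = d\<^sup>2 - \<mu>\<^sup>2"
  define \<nu> where "\<nu> = 2 * d * \<mu>"
  let ?L = "5 * \<bar>\<nu>\<bar> + 4 * \<bar>\<kappa>\<bar>"
  define A where "A = (\<Sum>k\<in>{1..n} - {s, s + 1}. (y (k - 1))\<^sup>2)"
  define B where "B = (\<Sum>k\<in>{1..n} - {s, s + 1}. y (k - 1) * (y k - \<mu>))"
  define A1 where "A1 = (\<Sum>k\<in>{1..<s}. (y (k - 1))\<^sup>2)"
  define S1 where "S1 = (\<Sum>k\<in>{1..<s}. y (k - 1) * (y k - \<alpha> * y (k - 1) - \<mu>))"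
  \<comment> \<open>Residuals with \<open>k \<ge> s + 2\<close> are reindexed by their regressor
    \<open>j = k - 1\<close>, so the sum starts at \<open>s + 1\<close>, the first regressor after
    the outlier.\<close>
  have split: "(\<Sum>k\<in>{1..n} - {s, s + 1}. f k) = (\<Sum>k\<in>{1..<s}. f k) + (\<Sum>j\<in>{s + 1..<n}. f (Suc j))" for f :: "nat \<Rightarrow> real"
  proof -
    have "{1..n} - {s, s + 1} = {1..<s} \<union> {Suc (s + 1)..<Suc n}" using s by auto
    then have "(\<Sum>k\<in>{1..n} - {s, s + 1}. f k) = (\<Sum>k\<in>{1..<s}. f k) + (\<Sum>k\<in>{Suc (s + 1)..<Suc n}. f k)"
      by (simp add: sum.union_disjoint)
    then show ?thesis by (simp only: sum.shift_bounds_Suc_ivl)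
  qed
  have A: "A = A1 + S2" unfolding A_def A1_def S2_def split by simp
  have BS: "B - \<alpha> * A = S1 + S"
  proof -
    have "B - \<alpha> * A = (\<Sum>k\<in>{1..n} - {s, s + 1}. y (k - 1) * (y k - \<alpha> * y (k - 1) - \<mu>))"
      unfolding A_def B_def sum_distrib_left sum_subtractf[symmetric]
      by (intro sum.cong refl) (simp add: power2_eq_square algebra_simps)
    then show ?thesis unfolding split S1_def S_def by simp
  qed
  have A1: "0 \<le> A1" unfolding A1_def by (intro sum_nonneg) auto
  have D: "D = ?L + p\<^sup>2 + \<bar>p * \<mu>\<bar> + A1 * (1 + \<bar>\<alpha>\<bar>) + \<bar>S1\<bar>"
    unfolding D_def remainder_const_def Let_def p_def d_def \<kappa>_def \<nu>_def A1_def S1_def ..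
  have "0 \<le> A1 * (1 + \<bar>\<alpha>\<bar>)" using A1 by simp
  \<comment> \<open>\<open>D\<close> contains the Lipschitz constant of the perturbation's
    derivative, so \<open>D < S2\<close> makes the profile strictly convex.\<close>
  then have "?L < A + p\<^sup>2" using big A1 zero_le_power2[of p] unfolding D A by linarith
  then obtain a where a: "2 * (A + p\<^sup>2) * a - 2 * (B - p * \<mu>) + rat_deriv \<kappa> \<nu> a = 0"
    and min: "\<And>b. b \<noteq> a \<Longrightarrow> (A + p\<^sup>2) * a\<^sup>2 - 2 * (B - p * \<mu>) * a + (\<kappa> - \<nu> * a) / (1 + a\<^sup>2)
       < (A + p\<^sup>2) * b\<^sup>2 - 2 * (B - p * \<mu>) * b + (\<kappa> - \<nu> * b) / (1 + b\<^sup>2)"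
    by (rule perturbed_quadratic_min[where A="A + p\<^sup>2" and B="B - p * \<mu>" and \<kappa>=\<kappa> and \<nu>=\<nu>]) blast
  define \<tau> where "\<tau> = (\<lambda>a. y s + outlier_shift \<mu> (y (s - 1) + y (s + 1)) a)"
  obtain C where Q: "\<And>a t. inar_Q n s \<mu> y a t =
     ((A + p\<^sup>2) * a\<^sup>2 - 2 * (B - p * \<mu>) * a + (\<kappa> - \<nu> * a) / (1 + a\<^sup>2)) + C + (1 + a\<^sup>2) * (t - \<tau> a)\<^sup>2"
    by (rule inar_Q_profile[where n=n and s=s and \<mu>=\<mu> and y=y, OF s(1)])
      (auto simp: A_def B_def \<kappa>_def \<nu>_def d_def p_def \<tau>_def)
  have "inar_est n s \<mu> y = (a, \<tau> a)"
  proof (rule inar_est_unique_min)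
    fix b t assume ne: "(b, t) \<noteq> (a, \<tau> a)"
    have sq: "0 \<le> (1 + b\<^sup>2) * (t - \<tau> b)\<^sup>2" by simp
    show "inar_Q n s \<mu> y a (\<tau> a) < inar_Q n s \<mu> y b t"
    proof (cases "b = a")
      case True
      then have "0 < (1 + b\<^sup>2) * (t - \<tau> b)\<^sup>2" using ne by (intro mult_pos_pos) (auto intro: add_pos_nonneg)
      then show ?thesis unfolding Q using True by simp
    next
      case False
      then show ?thesis using min[OF False] sq unfolding Q diff_self power2_eq_square[of 0] mult_zero_right by linarith
    qed
  qed
  moreover have "\<bar>S2 * (a - \<alpha>) - S\<bar> \<le> D * (1 + \<bar>a\<bar>)"
  proof -
    define R where "R = rat_deriv \<kappa> \<nu> a"
    have R: "\<bar>R\<bar> \<le> ?L" unfolding R_def by (rule rat_deriv_bounds)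
    have BB: "B = \<alpha> * A + S1 + S" using BS by simp
    have "S2 * (a - \<alpha>) - S = - (p\<^sup>2 * a) - p * \<mu> - R / 2 - A1 * (a - \<alpha>) + S1"
      using a unfolding R_def[symmetric] BB A by (simp add: algebra_simps)
    also have "\<bar>\<dots>\<bar> \<le> p\<^sup>2 * \<bar>a\<bar> + \<bar>p * \<mu>\<bar> + \<bar>R / 2\<bar> + A1 * \<bar>a - \<alpha>\<bar> + \<bar>S1\<bar>"
    proof -
      have "\<bar>- x1 - x2 - x3 - x4 + x5\<bar> \<le> \<bar>x1\<bar> + \<bar>x2\<bar> + \<bar>x3\<bar> + \<bar>x4\<bar> + \<bar>x5\<bar>" for x1 x2 x3 x4 x5 :: real
        by linarith
      moreover have "\<bar>p\<^sup>2 * a\<bar> = p\<^sup>2 * \<bar>a\<bar>" "\<bar>A1 * (a - \<alpha>)\<bar> = A1 * \<bar>a - \<alpha>\<bar>"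
        using A1 by (simp_all add: abs_mult)
      ultimately show ?thesis by metis
    qed
    also have "\<dots> \<le> D * (1 + \<bar>a\<bar>)"
    proof -
      have "A1 * \<bar>a - \<alpha>\<bar> \<le> A1 * ((1 + \<bar>\<alpha>\<bar>) * (1 + \<bar>a\<bar>))"
      proof (rule mult_left_mono[OF _ A1])
        have "\<bar>a - \<alpha>\<bar> \<le> \<bar>a\<bar> + \<bar>\<alpha>\<bar>" by simp
        also have "\<dots> \<le> (1 + \<bar>\<alpha>\<bar>) * (1 + \<bar>a\<bar>)" by (simp add: algebra_simps)
        finally show "\<bar>a - \<alpha>\<bar> \<le> (1 + \<bar>\<alpha>\<bar>) * (1 + \<bar>a\<bar>)" .
      qed
      moreover have "\<bar>R / 2\<bar> \<le> ?L * (1 + \<bar>a\<bar>)"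
      proof -
        have "\<bar>R / 2\<bar> \<le> \<bar>R\<bar>" by simp
        also have "\<dots> \<le> ?L * (1 + \<bar>a\<bar>)"
        proof -
          have "0 \<le> ?L * \<bar>a\<bar>" by (intro mult_nonneg_nonneg) auto
          then show ?thesis using R unfolding distrib_left mult_1_right by linarith
        qed
        finally show ?thesis .
      qed
      moreover have "\<bar>p * \<mu>\<bar> \<le> \<bar>p * \<mu>\<bar> * (1 + \<bar>a\<bar>)" "\<bar>S1\<bar> \<le> \<bar>S1\<bar> * (1 + \<bar>a\<bar>)" "p\<^sup>2 * \<bar>a\<bar> \<le> p\<^sup>2 * (1 + \<bar>a\<bar>)"
        by (simp_all add: distrib_left mult_left_mono)
      moreover have "D * (1 + \<bar>a\<bar>) = ?L * (1 + \<bar>a\<bar>) + p\<^sup>2 * (1 + \<bar>a\<bar>) + \<bar>p * \<mu>\<bar> * (1 + \<bar>a\<bar>)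
          + A1 * ((1 + \<bar>\<alpha>\<bar>) * (1 + \<bar>a\<bar>)) + \<bar>S1\<bar> * (1 + \<bar>a\<bar>)"
        unfolding D by (simp add: algebra_simps)
      ultimately show ?thesis by linarith
    qed
    finally show ?thesis .
  qed
  ultimately show ?thesis using that unfolding \<tau>_def by blast
qed

text \<open>As a function of \<open>a\<close> the shift has the shape of the perturbation, with
  \<open>- \<mu>\<close> for \<kappa> and \<open>c - \<mu>\<close> for \<nu>, so
  \<open>rat_deriv\<close> applies again. The value at \<alpha> is the delta-method factor in the
  limiting variance.\<close>

lemma DERIV_outlier_shift:
  "(outlier_shift \<mu> c has_real_derivative
     ((a\<^sup>2 - 1) * c + (1 + 2 * a - a\<^sup>2) * \<mu>) / (1 + a\<^sup>2)\<^sup>2) (at a)"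
proof -
  have pos: "1 + x\<^sup>2 \<noteq> 0" for x :: real
    by (rule one_plus_square_neq_0)
  have "outlier_shift \<mu> c = (\<lambda>a. (- \<mu> - (c - \<mu>) * a) / (1 + a\<^sup>2))"
    unfolding outlier_shift_def[abs_def]
    by (intro ext, simp only: times_divide_eq_left minus_divide_left diff_divide_distrib[symmetric])
      (simp add: algebra_simps)
  moreover have "rat_deriv (- \<mu>) (c - \<mu>) a = ((a\<^sup>2 - 1) * c + (1 + 2 * a - a\<^sup>2) * \<mu>) / (1 + a\<^sup>2)\<^sup>2"
  proof -
    define N where "N = 1 + a\<^sup>2"
    have N: "N \<noteq> 0" using pos by (simp add: N_def)
    have "rat_deriv (- \<mu>) (c - \<mu>) a = ((c - \<mu>) * (N - 2) + 2 * \<mu> * a) / N\<^sup>2"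
      unfolding rat_deriv_def N_def[symmetric] using N by (simp add: field_simps power2_eq_square)
    also have "(c - \<mu>) * (N - 2) + 2 * \<mu> * a = (a\<^sup>2 - 1) * c + (1 + 2 * a - a\<^sup>2) * \<mu>"
      by (simp add: N_def algebra_simps)
    finally show ?thesis by (simp add: N_def)
  qed
  ultimately show ?thesis using DERIV_rat[of "- \<mu>" "c - \<mu>" a] by simp
qed

text \<open>The bound is \<open>max n (s + 1)\<close> because \<open>inar_Q\<close> reads
  \<open>y (s + 1)\<close> also for small \<open>n\<close>.\<close>

lemma inar_est_cong:
  assumes "\<And>k. k \<le> max n (s + 1) \<Longrightarrow> y k = y' k"
  shows "inar_est n s \<mu> y = inar_est n s \<mu> y'"
proof -
  have "inar_Q n s \<mu> y a t = inar_Q n s \<mu> y' a t" for a t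
    unfolding inar_Q_def using assms by (intro arg_cong2[where f="(+)"] sum.cong) auto
  then show ?thesis unfolding inar_est_def by simp
qed

text \<open>A deterministic Slutsky argument, so that probability enters later only through the
  events that the sum of squares, the score and the remainder are under control.\<close>

lemma normalized_error_bound:
  fixes m \<alpha> C1 C2 \<epsilon> :: real
  assumes m: "0 < m" and C: "0 \<le> C1" "0 \<le> C2" and \<epsilon>: "0 < \<epsilon>"
  obtains \<delta> n0 where "0 < \<delta>"
    "\<And>n S2 S D a. \<lbrakk>n0 \<le> n; \<bar>S2 / real n - m\<bar> \<le> \<delta>; \<bar>S / sqrt (real n)\<bar> \<le> C1; 0 \<le> D; D \<le> C2;
       \<bar>S2 * (a - \<alpha>) - S\<bar> \<le> D * (1 + \<bar>a\<bar>)\<rbrakk> \<Longrightarrow>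
       \<bar>sqrt (real n) * (a - \<alpha>) - S / sqrt (real n) / m\<bar> \<le> \<epsilon> \<and>
       \<bar>sqrt (real n) * (a - \<alpha>)\<bar> \<le> 4 * C1 / m + 1 + \<bar>\<alpha>\<bar>"
    "\<And>n S2. n0 \<le> n \<Longrightarrow> \<bar>S2 / real n - m\<bar> \<le> \<delta> \<Longrightarrow> C2 < S2"
proof -
  \<comment> \<open>The first entry keeps \<open>S2 / real n\<close> above \<open>m / 2\<close>; the
    second limits the cost of replacing this average by \<open>m\<close> to half of
    \<epsilon>.\<close>
  define \<delta> where "\<delta> = min (m / 2) (\<epsilon> * m\<^sup>2 / (4 * (C1 + 1)))"
  have \<delta>: "0 < \<delta>" "\<delta> \<le> m / 2" "\<delta> \<le> \<epsilon> * m\<^sup>2 / (4 * (C1 + 1))" unfolding \<delta>_def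
    by (use m C \<epsilon> in simp, rule min.cobounded1, rule min.cobounded2)
  \<comment> \<open>Equals \<open>1 + \<bar>\<alpha>\<bar>\<close> plus the bound on the normalised
    error \<open>T\<close> obtained below.\<close>
  define E where "E = 2 * (1 + \<bar>\<alpha>\<bar>) + 4 * C1 / m"
  have E: "0 < E" using m C by (auto simp: E_def intro!: add_pos_nonneg)
  define \<eta> where "\<eta> = (\<lambda>n. 2 * C2 / m * (1 / sqrt (real n)))"
  have "(\<lambda>n. sqrt (1 / real n)) \<longlonglongrightarrow> sqrt 0" by (intro tendsto_real_sqrt lim_1_over_n)
  then have "(\<lambda>n. 2 * C2 / m * (1 / sqrt (real n))) \<longlonglongrightarrow> 2 * C2 / m * 0"
    by (intro tendsto_mult tendsto_const) (simp add: real_sqrt_divide)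
  then have "\<eta> \<longlonglongrightarrow> 0" by (simp add: \<eta>_def)
  then have "eventually (\<lambda>n. \<eta> n < min (1 / 2) (\<epsilon> / (2 * E))) sequentially"
    using E \<epsilon> by (intro order_tendstoD) auto
  then obtain n1 where n1: "\<And>n. n1 \<le> n \<Longrightarrow> \<eta> n < min (1 / 2) (\<epsilon> / (2 * E))"
    unfolding eventually_sequentially by blast
  obtain n2 :: nat where n2: "2 * C2 / m < real n2" using reals_Archimedean2 by blast
  define n0 where "n0 = max (max n1 n2) 1"
  have low: "m / 2 \<le> S2 / real n" if "\<bar>S2 / real n - m\<bar> \<le> \<delta>" for S2 n using that \<delta>(2) by linarith
  show ?thesis
  proof (rule that[of \<delta> n0, OF \<delta>(1)])
    fix n :: nat and S2 :: real
    assume n: "n0 \<le> n" and S2: "\<bar>S2 / real n - m\<bar> \<le> \<delta>"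
    have "real n2 \<le> real n" "0 < real n" using n by (auto simp: n0_def)
    moreover have "C2 < m / 2 * real n2" using n2 m by (simp add: field_simps)
    ultimately have "C2 < m / 2 * real n" using m by (smt (verit) mult_left_mono divide_nonneg_nonneg)
    also have "\<dots> \<le> S2 / real n * real n" using low[OF S2] by (intro mult_right_mono) auto
    finally show "C2 < S2" using \<open>0 < real n\<close> by simp
  next
    fix n :: nat and S2 S D a :: real
    assume n: "n0 \<le> n" and S2: "\<bar>S2 / real n - m\<bar> \<le> \<delta>" and S: "\<bar>S / sqrt (real n)\<bar> \<le> C1"
      and D: "0 \<le> D" "D \<le> C2" and err: "\<bar>S2 * (a - \<alpha>) - S\<bar> \<le> D * (1 + \<bar>a\<bar>)"
    define r where "r = sqrt (real n)"
    have r: "1 \<le> r" "r * r = real n" using n by (auto simp: r_def n0_def)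
    define T where "T = r * (a - \<alpha>)"
    define z where "z = S / r"
    define h where "h = S2 / real n"
    have h: "m / 2 \<le> h" "\<bar>h - m\<bar> \<le> \<delta>" using low[OF S2] S2 by (auto simp: h_def)
    have h0: "0 < h" using h m by linarith
    have \<eta>: "\<eta> n \<le> 1 / 2" "\<eta> n \<le> \<epsilon> / (2 * E)" "0 \<le> \<eta> n"
      using n1[of n] n m C by (auto simp: n0_def \<eta>_def)
    have "T - z / h = (S2 * (a - \<alpha>) - S) / (r * h)"
    proof -
      have "S2 = h * (r * r)" using r n by (simp add: h_def n0_def)
      then show ?thesis using h0 r(1) by (simp add: T_def z_def field_simps)
    qed
    then have "\<bar>T - z / h\<bar> = \<bar>S2 * (a - \<alpha>) - S\<bar> / (r * h)" using r h0 by (simp add: abs_divide abs_mult)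
    also have "\<dots> \<le> C2 * (1 + \<bar>\<alpha>\<bar> + \<bar>T\<bar>) / (r * (m / 2))"
    proof (rule frac_le)
      show "\<bar>S2 * (a - \<alpha>) - S\<bar> \<le> C2 * (1 + \<bar>\<alpha>\<bar> + \<bar>T\<bar>)"
      proof -
        have "\<bar>a - \<alpha>\<bar> \<le> \<bar>T\<bar>" using r(1) mult_right_mono[of 1 r "\<bar>a - \<alpha>\<bar>"] by (simp add: T_def abs_mult)
        then have "D * (1 + \<bar>a\<bar>) \<le> C2 * (1 + \<bar>\<alpha>\<bar> + \<bar>T\<bar>)" using D by (intro mult_mono) auto
        then show ?thesis using err by linarith
      qed
      show "0 \<le> C2 * (1 + \<bar>\<alpha>\<bar> + \<bar>T\<bar>)" using C by simp
      show "0 < r * (m / 2)" using r m by simp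
      show "r * (m / 2) \<le> r * h" using r h by (intro mult_left_mono) auto
    qed
    also have "\<dots> = \<eta> n * (1 + \<bar>\<alpha>\<bar> + \<bar>T\<bar>)" using r m by (simp add: \<eta>_def r_def field_simps)
    finally have T1: "\<bar>T - z / h\<bar> \<le> \<eta> n * (1 + \<bar>\<alpha>\<bar> + \<bar>T\<bar>)" .
    have z: "\<bar>z\<bar> \<le> C1" using S by (simp add: z_def r_def)
    have zh: "\<bar>z / h\<bar> \<le> 2 * C1 / m"
    proof -
      have "\<bar>z / h\<bar> = \<bar>z\<bar> / h" using h0 by simp
      also have "\<dots> \<le> C1 / (m / 2)" using z h m C by (intro frac_le) auto
      finally show ?thesis by (simp add: mult.commute)
    qed
    have half: "\<eta> n * (1 + \<bar>\<alpha>\<bar> + \<bar>T\<bar>) \<le> 1 / 2 * (1 + \<bar>\<alpha>\<bar> + \<bar>T\<bar>)" using \<eta> by (intro mult_right_mono) auto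
    \<comment> \<open>The remainder involves \<open>\<bar>T\<bar>\<close> itself; its coefficient is
      at most one half, so it can be absorbed into the left side.\<close>
    have TB: "\<bar>T\<bar> \<le> 4 * C1 / m + 1 + \<bar>\<alpha>\<bar>"
    proof -
      have lin: "x \<le> 2 * q + 1 + A" if "x \<le> e + q" "e \<le> 1 / 2 * (1 + A + x)" for x q e A :: real
        using that by (simp add: field_simps)
      have "\<bar>T\<bar> \<le> \<bar>T - z / h\<bar> + \<bar>z / h\<bar>" using abs_triangle_ineq[of "T - z / h" "z / h"] by simp
      then have "\<bar>T\<bar> \<le> \<eta> n * (1 + \<bar>\<alpha>\<bar> + \<bar>T\<bar>) + 2 * C1 / m" using T1 zh by (meson add_mono order_trans)
      from lin[OF this half] show ?thesis by simp
    qed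
    have "\<eta> n * (1 + \<bar>\<alpha>\<bar> + \<bar>T\<bar>) \<le> \<eta> n * E"
      using TB \<eta>(3) by (intro mult_left_mono) (auto simp: E_def)
    also have "\<dots> \<le> \<epsilon> / (2 * E) * E" using \<eta> E by (intro mult_right_mono) auto
    also have "\<dots> = \<epsilon> / 2" using E by simp
    finally have 1: "\<bar>T - z / h\<bar> \<le> \<epsilon> / 2" using T1 by linarith
    have 2: "\<bar>z / h - z / m\<bar> \<le> \<epsilon> / 2"
    proof -
      have "z / h - z / m = z * (m - h) / (h * m)" using h0 m by (simp add: field_simps)
      then have "\<bar>z / h - z / m\<bar> = \<bar>z\<bar> * \<bar>h - m\<bar> / (h * m)"
        using h0 m by (simp add: abs_divide abs_mult abs_minus_commute)
      also have "\<dots> \<le> (C1 + 1) * (\<epsilon> * m\<^sup>2 / (4 * (C1 + 1))) / (m / 2 * m)"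
      proof (intro frac_le mult_mono mult_right_mono)
        show "0 \<le> (C1 + 1) * (\<epsilon> * m\<^sup>2 / (4 * (C1 + 1)))" using \<epsilon> C by (intro mult_nonneg_nonneg divide_nonneg_nonneg) auto
      qed (use z h \<delta> m C in auto)
      also have "\<dots> = \<epsilon> / 2"
      proof -
        have "c * (\<epsilon> * m\<^sup>2 / (4 * c)) / (m / 2 * m) = \<epsilon> / 2" if "c \<noteq> 0" for c
          using that m by (simp add: field_simps power2_eq_square)
        from this[of "C1 + 1"] C show ?thesis by simp
      qed
      finally show ?thesis .
    qed
    have "\<bar>T - z / m\<bar> \<le> \<epsilon>" using 1 2 by linarith
    with TB show "\<bar>sqrt (real n) * (a - \<alpha>) - S / sqrt (real n) / m\<bar> \<le> \<epsilon> \<and>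
       \<bar>sqrt (real n) * (a - \<alpha>)\<bar> \<le> 4 * C1 / m + 1 + \<bar>\<alpha>\<bar>"
      unfolding T_def z_def r_def by blast
  qed
qed

section \<open>Asymptotic normality\<close>

context inar_process
begin

context
  fixes s \<theta> :: nat
  assumes s: "1 \<le> s"
begin

definition obs :: "'a \<Rightarrow> nat \<Rightarrow> real" where
  "obs \<omega> k = real (X k \<omega> + (if k = s then \<theta> else 0))"

text \<open>From \<open>s + 1\<close> on neither regressors nor responses are shifted by the
  outlier, so the sum can be written in terms of \<open>X\<close>.\<close>

definition score :: "nat \<Rightarrow> 'a \<Rightarrow> real" where
  "score n \<omega> = (\<Sum>j\<in>{s + 1..<n}. real (X j \<omega>) * (real (X (Suc j) \<omega>) - \<alpha> * real (X j \<omega>) - eps_moment 1)) / sqrt n"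

text \<open>Histories form a countable discrete space, on which every function is measurable. This
  covers the minimiser without an analysis of its dependence on the data.\<close>

lemma measurable_obs_functional:
  fixes \<Phi> :: "(nat \<Rightarrow> real) \<Rightarrow> 'b::topological_space"
  assumes "\<And>y y'. (\<And>k. k \<le> N \<Longrightarrow> y k = y' k) \<Longrightarrow> \<Phi> y = \<Phi> y'"
  shows "(\<lambda>\<omega>. \<Phi> (obs \<omega>)) \<in> borel_measurable M"
proof -
  have "\<Phi> (obs \<omega>) = \<Phi> (\<lambda>k. real (hist N \<omega> ! k + (if k = s then \<theta> else 0)))" for \<omega>
    by (rule assms) (simp add: obs_def del: inar_X.simps)
  then show ?thesis
    using measurable_compose[OF measurable_hist[of N], of "\<lambda>l. \<Phi> (\<lambda>k. real (l ! k + (if k = s then \<theta> else 0)))" borel]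
    by simp
qed

lemma measurable_score: "score n \<in> borel_measurable M"
  unfolding score_def[abs_def] by (simp del: inar_X.simps)

lemma score_clt:
  assumes A: "A = {\<omega>\<in>space M. hist (s + 1) \<omega> \<in> L}"
  shows "(\<lambda>n. \<integral>\<omega>. indicator A \<omega> * iexp (t * score n \<omega>) \<partial>M) \<longlonglongrightarrow>
    complex_of_real (prob A) * exp (- complex_of_real (t\<^sup>2 * asy_var / 2))"
proof -
  have "(\<integral>\<omega>. indicator A \<omega> * iexp (t * score n \<omega>) \<partial>M) =
      (\<integral>\<omega>. indicator L (hist (s + 1) \<omega>) * iexp (t * score n \<omega>) \<partial>M)" for n
    by (intro Bochner_Integration.integral_cong refl) (simp add: A indicator_def)
  then show ?thesis using martingale_clt[of L "s + 1" t] unfolding score_def A by simp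
qed

lemma score_tight:
  assumes "0 < \<epsilon>"
  obtains C where "0 < C" "eventually (\<lambda>n. prob {\<omega>\<in>space M. C < \<bar>score n \<omega>\<bar>} < \<epsilon>) sequentially"
proof -
  have sp: "space M = {\<omega>\<in>space M. hist (s + 1) \<omega> \<in> UNIV}" by simp
  have "weak_conv_m (\<lambda>n. distr (uniform_measure M (space M)) borel (score n)) (normal_var (1\<^sup>2 * asy_var))"
    by (rule conditional_weak_limit[where Z=score])
      (use score_clt[OF sp] measurable_score asy_var_nonneg in \<open>auto simp: prob_space\<close>)
  then have "weak_conv_m (\<lambda>n. distr M borel (score n)) (normal_var asy_var)"
    by (simp add: uniform_measure_space)
  from weak_conv_normal_tight[OF measurable_score asy_var_nonneg this assms] that show ?thesis by blast
qed

lemma bounded_in_prob: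
  assumes [measurable]: "f \<in> borel_measurable M" and "0 < (\<epsilon>::real)"
  obtains C :: real where "0 < C" "prob {\<omega>\<in>space M. C < f \<omega>} < \<epsilon>"
proof -
  interpret D: real_distribution "distr M borel f" by (rule real_distribution_distr) simp
  have "eventually (\<lambda>x. 1 - \<epsilon> < cdf (distr M borel f) x) at_top"
    using assms(2) by (intro order_tendstoD(1)[OF D.cdf_lim_at_top_prob]) auto
  then have "eventually (\<lambda>x. 1 - \<epsilon> < cdf (distr M borel f) x \<and> 0 < x) at_top"
    using eventually_gt_at_top[of 0] by eventually_elim auto
  then obtain C where C: "1 - \<epsilon> < cdf (distr M borel f) C" "0 < C"
    using eventually_happens'[OF trivial_limit_at_top_linorder] by blast
  have "cdf (distr M borel f) C = prob {\<omega>\<in>space M. f \<omega> \<le> C}" by (rule cdf_distr) simp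
  moreover have "prob {\<omega>\<in>space M. C < f \<omega>} = 1 - prob {\<omega>\<in>space M. f \<omega> \<le> C}"
    by (subst prob_compl[symmetric]) (auto intro!: arg_cong[where f=prob])
  ultimately show ?thesis using C that by simp
qed

text \<open>The delta method needs both bounds for the same \<open>a\<close>: \<open>Q\<close> keeps
  \<open>a\<close> near \<alpha>, and \<epsilon> controls the replacement of the normalised error by
  the score.\<close>

definition expands :: "nat \<Rightarrow> real \<Rightarrow> real \<Rightarrow> 'a \<Rightarrow> bool" where
  "expands n \<epsilon> Q \<omega> \<longleftrightarrow> (\<exists>a.
      inar_est n s (eps_moment 1) (obs \<omega>) = (a, obs \<omega> s + outlier_shift (eps_moment 1) (obs \<omega> (s - 1) + obs \<omega> (s + 1)) a) \<and>
      \<bar>sqrt n * (a - \<alpha>) - score n \<omega> / m2\<bar> \<le> \<epsilon> \<and> \<bar>sqrt n * (a - \<alpha>)\<bar> \<le> Q)"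

text \<open>Three events are discarded: the average of squares far from \<open>m2\<close>, a large
  score, a large remainder. Working with a superset \<open>E\<close> of the failures spares the
  measurability of \<open>expands\<close>. \<open>Q\<close> comes from tightness alone and serves
  every \<epsilon>.\<close>

lemma estimator_expansion:
  assumes "0 < \<eta>"
  obtains Q where "\<And>\<epsilon>. 0 < \<epsilon> \<Longrightarrow> eventually (\<lambda>n. \<exists>E\<in>events. prob E < \<eta> \<and> (\<forall>\<omega>\<in>space M - E. expands n \<epsilon> Q \<omega>)) sequentially"
proof -
  define D where "D = (\<lambda>\<omega>. remainder_const \<alpha> (eps_moment 1) s (obs \<omega>))"
  have D0: "0 \<le> D \<omega>" for \<omega>
    unfolding D_def remainder_const_def Let_def
    by (intro add_nonneg_nonneg mult_nonneg_nonneg sum_nonneg) auto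
  have D_meas [measurable]: "D \<in> borel_measurable M"
    unfolding D_def
  proof (rule measurable_obs_functional[where N="s + 1"])
    fix y y' :: "nat \<Rightarrow> real" assume eq: "\<And>k. k \<le> s + 1 \<Longrightarrow> y k = y' k"
    have "(\<Sum>k\<in>{1..<s}. (y (k - 1))\<^sup>2) = (\<Sum>k\<in>{1..<s}. (y' (k - 1))\<^sup>2)"
      "(\<Sum>k\<in>{1..<s}. y (k - 1) * (y k - \<alpha> * y (k - 1) - eps_moment 1)) = (\<Sum>k\<in>{1..<s}. y' (k - 1) * (y' k - \<alpha> * y' (k - 1) - eps_moment 1))"
      by (rule sum.cong, simp, use eq in auto)+
    moreover have "y (s - 1) = y' (s - 1)" "y (s + 1) = y' (s + 1)" by (auto intro: eq)
    ultimately show "remainder_const \<alpha> (eps_moment 1) s y = remainder_const \<alpha> (eps_moment 1) s y'"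
      unfolding remainder_const_def Let_def by (simp only:)
  qed
  obtain C1 where C1: "0 < C1" "eventually (\<lambda>n. prob {\<omega>\<in>space M. C1 < \<bar>score n \<omega>\<bar>} < \<eta> / 3) sequentially"
    using score_tight[of "\<eta> / 3"] assms by auto
  obtain C2 where C2: "0 < C2" "prob {\<omega>\<in>space M. C2 < D \<omega>} < \<eta> / 3"
    using bounded_in_prob[OF D_meas, of "\<eta> / 3"] assms by auto
  define Q where "Q = 4 * C1 / m2 + 1 + \<bar>\<alpha>\<bar>"
  define S2 where "S2 = (\<lambda>n \<omega>. \<Sum>j\<in>{s + 1..<n}. real (X j \<omega>) ^ 2)"
  have [measurable]: "S2 n \<in> borel_measurable M" for n
    unfolding S2_def by (simp del: inar_X.simps)
  note measurable_score[measurable]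
  show ?thesis
  proof (rule that[of Q])
    fix \<epsilon> :: real assume \<epsilon>: "0 < \<epsilon>"
    obtain \<delta> n0 where \<delta>: "0 < \<delta>"
      and err: "\<And>n S2 S D a. \<lbrakk>n0 \<le> n; \<bar>S2 / real n - m2\<bar> \<le> \<delta>; \<bar>S / sqrt (real n)\<bar> \<le> C1; 0 \<le> D; D \<le> C2;
         \<bar>S2 * (a - \<alpha>) - S\<bar> \<le> D * (1 + \<bar>a\<bar>)\<rbrakk> \<Longrightarrow>
         \<bar>sqrt (real n) * (a - \<alpha>) - S / sqrt (real n) / m2\<bar> \<le> \<epsilon> \<and> \<bar>sqrt (real n) * (a - \<alpha>)\<bar> \<le> Q"
      and big: "\<And>n S2. n0 \<le> n \<Longrightarrow> \<bar>S2 / real n - m2\<bar> \<le> \<delta> \<Longrightarrow> C2 < S2"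
      unfolding Q_def
      by (rule normalized_error_bound[OF m2_pos less_imp_le[OF C1(1)] less_imp_le[OF C2(1)] \<epsilon>, where \<alpha>=\<alpha>]) blast
    have "eventually (\<lambda>n. prob {\<omega>\<in>space M. \<delta> < \<bar>S2 n \<omega> / n - m2\<bar>} < \<eta> / 3) sequentially"
      unfolding S2_def using assms by (intro order_tendstoD(2)[OF weak_law_squares[OF \<delta>]]) auto
    then show "eventually (\<lambda>n. \<exists>E\<in>events. prob E < \<eta> \<and> (\<forall>\<omega>\<in>space M - E. expands n \<epsilon> Q \<omega>)) sequentially"
      using C1(2) eventually_ge_at_top[of "max n0 (s + 1)"]
    proof eventually_elim
      case (elim n)
      define E where "E = {\<omega>\<in>space M. \<delta> < \<bar>S2 n \<omega> / n - m2\<bar>} \<union> {\<omega>\<in>space M. C1 < \<bar>score n \<omega>\<bar>} \<union> {\<omega>\<in>space M. C2 < D \<omega>}"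
      have "prob E \<le> prob ({\<omega>\<in>space M. \<delta> < \<bar>S2 n \<omega> / n - m2\<bar>} \<union> {\<omega>\<in>space M. C1 < \<bar>score n \<omega>\<bar>}) + prob {\<omega>\<in>space M. C2 < D \<omega>}"
        unfolding E_def by (rule measure_Un_le) measurable
      also have "\<dots> \<le> prob {\<omega>\<in>space M. \<delta> < \<bar>S2 n \<omega> / n - m2\<bar>} + prob {\<omega>\<in>space M. C1 < \<bar>score n \<omega>\<bar>} + prob {\<omega>\<in>space M. C2 < D \<omega>}"
        by (intro add_right_mono measure_Un_le) measurable
      also have "\<dots> < \<eta>" using elim C2(2) by linarith
      finally have PE: "prob E < \<eta>" .
      have "expands n \<epsilon> Q \<omega>" if \<omega>: "\<omega> \<in> space M - E" for \<omega>
      proof -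
        define S where "S = (\<Sum>j\<in>{s + 1..<n}. real (X j \<omega>) * (real (X (Suc j) \<omega>) - \<alpha> * real (X j \<omega>) - eps_moment 1))"
        have sc: "S / sqrt n = score n \<omega>" by (simp add: S_def score_def del: inar_X.simps)
        have bnds: "\<bar>S2 n \<omega> / n - m2\<bar> \<le> \<delta>" "\<bar>S / sqrt n\<bar> \<le> C1" "D \<omega> \<le> C2"
          using \<omega> unfolding sc by (auto simp: E_def not_less)
        have o: "(\<Sum>j\<in>{s + 1..<n}. (obs \<omega> j)\<^sup>2) = S2 n \<omega>"
          "(\<Sum>j\<in>{s + 1..<n}. obs \<omega> j * (obs \<omega> (Suc j) - \<alpha> * obs \<omega> j - eps_moment 1)) = S"
          unfolding S2_def S_def obs_def by (intro sum.cong refl; simp del: inar_X.simps)+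
        have "D \<omega> < S2 n \<omega>" using big[of n "S2 n \<omega>"] elim bnds by simp
        then obtain a where a: "inar_est n s (eps_moment 1) (obs \<omega>) = (a, obs \<omega> s + outlier_shift (eps_moment 1) (obs \<omega> (s - 1) + obs \<omega> (s + 1)) a)"
          "\<bar>S2 n \<omega> * (a - \<alpha>) - S\<bar> \<le> D \<omega> * (1 + \<bar>a\<bar>)"
          using inar_est_expansion[OF s, of n \<alpha> "eps_moment 1" "obs \<omega>"] elim unfolding o D_def by auto
        with err[of n "S2 n \<omega>" S "D \<omega>" a] bnds D0 elim show ?thesis unfolding sc expands_def by auto
      qed
      moreover have "E \<in> events" unfolding E_def by measurable
      ultimately show ?case using PE by blast
    qed
  qed
qed

section \<open>The limit laws of the two estimators\<close>

lemma conv_in_probI: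
  assumes "\<And>n. f n \<in> events" and "\<And>\<eta>. 0 < \<eta> \<Longrightarrow> eventually (\<lambda>n. \<exists>E\<in>events. prob E < \<eta> \<and> f n \<subseteq> E) sequentially"
  shows "(\<lambda>n. prob (f n)) \<longlonglongrightarrow> 0"
proof (rule order_tendstoI)
  fix \<eta> :: real assume "0 < \<eta>"
  from assms(2)[OF this] show "eventually (\<lambda>n. prob (f n) < \<eta>) sequentially"
    by eventually_elim (meson finite_measure_mono le_less_trans)
qed (auto intro!: always_eventually less_le_trans[OF _ measure_nonneg])

text \<open>Conditioning on the whole space makes this an instance of the conditional limit with
  scaling \<open>1 / m2\<close>, which turns \<open>asy_var\<close> into
  \<open>inar_sigma2\<close>.\<close>

theorem alpha_estimator_limit:
  "weak_conv_m (\<lambda>n. distr M borel (\<lambda>\<omega>. sqrt n * (fst (inar_est n s (eps_moment 1) (obs \<omega>)) - \<alpha>)))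
     (normal_var (inar_sigma2 \<alpha> p))"
proof -
  define V where "V = (\<lambda>n \<omega>. sqrt n * (fst (inar_est n s (eps_moment 1) (obs \<omega>)) - \<alpha>))"
  have [measurable]: "V n \<in> borel_measurable M" for n
    unfolding V_def
    by (rule measurable_obs_functional[where N="max n (s + 1)"]) (use inar_est_cong in metis)
  note measurable_score[measurable]
  have sp: "space M = {\<omega>\<in>space M. hist (s + 1) \<omega> \<in> UNIV}" by simp
  have "weak_conv_m (\<lambda>n. distr (uniform_measure M (space M)) borel (V n)) (normal_var ((1 / m2)\<^sup>2 * asy_var))"
  proof (rule conditional_weak_limit[where Z=score])
    show "(\<lambda>n. \<integral>\<omega>. indicator (space M) \<omega> * iexp (t * score n \<omega>) \<partial>M) \<longlonglongrightarrow>
       complex_of_real (prob (space M)) * exp (- complex_of_real (t\<^sup>2 * asy_var / 2))" for t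
      by (rule score_clt[OF sp])
    fix \<epsilon> :: real assume \<epsilon>: "0 < \<epsilon>"
    show "(\<lambda>n. prob {\<omega> \<in> space M. \<omega> \<in> space M \<and> \<epsilon> < \<bar>V n \<omega> - 1 / m2 * score n \<omega>\<bar>}) \<longlonglongrightarrow> 0"
    proof (rule conv_in_probI)
      fix \<eta> :: real assume "0 < \<eta>"
      from estimator_expansion[OF this] obtain Q where Q: "\<And>\<epsilon>. 0 < \<epsilon> \<Longrightarrow> eventually (\<lambda>n. \<exists>E\<in>events. prob E < \<eta> \<and> (\<forall>\<omega>\<in>space M - E. expands n \<epsilon> Q \<omega>)) sequentially" by blast
      from Q[OF \<epsilon>] show "eventually (\<lambda>n. \<exists>E\<in>events. prob E < \<eta> \<and> {\<omega> \<in> space M. \<omega> \<in> space M \<and> \<epsilon> < \<bar>V n \<omega> - 1 / m2 * score n \<omega>\<bar>} \<subseteq> E) sequentially"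
      proof eventually_elim
        case (elim n)
        then obtain E where E: "E \<in> events" "prob E < \<eta>" "\<And>\<omega>. \<omega> \<in> space M - E \<Longrightarrow> expands n \<epsilon> Q \<omega>" by blast
        have "{\<omega> \<in> space M. \<omega> \<in> space M \<and> \<epsilon> < \<bar>V n \<omega> - 1 / m2 * score n \<omega>\<bar>} \<subseteq> E"
        proof
          fix \<omega> assume \<omega>: "\<omega> \<in> {\<omega> \<in> space M. \<omega> \<in> space M \<and> \<epsilon> < \<bar>V n \<omega> - 1 / m2 * score n \<omega>\<bar>}"
          show "\<omega> \<in> E"
          proof (rule ccontr)
            assume "\<omega> \<notin> E"
            with \<omega> E(3)[of \<omega>] show False by (auto simp: V_def expands_def)
          qed
        qed
        with E show ?case by blast
      qed
    qed measurable
  qed (auto simp: prob_space asy_var_nonneg)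
  then show ?thesis
    by (simp add: uniform_measure_space V_def sigma2_eq power_divide)
qed

text \<open>On \<open>A\<close> the neighbours of the outlier are fixed and the observation at
  \<open>s\<close> cancels. What remains is the increment of the deterministic function \<psi> from
  \<alpha> to its estimate, to which the delta method applies with derivative
  \<open>d\<close>.\<close>

theorem theta_estimator_limit:
  fixes c1 c2 :: nat
  defines "A \<equiv> {\<omega>\<in>space M. X (s - 1) \<omega> = c1 \<and> X (s + 1) \<omega> = c2}"
  assumes A: "0 < prob A"
  shows "weak_conv_m (\<lambda>n. distr (uniform_measure M A) borel
       (\<lambda>\<omega>. sqrt n * (snd (inar_est n s (eps_moment 1) (obs \<omega>))
          - (obs \<omega> s + outlier_shift (eps_moment 1) (obs \<omega> (s - 1) + obs \<omega> (s + 1)) \<alpha>))))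
     (normal_var (inar_sigma2 \<alpha> p / (1 + \<alpha>\<^sup>2) ^ 4 *
        ((\<alpha>\<^sup>2 - 1) * (real c1 + real c2) + (1 + 2 * \<alpha> - \<alpha>\<^sup>2) * eps_moment 1)\<^sup>2))"
proof -
  define \<psi> where "\<psi> = outlier_shift (eps_moment 1) (real c1 + real c2)"
  define d where "d = ((\<alpha>\<^sup>2 - 1) * (real c1 + real c2) + (1 + 2 * \<alpha> - \<alpha>\<^sup>2) * eps_moment 1) / (1 + \<alpha>\<^sup>2)\<^sup>2"
  define V where "V = (\<lambda>n \<omega>. sqrt n * (snd (inar_est n s (eps_moment 1) (obs \<omega>))
          - (obs \<omega> s + outlier_shift (eps_moment 1) (obs \<omega> (s - 1) + obs \<omega> (s + 1)) \<alpha>)))"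
  have \<psi>: "(\<psi> has_real_derivative d) (at \<alpha>)" unfolding \<psi>_def d_def by (rule DERIV_outlier_shift)
  have [measurable]: "V n \<in> borel_measurable M" for n
    unfolding V_def
  proof (rule measurable_obs_functional[where N="max n (s + 1)"])
    fix y y' :: "nat \<Rightarrow> real" assume eq: "\<And>k. k \<le> max n (s + 1) \<Longrightarrow> y k = y' k"
    have "inar_est n s (eps_moment 1) y = inar_est n s (eps_moment 1) y'" by (rule inar_est_cong) (rule eq)
    moreover have "y s = y' s" "y (s - 1) = y' (s - 1)" "y (s + 1) = y' (s + 1)" by (auto intro: eq)
    ultimately show "sqrt n * (snd (inar_est n s (eps_moment 1) y) - (y s + outlier_shift (eps_moment 1) (y (s - 1) + y (s + 1)) \<alpha>)) =
       sqrt n * (snd (inar_est n s (eps_moment 1) y') - (y' s + outlier_shift (eps_moment 1) (y' (s - 1) + y' (s + 1)) \<alpha>))"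
      by (simp only:)
  qed
  note measurable_score[measurable]
  have A_meas [measurable]: "A \<in> events" unfolding A_def by (simp del: inar_X.simps)
  have A_hist: "A = {\<omega>\<in>space M. hist (s + 1) \<omega> \<in> {l. l ! (s - 1) = c1 \<and> l ! (s + 1) = c2}}"
    unfolding A_def by (simp del: inar_X.simps)
  have "weak_conv_m (\<lambda>n. distr (uniform_measure M A) borel (V n)) (normal_var ((d / m2)\<^sup>2 * asy_var))"
  proof (rule conditional_weak_limit[where Z=score])
    show "(\<lambda>n. \<integral>\<omega>. indicator A \<omega> * iexp (t * score n \<omega>) \<partial>M) \<longlonglongrightarrow>
       complex_of_real (prob A) * exp (- complex_of_real (t\<^sup>2 * asy_var / 2))" for t
      by (rule score_clt[OF A_hist])
    fix \<epsilon> :: real assume \<epsilon>: "0 < \<epsilon>"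
    show "(\<lambda>n. prob {\<omega> \<in> space M. \<omega> \<in> A \<and> \<epsilon> < \<bar>V n \<omega> - d / m2 * score n \<omega>\<bar>}) \<longlonglongrightarrow> 0"
    proof (rule conv_in_probI)
      fix \<eta> :: real assume "0 < \<eta>"
      from estimator_expansion[OF this] obtain Q where Q: "\<And>\<epsilon>. 0 < \<epsilon> \<Longrightarrow> eventually (\<lambda>n. \<exists>E\<in>events. prob E < \<eta> \<and> (\<forall>\<omega>\<in>space M - E. expands n \<epsilon> Q \<omega>)) sequentially" by blast
      \<comment> \<open>Half of \<epsilon> goes to linearising \<psi>, an error proportional to the
        normalised error bounded by \<open>Q\<close>; the other half goes to replacing that error by
        the score, which is multiplied by \<open>d\<close>.\<close>
      define e where "e = \<epsilon> / (2 * (\<bar>Q\<bar> + 1))"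
      define \<epsilon>1 where "\<epsilon>1 = \<epsilon> / (2 * (\<bar>d\<bar> + 1))"
      have e: "0 < e" "e * \<bar>Q\<bar> \<le> \<epsilon> / 2" and \<epsilon>1: "0 < \<epsilon>1" "\<bar>d\<bar> * \<epsilon>1 \<le> \<epsilon> / 2"
        using \<epsilon> by (auto simp: e_def \<epsilon>1_def field_simps)
      have "(\<psi> has_derivative (\<lambda>x. d * x)) (at \<alpha>)" using \<psi> by (simp add: has_field_derivative_def)
      from this[unfolded has_derivative_at_alt] e(1)
      obtain \<kappa> where \<kappa>: "0 < \<kappa>" "\<And>a. \<bar>a - \<alpha>\<bar> < \<kappa> \<Longrightarrow> \<bar>\<psi> a - \<psi> \<alpha> - d * (a - \<alpha>)\<bar> \<le> e * \<bar>a - \<alpha>\<bar>"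
        by (auto simp: real_norm_def)
      \<comment> \<open>For large \<open>n\<close> the bound \<open>Q\<close> on the normalised
        error forces \<open>a\<close> into the neighbourhood where the derivative estimate
        holds.\<close>
      have "(\<lambda>n. \<bar>Q\<bar> * (1 / sqrt (real n))) \<longlonglongrightarrow> \<bar>Q\<bar> * 0" by (intro tendsto_intros inverse_sqrt_lim)
      then have "eventually (\<lambda>n. \<bar>Q\<bar> * (1 / sqrt (real n)) < \<kappa>) sequentially"
        using \<kappa>(1) by (intro order_tendstoD) auto
      with Q[OF \<epsilon>1(1)] eventually_gt_at_top[of 0]
      show "eventually (\<lambda>n. \<exists>E\<in>events. prob E < \<eta> \<and> {\<omega> \<in> space M. \<omega> \<in> A \<and> \<epsilon> < \<bar>V n \<omega> - d / m2 * score n \<omega>\<bar>} \<subseteq> E) sequentially"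
      proof eventually_elim
        case (elim n)
        then obtain E where E: "E \<in> events" "prob E < \<eta>" "\<And>\<omega>. \<omega> \<in> space M - E \<Longrightarrow> expands n \<epsilon>1 Q \<omega>" by blast
        have n: "0 < sqrt n" using elim by simp
        have "{\<omega> \<in> space M. \<omega> \<in> A \<and> \<epsilon> < \<bar>V n \<omega> - d / m2 * score n \<omega>\<bar>} \<subseteq> E"
        proof
          fix \<omega> assume \<omega>: "\<omega> \<in> {\<omega> \<in> space M. \<omega> \<in> A \<and> \<epsilon> < \<bar>V n \<omega> - d / m2 * score n \<omega>\<bar>}"
          show "\<omega> \<in> E"
          proof (rule ccontr)
            assume "\<omega> \<notin> E"
            with \<omega> E(3)[of \<omega>] obtain a where a:
              "inar_est n s (eps_moment 1) (obs \<omega>) = (a, obs \<omega> s + outlier_shift (eps_moment 1) (obs \<omega> (s - 1) + obs \<omega> (s + 1)) a)"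
              "\<bar>sqrt n * (a - \<alpha>) - score n \<omega> / m2\<bar> \<le> \<epsilon>1" "\<bar>sqrt n * (a - \<alpha>)\<bar> \<le> Q" by (auto simp: expands_def)
            have o: "obs \<omega> (s - 1) + obs \<omega> (s + 1) = real c1 + real c2"
              using \<omega> s by (simp add: A_def obs_def del: inar_X.simps)
            have V: "V n \<omega> = sqrt n * (\<psi> a - \<psi> \<alpha>)"
              unfolding V_def a(1) o \<psi>_def by simp
            define T where "T = sqrt n * (a - \<alpha>)"
            have T: "\<bar>T\<bar> \<le> \<bar>Q\<bar>" using a(3) by (simp add: T_def)
            have "\<bar>a - \<alpha>\<bar> = \<bar>T\<bar> * (1 / sqrt n)" using n by (simp add: T_def abs_mult)
            also have "\<dots> \<le> \<bar>Q\<bar> * (1 / sqrt n)" using T n by (intro mult_right_mono) auto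
            finally have "\<bar>a - \<alpha>\<bar> < \<kappa>" using elim by linarith
            then have "sqrt n * \<bar>\<psi> a - \<psi> \<alpha> - d * (a - \<alpha>)\<bar> \<le> sqrt n * (e * \<bar>a - \<alpha>\<bar>)"
              using n by (intro mult_left_mono \<kappa>) auto
            moreover have "sqrt n * \<bar>\<psi> a - \<psi> \<alpha> - d * (a - \<alpha>)\<bar> = \<bar>V n \<omega> - d * T\<bar>"
            proof -
              have "V n \<omega> - d * T = sqrt n * (\<psi> a - \<psi> \<alpha> - d * (a - \<alpha>))"
                unfolding V T_def by (simp only: right_diff_distrib mult.left_commute)
              then show ?thesis using n by (simp only: abs_mult abs_of_pos)
            qed
            moreover have "sqrt n * (e * \<bar>a - \<alpha>\<bar>) = e * \<bar>T\<bar>"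
              using n by (simp add: T_def abs_mult)
            moreover have "e * \<bar>T\<bar> \<le> e * \<bar>Q\<bar>" using T e by (intro mult_left_mono) auto
            ultimately have 1: "\<bar>V n \<omega> - d * T\<bar> \<le> \<epsilon> / 2" using e(2) by linarith
            have "\<bar>d * T - d / m2 * score n \<omega>\<bar> = \<bar>d\<bar> * \<bar>T - score n \<omega> / m2\<bar>"
              by (simp add: abs_mult[symmetric] right_diff_distrib)
            also have "\<dots> \<le> \<bar>d\<bar> * \<epsilon>1" using a(2) by (intro mult_left_mono) (auto simp: T_def)
            finally have 2: "\<bar>d * T - d / m2 * score n \<omega>\<bar> \<le> \<epsilon> / 2" using \<epsilon>1(2) by linarith
            have "\<bar>V n \<omega> - d / m2 * score n \<omega>\<bar> \<le> \<bar>V n \<omega> - d * T\<bar> + \<bar>d * T - d / m2 * score n \<omega>\<bar>"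
              using abs_triangle_ineq[of "V n \<omega> - d * T" "d * T - d / m2 * score n \<omega>"] by simp
            then show False using 1 2 \<omega> by simp
          qed
        qed
        with E show ?case by blast
      qed
    qed measurable
  qed (use A asy_var_nonneg in auto)
  moreover have "(d / m2)\<^sup>2 * asy_var = inar_sigma2 \<alpha> p / (1 + \<alpha>\<^sup>2) ^ 4 *
        ((\<alpha>\<^sup>2 - 1) * (real c1 + real c2) + (1 + 2 * \<alpha> - \<alpha>\<^sup>2) * eps_moment 1)\<^sup>2"
  proof -
    have "((1 + \<alpha>\<^sup>2)\<^sup>2)\<^sup>2 = (1 + \<alpha>\<^sup>2) ^ 4" by (simp flip: power_mult)
    then show ?thesis unfolding sigma2_eq d_def power_divide by (simp only:) (simp add: mult.commute)
  qed
  ultimately show ?thesis unfolding V_def by simp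
qed

end

end

section \<open>From the hypotheses on the process to the limit laws for \<open>Y\<close>\<close>

theorem theorem3p2p2:
  fixes M :: "'a measure"
    and \<alpha> :: real and \<mu> :: real
    and X0 :: "'a \<Rightarrow> nat" and eps :: "nat \<Rightarrow> 'a \<Rightarrow> nat" and xi :: "nat \<Rightarrow> nat \<Rightarrow> 'a \<Rightarrow> nat"
    and eps_law :: "nat pmf"
    and s \<theta> :: nat
    and Y :: "nat \<Rightarrow> 'a \<Rightarrow> nat"
  assumes "prob_space M"
    and "0 < \<alpha>" and "\<alpha> < 1"
    and "prob_space.indep_vars M (\<lambda>_. count_space UNIV) (inar_family X0 eps xi) inar_indices"
    and "\<And>k. k \<ge> 1 \<Longrightarrow> distr M (count_space UNIV) (eps k) = measure_pmf eps_law"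
    and "\<And>k j. k \<ge> 1 \<Longrightarrow> j \<ge> 1 \<Longrightarrow>
           distr M (count_space UNIV) (xi k j) = measure_pmf (map_pmf of_bool (bernoulli_pmf \<alpha>))"
    and "integrable M (\<lambda>\<omega>. real (eps 1 \<omega>) ^ 2)"
    and "measure M {\<omega> \<in> space M. eps 1 \<omega> \<noteq> 0} > 0"
    and "integrable M (\<lambda>\<omega>. real (X0 \<omega>) ^ 2)"
    and "integrable M (\<lambda>\<omega>. real (X0 \<omega>) ^ 3)"
    and "integrable M (\<lambda>\<omega>. real (eps 1 \<omega>) ^ 3)"
    and "\<mu> = integral\<^sup>L M (\<lambda>\<omega>. real (eps 1 \<omega>))"
    and "s \<ge> 1" and "\<theta> \<ge> 1"
    and "\<And>k \<omega>. Y k \<omega> = inar_X X0 eps xi k \<omega> + (if k = s then \<theta> else 0)"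
  shows "weak_conv_m
           (\<lambda>n. distr M borel (\<lambda>\<omega>. sqrt (real n) *
                 (fst (inar_est n s \<mu> (\<lambda>k. real (Y k \<omega>))) - \<alpha>)))
           (normal_var (inar_sigma2 \<alpha> eps_law))
       \<and> (\<forall>m1 m2. measure M {\<omega> \<in> space M. Y (s - 1) \<omega> = m1 \<and> Y (s + 1) \<omega> = m2} > 0 \<longrightarrow>
           weak_conv_m
             (\<lambda>n. distr (uniform_measure M {\<omega> \<in> space M. Y (s - 1) \<omega> = m1 \<and> Y (s + 1) \<omega> = m2}) borel
                (\<lambda>\<omega>. sqrt (real n) *
                   (snd (inar_est n s \<mu> (\<lambda>k. real (Y k \<omega>)))
                    - (real (Y s \<omega>) - \<alpha> / (1 + \<alpha>\<^sup>2) * (real (Y (s - 1) \<omega>) + real (Y (s + 1) \<omega>))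
                       - (1 - \<alpha>) / (1 + \<alpha>\<^sup>2) * \<mu>))))
             (normal_var (inar_sigma2 \<alpha> eps_law / (1 + \<alpha>\<^sup>2) ^ 4 *
                ((\<alpha>\<^sup>2 - 1) * (real m1 + real m2) + (1 + 2 * \<alpha> - \<alpha>\<^sup>2) * \<mu>)\<^sup>2)))"
proof -
  interpret P: prob_space M by fact
  have ev [measurable]: "eps 1 \<in> measurable M (count_space UNIV)"
  proof -
    have "IEps 1 \<in> inar_indices" by (auto simp: inar_indices_def)
    then have "inar_family X0 eps xi (IEps 1) \<in> measurable M (count_space UNIV)"
      using assms(4) unfolding P.indep_vars_def by blast
    then show ?thesis by (simp add: inar_family_def[abs_def])
  qed
  have law: "distr M (count_space UNIV) (eps 1) = measure_pmf eps_law" by (rule assms(5)) simp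
  have p3: "integrable (measure_pmf eps_law) (\<lambda>x. real x ^ 3)"
    unfolding law[symmetric] using assms(11) ev by (subst integrable_distr_eq) auto
  have mean: "\<mu> = (\<integral>x. real x \<partial>measure_pmf eps_law)"
    unfolding law[symmetric] using assms(12) ev by (subst integral_distr) auto
  have p0: "pmf eps_law 0 < 1"
  proof -
    have "pmf eps_law 0 = measure M {\<omega>\<in>space M. eps 1 \<omega> = 0}"
    proof -
      have "{\<omega>\<in>space M. eps 1 \<omega> = 0} = eps 1 -` {0} \<inter> space M" by auto
      then show ?thesis using law P.distr_eq_measure_pmf_iff[OF ev, of eps_law] by simp
    qed
    also have "\<dots> = 1 - measure M {\<omega>\<in>space M. eps 1 \<omega> \<noteq> 0}"
    proof -
      have "{\<omega>\<in>space M. eps 1 \<omega> \<noteq> 0} \<in> sets M" by measurable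
      from P.prob_compl[OF this] show ?thesis
        by (auto intro!: arg_cong[where f="measure M"] elim!: trans[rotated])
    qed
    finally show ?thesis using assms(8) by simp
  qed
  \<comment> \<open>The third moment and the atom at 0 have been moved from \<open>eps 1\<close> to
    its law, the form in which the locale asks for them.\<close>
  interpret inar_process M \<alpha> eps_law X0 eps xi
    by unfold_locales (use assms(2-6,10) p3 p0 in auto)
  have \<mu>: "\<mu> = eps_moment 1" unfolding mean eps_moment_def binom_1 ..
  have obs: "obs s \<theta> \<omega> = (\<lambda>k. real (Y k \<omega>))" for \<omega>
    by (simp add: obs_def[OF \<open>s \<ge> 1\<close>] fun_eq_iff assms(15) del: inar_X.simps)
  \<comment> \<open>The neighbours of \<open>s\<close> are observed unshifted, so conditioning on
    \<open>Y\<close> is conditioning on \<open>X\<close>. Natural subtraction gives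
    \<open>s - 1\<close> different from \<open>s\<close> because \<open>s \<ge> 1\<close>.\<close>
  have sm: "Y (s - 1) \<omega> = X (s - 1) \<omega>" "Y (s + 1) \<omega> = X (s + 1) \<omega>" for \<omega>
    using \<open>s \<ge> 1\<close> by (simp_all add: assms(15) del: inar_X.simps)
  show ?thesis
  proof (intro conjI allI impI, goal_cases)
    case 1
    show ?case using alpha_estimator_limit[OF \<open>s \<ge> 1\<close>, of \<theta>] unfolding obs \<mu> .
  next
    case (2 m1 m2)
    have sh: "real (Y s \<omega>) - \<alpha> / (1 + \<alpha>\<^sup>2) * (real (Y (s - 1) \<omega>) + real (Y (s + 1) \<omega>)) - (1 - \<alpha>) / (1 + \<alpha>\<^sup>2) * eps_moment 1
       = real (Y s \<omega>) + outlier_shift (eps_moment 1) (real (Y (s - 1) \<omega>) + real (Y (s + 1) \<omega>)) \<alpha>" for \<omega>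
      by (simp add: outlier_shift_def)
    show ?case
      using theta_estimator_limit[OF \<open>s \<ge> 1\<close>, of m1 m2 \<theta>] 2
      unfolding \<mu> sh obs sm(1)[symmetric] sm(2)[symmetric] by (simp only:)
  qed
qed

end
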